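(* Let $m$ be a point of a Poisson manifold $(M,\Pi)$ of dimension $n$. Let $p_1,\dots,p_r$ be $r$ functions in involution, defined on a neighborhood of $m$, which vanish at $m$ and whose Hamiltonian vector fields are linearly independent at $m$. Then there exist, on a neighborhood $U$ of $m$, functions $q_1,\dots,q_r,z_1,\dots,z_{n-2r}$ such that (1) the $n$ functions $(p_1,q_1,\dots,p_r,q_r,z_1,\dots,z_{n-2r})$ form a system of coordinates on $U$, centered at $m$; (2) the Poisson structure $\Pi$ is given on $U$ by $$\Pi=\sum_{i=1}^r\frac{\partial}{\partial q_i}\wedge\frac{\partial}{\partial p_i}+\sum_{i,j=1}^{n-2r}g_{ij}(z)\frac{\partial}{\partial z_i}\wedge\frac{\partial}{\partial z_j},$$ where each $g_{ij}(z)$ is a smooth function on $U$ independent of $p_1,\dots,p_r,q_1,\dots,q_r$, and $g_{ij}=-g_{ji}$. Moreover, the rank of $\Pi$ at $m$ is $2r$ if and only if all the functions $g_{ij}(z)$ vanish for $z=0$.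
   Context: All manifolds and objects on them are smooth. A Poisson manifold $(M,\Pi)$ is a manifold with a bivector field $\Pi$ such that $\{f,g\}:=\Pi(\mathrm df,\mathrm dg)$ is a Lie bracket on $C^\infty(M)$; here $\left(\frac{\partial}{\partial q}\wedge\frac{\partial}{\partial p}\right)(\mathrm df,\mathrm dg)=\frac{\partial f}{\partial q}\frac{\partial g}{\partial p}-\frac{\partial g}{\partial q}\frac{\partial f}{\partial p}$. The Hamiltonian vector field of $h$ is $\mathcal X_h:=\{\cdot,h\}$. Functions are in involution if they pairwise Poisson commute. Coordinates are centered at $m$ if they all vanish at $m$. *)

theory Defs
  imports "HOL-Analysis.Analysis" "HOL-Library.Function_Algebras"
begin

section \<open>Smooth maps between Euclidean spaces\<close>

text \<open>
  Class \<open>C^k\<close> on an open set \<open>S\<close>: continuous for \<open>k = 0\<close>; for \<open>k + 1\<close>, differentiable on \<open>S\<close>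
  with every directional derivative of class \<open>C^k\<close>. These predicates are only used for open \<open>S\<close>.
\<close>

primrec Ck_on :: "nat \<Rightarrow> 'e::euclidean_space set \<Rightarrow> ('e \<Rightarrow> 'b::real_normed_vector) \<Rightarrow> bool" where
  "Ck_on 0 S f \<longleftrightarrow> continuous_on S f"
| "Ck_on (Suc k) S f \<longleftrightarrow>
     (\<forall>x\<in>S. f differentiable (at x)) \<and> (\<forall>v. Ck_on k S (\<lambda>x. frechet_derivative f (at x) v))"

definition smooth_on :: "'e::euclidean_space set \<Rightarrow> ('e \<Rightarrow> 'b::real_normed_vector) \<Rightarrow> bool" where
  "smooth_on S f \<longleftrightarrow> (\<forall>k. Ck_on k S f)"


section \<open>Smooth manifolds\<close>

text \<open>
  The manifold is the whole type \<open>'a\<close>, with a smooth atlas of charts with values in the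
  Euclidean space \<open>'e\<close>; its dimension is \<open>DIM('e)\<close>. In a chart \<open>(U, \<phi>)\<close> only the values of
  \<open>\<phi>\<close> on \<open>U\<close> matter.
\<close>

type_synonym ('a, 'e) chart = "'a set \<times> ('a \<Rightarrow> 'e)"

definition is_chart :: "('a::topological_space, 'e::euclidean_space) chart \<Rightarrow> bool" where
  "is_chart c \<longleftrightarrow> (case c of (U, \<phi>) \<Rightarrow>
     open U \<and> open (\<phi> ` U) \<and> (\<exists>\<psi>. homeomorphism U (\<phi> ` U) \<phi> \<psi>))"

definition smooth_transition ::
    "('a::topological_space, 'e::euclidean_space) chart \<Rightarrow> ('a, 'e) chart \<Rightarrow> bool" where
  "smooth_transition c d \<longleftrightarrow> (case c of (U, \<phi>) \<Rightarrow> case d of (V, \<psi>) \<Rightarrow>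
     smooth_on (\<phi> ` (U \<inter> V)) (\<psi> \<circ> inv_into U \<phi>))"

definition smooth_manifold ::
    "('a::{t2_space, second_countable_topology}, 'e::euclidean_space) chart set \<Rightarrow> bool" where
  "smooth_manifold A \<longleftrightarrow>
     (\<forall>c\<in>A. is_chart c) \<and> (\<Union>c\<in>A. fst c) = UNIV \<and> (\<forall>c\<in>A. \<forall>d\<in>A. smooth_transition c d)"

definition maximal_atlas ::
    "('a::topological_space, 'e::euclidean_space) chart set \<Rightarrow> ('a, 'e) chart set" where
  "maximal_atlas A =
     {c. is_chart c \<and> (\<forall>d\<in>A. smooth_transition c d \<and> smooth_transition d c)}"

text \<open>Smoothness on an open set \<open>V\<close> of a function, given as a total function on \<open>'a\<close>.\<close>

definition smooth_fun ::
    "('a::topological_space, 'e::euclidean_space) chart set \<Rightarrow> 'a set \<Rightarrow> ('a \<Rightarrow> real) \<Rightarrow> bool" where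
  "smooth_fun A V f \<longleftrightarrow> (\<forall>(U, \<phi>)\<in>A. smooth_on (\<phi> ` (U \<inter> V)) (f \<circ> inv_into U \<phi>))"

definition smooth_near ::
    "('a::topological_space, 'e::euclidean_space) chart set \<Rightarrow> 'a \<Rightarrow> ('a \<Rightarrow> real) set" where
  "smooth_near A m = {f. \<exists>V. open V \<and> m \<in> V \<and> smooth_fun A V f}"


section \<open>Tangent vectors, covectors, bivector fields\<close>

text \<open>
  Real-valued functions on a type, with pointwise operations, form a real vector space.
  Tangent vectors and covectors are represented by such functions.
\<close>

definition fscale :: "real \<Rightarrow> ('b \<Rightarrow> real) \<Rightarrow> 'b \<Rightarrow> real" where
  "fscale c f = (\<lambda>x. c * f x)"

lemma vector_space_fscale: "vector_space (fscale :: real \<Rightarrow> ('b \<Rightarrow> real) \<Rightarrow> 'b \<Rightarrow> real)"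
  by unfold_locales (auto simp: fscale_def fun_eq_iff algebra_simps)

type_synonym 'a tvec = "('a \<Rightarrow> real) \<Rightarrow> real"
type_synonym 'a covec = "'a tvec \<Rightarrow> real"
type_synonym 'a bivec = "'a covec \<Rightarrow> 'a covec \<Rightarrow> real"

text \<open>
  The tangent space at \<open>m\<close>: derivations at \<open>m\<close> of the functions smooth near \<open>m\<close>, extended by \<open>0\<close>
  to all other functions so that equal tangent vectors are equal as HOL functions. The Leibniz
  rule forces \<open>v f\<close> to depend only on the germ of \<open>f\<close> at \<open>m\<close> (multiply by the indicator function
  of a neighborhood of \<open>m\<close>).
\<close>

definition tangent_space ::
    "('a::topological_space, 'e::euclidean_space) chart set \<Rightarrow> 'a \<Rightarrow> 'a tvec set" where
  "tangent_space A m = {v.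
     (\<forall>f\<in>smooth_near A m. \<forall>g\<in>smooth_near A m. v (f + g) = v f + v g) \<and>
     (\<forall>c. \<forall>f\<in>smooth_near A m. v (fscale c f) = c * v f) \<and>
     (\<forall>f\<in>smooth_near A m. \<forall>g\<in>smooth_near A m. v (f * g) = f m * v g + g m * v f) \<and>
     (\<forall>f. f \<notin> smooth_near A m \<longrightarrow> v f = 0)}"

text \<open>The dual of the tangent space; again covectors are extended by \<open>0\<close>.\<close>

definition cotangent_space ::
    "('a::topological_space, 'e::euclidean_space) chart set \<Rightarrow> 'a \<Rightarrow> 'a covec set" where
  "cotangent_space A m = {\<alpha>.
     (\<forall>v\<in>tangent_space A m. \<forall>w\<in>tangent_space A m. \<alpha> (v + w) = \<alpha> v + \<alpha> w) \<and>
     (\<forall>c. \<forall>v\<in>tangent_space A m. \<alpha> (fscale c v) = c * \<alpha> v) \<and>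
     (\<forall>v. v \<notin> tangent_space A m \<longrightarrow> \<alpha> v = 0)}"

definition differential ::
    "('a::topological_space, 'e::euclidean_space) chart set \<Rightarrow> ('a \<Rightarrow> real) \<Rightarrow> 'a \<Rightarrow> 'a covec" where
  "differential A f m = (\<lambda>v. if v \<in> tangent_space A m then v f else 0)"

text \<open>
  Bivectors at \<open>m\<close>, that is elements of the second exterior power of the tangent space, are
  identified with the skew-symmetric bilinear forms on the cotangent space. Values outside the
  cotangent space are irrelevant.
\<close>

definition bivector_at ::
    "('a::topological_space, 'e::euclidean_space) chart set \<Rightarrow> 'a \<Rightarrow> 'a bivec \<Rightarrow> bool" where
  "bivector_at A m B \<longleftrightarrow>
     (\<forall>\<alpha>\<in>cotangent_space A m. \<forall>\<beta>\<in>cotangent_space A m. \<forall>\<gamma>\<in>cotangent_space A m.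
        B (\<alpha> + \<beta>) \<gamma> = B \<alpha> \<gamma> + B \<beta> \<gamma>) \<and>
     (\<forall>c. \<forall>\<alpha>\<in>cotangent_space A m. \<forall>\<beta>\<in>cotangent_space A m. B (fscale c \<alpha>) \<beta> = c * B \<alpha> \<beta>) \<and>
     (\<forall>\<alpha>\<in>cotangent_space A m. \<forall>\<beta>\<in>cotangent_space A m. B \<alpha> \<beta> = - B \<beta> \<alpha>)"

definition wedge :: "'a tvec \<Rightarrow> 'a tvec \<Rightarrow> 'a bivec" where
  "wedge v w = (\<lambda>\<alpha> \<beta>. \<alpha> v * \<beta> w - \<beta> v * \<alpha> w)"

text \<open>\<open>bracket A P f g\<close> is the function \<open>{f, g} = P(df, dg)\<close>.\<close>

definition bracket ::
    "('a::topological_space, 'e::euclidean_space) chart set \<Rightarrow> ('a \<Rightarrow> 'a bivec)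
      \<Rightarrow> ('a \<Rightarrow> real) \<Rightarrow> ('a \<Rightarrow> real) \<Rightarrow> 'a \<Rightarrow> real" where
  "bracket A P f g = (\<lambda>x. P x (differential A f x) (differential A g x))"

definition bivector_field ::
    "('a::topological_space, 'e::euclidean_space) chart set \<Rightarrow> ('a \<Rightarrow> 'a bivec) \<Rightarrow> bool" where
  "bivector_field A P \<longleftrightarrow>
     (\<forall>x. bivector_at A x (P x)) \<and>
     (\<forall>V f g. open V \<longrightarrow> smooth_fun A V f \<longrightarrow> smooth_fun A V g \<longrightarrow> smooth_fun A V (bracket A P f g))"


section \<open>Poisson structures\<close>

definition lie_bracket_on ::
    "('b \<Rightarrow> real) set \<Rightarrow> (('b \<Rightarrow> real) \<Rightarrow> ('b \<Rightarrow> real) \<Rightarrow> ('b \<Rightarrow> real)) \<Rightarrow> bool" where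
  "lie_bracket_on C br \<longleftrightarrow>
     (\<forall>f\<in>C. \<forall>g\<in>C. br f g \<in> C) \<and>
     (\<forall>f\<in>C. \<forall>g\<in>C. \<forall>h\<in>C. br (f + g) h = br f h + br g h \<and> br h (f + g) = br h f + br h g) \<and>
     (\<forall>c. \<forall>f\<in>C. \<forall>g\<in>C. br (fscale c f) g = fscale c (br f g) \<and> br f (fscale c g) = fscale c (br f g)) \<and>
     (\<forall>f\<in>C. br f f = 0) \<and>
     (\<forall>f\<in>C. \<forall>g\<in>C. \<forall>h\<in>C. br (br f g) h + br (br g h) f + br (br h f) g = 0)"

definition poisson_manifold ::
    "('a::{t2_space, second_countable_topology}, 'e::euclidean_space) chart set
      \<Rightarrow> ('a \<Rightarrow> 'a bivec) \<Rightarrow> bool" where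
  "poisson_manifold A P \<longleftrightarrow>
     smooth_manifold A \<and> bivector_field A P \<and>
     lie_bracket_on {f. smooth_fun A UNIV f} (bracket A P)"

text \<open>The value at \<open>x\<close> of the Hamiltonian vector field \<open>{_, h}\<close>.\<close>

definition hamiltonian_vf ::
    "('a::topological_space, 'e::euclidean_space) chart set \<Rightarrow> ('a \<Rightarrow> 'a bivec)
      \<Rightarrow> ('a \<Rightarrow> real) \<Rightarrow> 'a \<Rightarrow> 'a tvec" where
  "hamiltonian_vf A P h x = (\<lambda>f. if f \<in> smooth_near A x then bracket A P f h x else 0)"

text \<open>The linear map from the cotangent to the tangent space at \<open>x\<close> induced by \<open>P\<close>, and its rank.\<close>

definition sharp ::
    "('a::topological_space, 'e::euclidean_space) chart set \<Rightarrow> ('a \<Rightarrow> 'a bivec)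
      \<Rightarrow> 'a \<Rightarrow> 'a covec \<Rightarrow> 'a tvec" where
  "sharp A P x \<beta> = (\<lambda>f. if f \<in> smooth_near A x then P x (differential A f x) \<beta> else 0)"

definition poisson_rank ::
    "('a::topological_space, 'e::euclidean_space) chart set \<Rightarrow> ('a \<Rightarrow> 'a bivec) \<Rightarrow> 'a \<Rightarrow> nat" where
  "poisson_rank A P x = vector_space.dim fscale (sharp A P x ` cotangent_space A x)"

definition lin_indep_family :: "nat \<Rightarrow> (nat \<Rightarrow> 'b \<Rightarrow> real) \<Rightarrow> bool" where
  "lin_indep_family r v \<longleftrightarrow>
     (\<forall>c. (\<Sum>i<r. fscale (c i) (v i)) = 0 \<longrightarrow> (\<forall>i<r. c i = 0))"


section \<open>Systems of coordinates\<close>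

text \<open>
  A list of \<open>DIM('e)\<close> functions is assembled to a map into \<open>'e\<close> by means of an arbitrary, fixed
  enumeration of the standard basis.
\<close>

definition basis_enum :: "nat \<Rightarrow> 'e::euclidean_space" where
  "basis_enum = (SOME b. bij_betw b {..<DIM('e)} Basis)"

definition coord_map :: "('a \<Rightarrow> real) list \<Rightarrow> 'a \<Rightarrow> 'e::euclidean_space" where
  "coord_map xs y = (\<Sum>k<length xs. (xs ! k) y *\<^sub>R basis_enum k)"

definition coordinate_system ::
    "('a::topological_space, 'e::euclidean_space) chart set \<Rightarrow> 'a set \<Rightarrow> ('a \<Rightarrow> real) list \<Rightarrow> bool" where
  "coordinate_system A U xs \<longleftrightarrow> length xs = DIM('e) \<and> (U, coord_map xs) \<in> maximal_atlas A"

definition centered_at :: "'a \<Rightarrow> ('a \<Rightarrow> real) list \<Rightarrow> bool" where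
  "centered_at m xs \<longleftrightarrow> (\<forall>f\<in>set xs. f m = 0)"

text \<open>
  The coordinate vector at \<open>y\<close> belonging to the \<open>k\<close>-th (counted from 0) of the coordinates \<open>xs\<close>
  on \<open>U\<close>.
\<close>

definition coord_vf ::
    "('a::topological_space, 'e::euclidean_space) chart set \<Rightarrow> 'a set \<Rightarrow> ('a \<Rightarrow> real) list
      \<Rightarrow> nat \<Rightarrow> 'a \<Rightarrow> 'a tvec" where
  "coord_vf A U xs k y = (\<lambda>f. if f \<in> smooth_near A y then
     frechet_derivative (f \<circ> inv_into U (coord_map xs :: 'a \<Rightarrow> 'e)) (at (coord_map xs y)) (basis_enum k)
     else 0)"

text \<open>The list \<open>p 0, q 0, ..., p (r - 1), q (r - 1), z 0, ..., z (s - 1)\<close>.\<close>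

definition pqz :: "nat \<Rightarrow> nat \<Rightarrow> (nat \<Rightarrow> 'b) \<Rightarrow> (nat \<Rightarrow> 'b) \<Rightarrow> (nat \<Rightarrow> 'b) \<Rightarrow> 'b list" where
  "pqz r s p q z = concat (map (\<lambda>i. [p i, q i]) [0..<r]) @ map z [0..<s]"

lemma length_pqz: "length (pqz r s p q z) = 2 * r + s"
  by (induction r) (auto simp: pqz_def)

lemma pqz_nth:
  shows "i < r \<Longrightarrow> pqz r s p q z ! (2 * i) = p i"
    and "i < r \<Longrightarrow> pqz r s p q z ! (2 * i + 1) = q i"
    and "j < s \<Longrightarrow> pqz r s p q z ! (2 * r + j) = z j"
proof -
  let ?c = "\<lambda>r. concat (map (\<lambda>i. [p i, q i]) [0..<r])"
  have len: "length (?c r) = 2 * r" for r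
    by (induction r) auto
  have *: "i < r \<Longrightarrow> ?c r ! (2 * i) = p i \<and> ?c r ! (2 * i + 1) = q i" for r
    by (induction r) (auto simp: nth_append len less_Suc_eq)
  show "i < r \<Longrightarrow> pqz r s p q z ! (2 * i) = p i"
    and "i < r \<Longrightarrow> pqz r s p q z ! (2 * i + 1) = q i"
    using * by (auto simp: pqz_def nth_append len)
  show "j < s \<Longrightarrow> pqz r s p q z ! (2 * r + j) = z j"
    by (simp add: pqz_def nth_append len)
qed

end

theory Submission
  imports Defs
begin

text \<open>By the Jacobi identity, Hamiltonian vector fields of functions with constant mutual brackets
  commute, and commuting vector fields that are linearly independent at \<open>m\<close> can be straightened
  simultaneously. Straightening the fields of \<open>p\<^sub>1, \<dots>, p\<^sub>r, q\<^sub>1, \<dots>, q\<^sub>j\<close> yields a coordinate function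
  \<open>q\<^sub>j\<^sub>+\<^sub>1\<close> that is conjugate to \<open>p\<^sub>j\<^sub>+\<^sub>1\<close> and commutes with all the others; once all \<open>2r\<close> fields
  are straightened, the remaining coordinates are the \<open>z\<^sub>i\<close>. The brackets \<open>{z\<^sub>i, z\<^sub>j} = 2 g\<^sub>i\<^sub>j\<close> commute
  with all \<open>p\<^sub>k\<close> and \<open>q\<^sub>k\<close>, hence depend on \<open>z\<close> only.

  Vector fields are straightened one at a time by their flows. A flow is smooth because it is given by the
  fixed point \<open>u\<close> of \<open>u = x + t \<integral> X(u)\<close> in a Banach space of curves: its derivatives with respect to
  the parameters \<open>(t, x)\<close> solve linear equations \<open>(1 - K) w = c\<close> whose coefficients are as smooth as \<open>u\<close>.

  The Jacobi identity is available for globally defined functions only, so bump functions are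
  needed to apply it in a chart; tangent vectors are derivations, so Hadamard's lemma is needed to
  expand them in coordinates.\<close>

section \<open>Calculus of smooth maps\<close>

abbreviation FD :: "('a::real_normed_vector \<Rightarrow> 'b::real_normed_vector) \<Rightarrow> 'a \<Rightarrow> 'a \<Rightarrow> 'b" where
  "FD f x \<equiv> frechet_derivative f (at x)"

lemma FD_eqI: "(f has_derivative f') (at x) \<Longrightarrow> FD f x = f'"
  using frechet_derivative_at by metis

lemma FD_works: "f differentiable (at x) \<Longrightarrow> (f has_derivative FD f x) (at x)"
  by (simp add: frechet_derivative_works)

lemma FD_cong:
  assumes "open S" "x \<in> S" "\<And>y. y \<in> S \<Longrightarrow> f y = g y"
  shows "FD f x = FD g x"
proof -
  have "(f has_derivative f') (at x) = (g has_derivative f') (at x)" for f'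
    using has_derivative_transform_within_open[OF _ assms(1,2), of f f' UNIV g]
      has_derivative_transform_within_open[OF _ assms(1,2), of g f' UNIV f] assms(3) by metis
  then show ?thesis by (simp add: frechet_derivative_def)
qed

lemma differentiable_cong_open:
  assumes "open S" "x \<in> S" "\<And>y. y \<in> S \<Longrightarrow> f y = g y" "f differentiable (at x)"
  shows "g differentiable (at x)"
  using assms has_derivative_transform_within_open[OF _ assms(1,2), of f _ UNIV g]
  by (auto simp: differentiable_def)

lemma Ck_on_cong:
  assumes "open S" "\<And>x. x \<in> S \<Longrightarrow> f x = g x" "Ck_on k S f"
  shows "Ck_on k S g"
  using assms(2,3)
proof (induction k arbitrary: f g)
  case 0
  then show ?case using continuous_on_cong[of S S f g] by simp
next
  case (Suc k)
  have "Ck_on k S (\<lambda>x. FD g x v)" for v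
  proof (rule Suc.IH[of "\<lambda>x. FD f x v"])
    show "FD f x v = FD g x v" if "x \<in> S" for x
      using FD_cong[OF assms(1) that Suc.prems(1)] by simp
  qed (use Suc.prems in auto)
  moreover have "g differentiable at x" if "x \<in> S" for x
    using differentiable_cong_open[OF assms(1) that Suc.prems(1)] Suc.prems(2) that by simp
  ultimately show ?case by simp
qed

lemma Ck_on_subset: "Ck_on k S f \<Longrightarrow> T \<subseteq> S \<Longrightarrow> Ck_on k T f"
  by (induction k arbitrary: f) (auto intro: continuous_on_subset)

lemma Ck_on_SucD: "Ck_on (Suc k) S f \<Longrightarrow> Ck_on k S f"
proof (induction k arbitrary: f)
  case 0
  then show ?case
    by (auto intro!: continuous_at_imp_continuous_on differentiable_imp_continuous_within)
qed auto

lemma Ck_on_local: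
  assumes "open S" "\<And>x. x \<in> S \<Longrightarrow> \<exists>T. open T \<and> x \<in> T \<and> Ck_on k T f"
  shows "Ck_on k S f"
  using assms(2)
proof (induction k arbitrary: f)
  case 0
  have "continuous (at x) f" if "x \<in> S" for x
    using 0[OF that] by (auto simp: continuous_on_eq_continuous_at)
  then show ?case by (simp add: continuous_at_imp_continuous_on)
next
  case (Suc k)
  have "f differentiable at x" if "x \<in> S" for x
    using Suc.prems[OF that] by auto
  moreover have "Ck_on k S (\<lambda>x. FD f x v)" for v
  proof (rule Suc.IH)
    show "\<exists>T. open T \<and> x \<in> T \<and> Ck_on k T (\<lambda>x. FD f x v)" if "x \<in> S" for x
      using Suc.prems[OF that] by auto
  qed
  ultimately show ?case by simp
qed

lemma Ck_on_SucI:
  assumes "open S" "\<And>x. x \<in> S \<Longrightarrow> (f has_derivative f' x) (at x)" "\<And>v. Ck_on k S (\<lambda>x. f' x v)"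
  shows "Ck_on (Suc k) S f"
proof -
  have "Ck_on k S (\<lambda>x. FD f x v)" for v
    by (rule Ck_on_cong[OF assms(1) _ assms(3)[of v]]) (use FD_eqI assms(2) in metis)
  then show ?thesis using assms(2) by (auto simp: differentiable_def)
qed

lemma Ck_on_const [simp]: "Ck_on k S (\<lambda>x. c)"
proof (induction k arbitrary: c)
  case (Suc k)
  have "FD (\<lambda>x::'a. c) x v = 0" for x v by (simp add: FD_eqI)
  then show ?case using Suc by simp
qed simp

lemma Ck_on_bounded_linear: "bounded_linear f \<Longrightarrow> Ck_on k S f"
proof (cases k)
  case (Suc j)
  assume f: "bounded_linear f"
  then have "FD f x = f" for x by (simp add: FD_eqI bounded_linear_imp_has_derivative)
  then show ?thesis using f Suc by (simp add: bounded_linear_imp_differentiable)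
qed (simp add: linear_continuous_on)

lemma Ck_on_linear_comp:
  assumes "bounded_linear L" "open S" "Ck_on k S f"
  shows "Ck_on k S (\<lambda>x. L (f x))"
  using assms(3)
proof (induction k arbitrary: f)
  case 0
  then show ?case using bounded_linear.continuous_on[OF assms(1)] by simp
next
  case (Suc k)
  show ?case
    by (rule Ck_on_SucI[OF assms(2), where f' = "\<lambda>x v. L (FD f x v)"])
      (use Suc in \<open>auto intro!: bounded_linear.has_derivative[OF assms(1)] FD_works\<close>)
qed

lemma Ck_on_add:
  assumes "open S" "Ck_on k S f" "Ck_on k S g"
  shows "Ck_on k S (\<lambda>x. f x + g x)"
  using assms(2,3)
proof (induction k arbitrary: f g)
  case (Suc k)
  show ?case
    by (rule Ck_on_SucI[OF assms(1), where f' = "\<lambda>x v. FD f x v + FD g x v"])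
      (use Suc in \<open>auto intro!: has_derivative_add FD_works\<close>)
qed (auto intro: continuous_intros)

lemma Ck_on_sum:
  assumes "open S" "\<And>i. i \<in> I \<Longrightarrow> Ck_on k S (f i)"
  shows "Ck_on k S (\<lambda>x. \<Sum>i\<in>I. f i x)"
  using assms(2) by (induction I rule: infinite_finite_induct) (auto intro!: Ck_on_add[OF assms(1)])

lemma Ck_on_bilinear:
  assumes B: "bounded_bilinear B" and "open S" "Ck_on k S f" "Ck_on k S g"
  shows "Ck_on k S (\<lambda>x. B (f x) (g x))"
  using assms(3,4)
proof (induction k arbitrary: f g)
  case 0
  then show ?case using bounded_bilinear.continuous_on[OF B] by simp
next
  case (Suc k)
  show ?case
  proof (rule Ck_on_SucI[OF assms(2), where f' = "\<lambda>x v. B (f x) (FD g x v) + B (FD f x v) (g x)"])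
    show "((\<lambda>x. B (f x) (g x)) has_derivative (\<lambda>v. B (f x) (FD g x v) + B (FD f x v) (g x))) (at x)"
      if "x \<in> S" for x
      using Suc.prems that by (intro bounded_bilinear.FDERIV[OF B] FD_works) auto
    show "Ck_on k S (\<lambda>x. B (f x) (FD g x v) + B (FD f x v) (g x))" for v
      using Suc.prems Suc.prems[THEN Ck_on_SucD] by (intro Ck_on_add[OF assms(2)] Suc.IH) simp_all
  qed
qed

lemma bounded_linear_basis_sum:
  fixes g :: "'e::euclidean_space \<Rightarrow> 'b::real_normed_vector"
  assumes "bounded_linear g"
  shows "g w = (\<Sum>b\<in>Basis. (w \<bullet> b) *\<^sub>R g b)"
proof -
  interpret bounded_linear g by fact
  show ?thesis by (subst euclidean_representation[of w, symmetric]) (simp add: sum scaleR)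
qed

lemma Ck_on_compose:
  fixes g :: "'e::euclidean_space \<Rightarrow> 'f::euclidean_space" and f :: "'f \<Rightarrow> 'b::real_normed_vector"
  assumes "open S" "open T" "g ` S \<subseteq> T" "Ck_on k S g" "Ck_on k T f"
  shows "Ck_on k S (\<lambda>x. f (g x))"
  using assms(4,5)
proof (induction k arbitrary: f)
  case 0
  then show ?case using continuous_on_compose2[of T f S g] assms(3) by simp
next
  case (Suc k)
  have D: "x \<in> S \<Longrightarrow> f differentiable at (g x)" "x \<in> S \<Longrightarrow> g differentiable at x" for x
    using Suc.prems assms(3) by auto
  show ?case
  proof (rule Ck_on_SucI[OF assms(1)])
    show "((\<lambda>x. f (g x)) has_derivative (\<lambda>v. \<Sum>b\<in>Basis. (FD g x v \<bullet> b) *\<^sub>R FD f (g x) b)) (at x)"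
      if x: "x \<in> S" for x
    proof -
      have "((\<lambda>x. f (g x)) has_derivative (\<lambda>v. FD f (g x) (FD g x v))) (at x)"
        using has_derivative_compose[OF FD_works FD_works] D x by blast
      moreover have "FD f (g x) w = (\<Sum>b\<in>Basis. (w \<bullet> b) *\<^sub>R FD f (g x) b)" for w
        using FD_works[OF D(1)[OF x]] has_derivative_bounded_linear bounded_linear_basis_sum by blast
      then have "(\<lambda>v. FD f (g x) (FD g x v)) = (\<lambda>v. \<Sum>b\<in>Basis. (FD g x v \<bullet> b) *\<^sub>R FD f (g x) b)"
        by (rule ext)
      ultimately show ?thesis by metis
    qed
    have "Ck_on k S (\<lambda>x. FD g x v)" "Ck_on k S (\<lambda>x. FD f (g x) b)" for v b
      using Suc.prems Suc.prems(1)[THEN Ck_on_SucD] Suc.IH[of "\<lambda>y. FD f y b"] by simp_all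
    then show "Ck_on k S (\<lambda>x. \<Sum>b\<in>Basis. (FD g x v \<bullet> b) *\<^sub>R FD f (g x) b)" for v
      by (intro Ck_on_sum[OF assms(1)] Ck_on_bilinear[OF bounded_bilinear_scaleR assms(1)]
          Ck_on_linear_comp[OF bounded_linear_inner_left assms(1)])
  qed
qed

lemma smooth_on_differentiable: "smooth_on S f \<Longrightarrow> x \<in> S \<Longrightarrow> f differentiable (at x)"
  unfolding smooth_on_def by (metis Ck_on.simps(2))

lemma smooth_on_has_derivative: "smooth_on S f \<Longrightarrow> x \<in> S \<Longrightarrow> (f has_derivative FD f x) (at x)"
  by (simp add: FD_works smooth_on_differentiable)

lemma smooth_on_bounded_linear_FD: "smooth_on S f \<Longrightarrow> x \<in> S \<Longrightarrow> bounded_linear (FD f x)"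
  using smooth_on_has_derivative has_derivative_bounded_linear by blast

lemma smooth_on_continuous: "smooth_on S f \<Longrightarrow> continuous_on S f"
  unfolding smooth_on_def by (metis Ck_on.simps(1))

lemma smooth_on_FD: "smooth_on S f \<Longrightarrow> smooth_on S (\<lambda>x. FD f x v)"
  unfolding smooth_on_def by (metis Ck_on.simps(2))

lemma smooth_on_cong: "open S \<Longrightarrow> (\<And>x. x \<in> S \<Longrightarrow> f x = g x) \<Longrightarrow> smooth_on S f \<Longrightarrow> smooth_on S g"
  unfolding smooth_on_def by (blast intro: Ck_on_cong)

lemma smooth_on_subset: "smooth_on S f \<Longrightarrow> T \<subseteq> S \<Longrightarrow> smooth_on T f"
  unfolding smooth_on_def using Ck_on_subset by blast

lemma smooth_on_local:
  "open S \<Longrightarrow> (\<And>x. x \<in> S \<Longrightarrow> \<exists>T. open T \<and> x \<in> T \<and> smooth_on T f) \<Longrightarrow> smooth_on S f"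
proof -
  assume S: "open S" "\<And>x. x \<in> S \<Longrightarrow> \<exists>T. open T \<and> x \<in> T \<and> smooth_on T f"
  then show "smooth_on S f" unfolding smooth_on_def by (intro allI Ck_on_local) blast+
qed

lemma smooth_on_const [simp]: "smooth_on S (\<lambda>x. c)"
  by (simp add: smooth_on_def)

lemma smooth_on_bounded_linear: "bounded_linear f \<Longrightarrow> smooth_on S f"
  by (simp add: smooth_on_def Ck_on_bounded_linear)

lemma smooth_on_id [simp]: "smooth_on S (\<lambda>x. x)"
  by (simp add: smooth_on_bounded_linear bounded_linear_ident)

lemma smooth_on_linear_comp:
  "bounded_linear L \<Longrightarrow> open S \<Longrightarrow> smooth_on S f \<Longrightarrow> smooth_on S (\<lambda>x. L (f x))"
  by (simp add: smooth_on_def Ck_on_linear_comp)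

lemma smooth_on_add: "open S \<Longrightarrow> smooth_on S f \<Longrightarrow> smooth_on S g \<Longrightarrow> smooth_on S (\<lambda>x. f x + g x)"
  by (simp add: smooth_on_def Ck_on_add)

lemma smooth_on_sum:
  "open S \<Longrightarrow> (\<And>i. i \<in> I \<Longrightarrow> smooth_on S (f i)) \<Longrightarrow> smooth_on S (\<lambda>x. \<Sum>i\<in>I. f i x)"
  by (simp add: smooth_on_def Ck_on_sum)

lemma smooth_on_uminus:
  fixes f :: "'e::euclidean_space \<Rightarrow> 'b::real_normed_vector"
  shows "open S \<Longrightarrow> smooth_on S f \<Longrightarrow> smooth_on S (\<lambda>x. - f x)"
  by (rule smooth_on_linear_comp[OF bounded_linear_minus[OF bounded_linear_ident]])

lemma smooth_on_diff:
  "open S \<Longrightarrow> smooth_on S f \<Longrightarrow> smooth_on S g \<Longrightarrow> smooth_on S (\<lambda>x. f x - g x)"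
  using smooth_on_add[of S f "\<lambda>x. - g x"] smooth_on_uminus[of S g] by simp

lemma smooth_on_bilinear:
  "bounded_bilinear B \<Longrightarrow> open S \<Longrightarrow> smooth_on S f \<Longrightarrow> smooth_on S g \<Longrightarrow> smooth_on S (\<lambda>x. B (f x) (g x))"
  by (simp add: smooth_on_def Ck_on_bilinear)

lemmas smooth_on_mult = smooth_on_bilinear[OF bounded_bilinear_mult]
  and smooth_on_scaleR = smooth_on_bilinear[OF bounded_bilinear_scaleR]
  and smooth_on_inner = smooth_on_bilinear[OF bounded_bilinear_inner]

lemma smooth_on_compose:
  fixes g :: "'e::euclidean_space \<Rightarrow> 'f::euclidean_space" and f :: "'f \<Rightarrow> 'b::real_normed_vector"
  shows "open S \<Longrightarrow> open T \<Longrightarrow> g ` S \<subseteq> T \<Longrightarrow> smooth_on S g \<Longrightarrow> smooth_on T f \<Longrightarrow> smooth_on S (\<lambda>x. f (g x))"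
  by (simp add: smooth_on_def Ck_on_compose)

lemmas smooth_intros = smooth_on_add smooth_on_sum smooth_on_uminus smooth_on_diff smooth_on_mult
  smooth_on_scaleR smooth_on_inner

lemma smooth_on_FD_apply:
  fixes f :: "'e::euclidean_space \<Rightarrow> 'b::real_normed_vector"
  assumes "open S" "smooth_on S f" "smooth_on S X"
  shows "smooth_on S (\<lambda>x. FD f x (X x))"
proof (rule smooth_on_cong[OF assms(1)])
  show "(\<Sum>b\<in>Basis. (X x \<bullet> b) *\<^sub>R FD f x b) = FD f x (X x)" if "x \<in> S" for x
    using bounded_linear_basis_sum[OF smooth_on_bounded_linear_FD[OF assms(2) that]] by metis
  show "smooth_on S (\<lambda>x. \<Sum>b\<in>Basis. (X x \<bullet> b) *\<^sub>R FD f x b)"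
    using assms by (intro smooth_intros smooth_on_FD) auto
qed

lemma Ck_on_blinfun_bilinear:
  assumes "open S" "Ck_on k S F" "Ck_on k S G"
  shows "Ck_on k S (\<lambda>x. (F x :: 'c::real_normed_vector \<Rightarrow>\<^sub>L 'd::real_normed_vector) (G x))"
  using Ck_on_bilinear[OF bounded_bilinear_blinfun_apply] assms by blast

lemma has_derivative_bilinear_vanishing:
  assumes B: "bounded_bilinear B" and f: "continuous (at p) f"
    and g: "(g has_derivative g') (at p)" "g p = 0"
  shows "((\<lambda>x. B (f x) (g x)) has_derivative (\<lambda>v. B (f p) (g' v))) (at p)"
proof -
  interpret B: bounded_bilinear B by fact
  obtain K where K: "K > 0" "\<And>a b. norm (B a b) \<le> norm a * norm b * K" using B.pos_bounded by blast
  have 1: "((\<lambda>x. B (f p) (g x)) has_derivative (\<lambda>v. B (f p) (g' v))) (at p)"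
    using bounded_linear.has_derivative[OF B.bounded_linear_right g(1)] .
  obtain C where C: "\<forall>\<^sub>F x in at p. norm (g x) \<le> C * norm (x - p)" "C > 0"
  proof -
    obtain K' where K': "K' > 0" "\<And>v. norm (g' v) \<le> norm v * K'"
      using has_derivative_bounded_linear[OF g(1)] bounded_linear.pos_bounded by blast
    have "\<exists>d>0. \<forall>x'. 0 < norm (x' - p) \<and> norm (x' - p) < d \<longrightarrow>
       norm (g x' - g p - g' (x' - p)) / norm (x' - p) < 1"
      using g(1)[unfolded has_derivative_at'] zero_less_one by blast
    then obtain d where d: "d>0" "\<And>x'. 0 < norm (x' - p) \<and> norm (x' - p) < d \<Longrightarrow>
       norm (g x' - g p - g' (x' - p)) / norm (x' - p) < 1" by blast
    have "norm (g x) \<le> (1 + K') * norm (x - p)" if "x \<noteq> p" "dist x p < d" for x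
    proof -
      have "norm (g x - g' (x - p)) \<le> norm (x - p)"
        using d(2)[of x] that g(2) by (simp add: dist_norm divide_simps)
      then show ?thesis using K'(2)[of "x - p"] norm_triangle_sub[of "g x" "g' (x - p)"]
        by (simp add: algebra_simps)
    qed
    then have "\<forall>\<^sub>F x in at p. norm (g x) \<le> (1 + K') * norm (x - p)"
      using d(1) by (auto simp: eventually_at)
    then show ?thesis using that[of "1 + K'"] K' by auto
  qed
  have 2: "((\<lambda>x. B (f x - f p) (g x)) has_derivative (\<lambda>v. 0)) (at p)"
    unfolding has_derivative_within
  proof (intro conjI)
    have "((\<lambda>x. norm (B (f x - f p) (g x)) / norm (x - p)) \<longlongrightarrow> 0) (at p)"
    proof (rule tendsto_sandwich[OF _ _ tendsto_const])
      have "((\<lambda>x. norm (f x - f p)) \<longlongrightarrow> 0) (at p)"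
        using f by (simp add: continuous_at tendsto_norm_zero LIM_zero)
      then show "((\<lambda>x. norm (f x - f p) * (C * K)) \<longlongrightarrow> 0) (at p)"
        using tendsto_mult_left_zero by blast
      show "\<forall>\<^sub>F x in at p. 0 \<le> norm (B (f x - f p) (g x)) / norm (x - p)" by simp
      show "\<forall>\<^sub>F x in at p. norm (B (f x - f p) (g x)) / norm (x - p) \<le> norm (f x - f p) * (C * K)"
        using C(1) eventually_neq_at_within[of p p]
      proof eventually_elim
        case (elim x)
        have "norm (B (f x - f p) (g x)) \<le> norm (f x - f p) * norm (g x) * K" by (rule K(2))
        also have "\<dots> \<le> norm (f x - f p) * (C * norm (x - p)) * K"
          using elim K(1) by (intro mult_right_mono mult_left_mono) auto
        finally show ?case using elim by (simp add: divide_simps mult_ac)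
      qed
    qed
    then have "((\<lambda>x. norm ((1 / norm (x - p)) *\<^sub>R B (f x - f p) (g x))) \<longlongrightarrow> 0) (at p)"
      by simp
    then have "((\<lambda>x. (1 / norm (x - p)) *\<^sub>R B (f x - f p) (g x)) \<longlongrightarrow> 0) (at p)"
      by (rule tendsto_norm_zero_cancel)
    then show "((\<lambda>y. (1 / norm (y - p)) *\<^sub>R (B (f y - f p) (g y) - (B (f p - f p) (g p) + 0))) \<longlongrightarrow> 0) (at p)"
      by (simp add: g(2) B.zero_right)
  qed simp
  have "(\<lambda>x. B (f x) (g x)) = (\<lambda>x. B (f p) (g x) + B (f x - f p) (g x))"
    by (simp add: B.diff_left)
  then show ?thesis using has_derivative_add[OF 1 2] by simp
qed

text \<open>The resolvent identity \<open>M q - M p = - M q (L q - L p) M p\<close> first bounds \<open>M\<close> near \<open>p\<close>, then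
  gives continuity, differentiability and the formula for the derivative, and the order of
  differentiability follows by bootstrapping.\<close>

lemma Ck_on_inverse_blinfun:
  fixes L M :: "'e::euclidean_space \<Rightarrow> ('c::real_normed_vector \<Rightarrow>\<^sub>L 'c)"
  assumes S: "open S" and LM: "\<And>x. x \<in> S \<Longrightarrow> L x o\<^sub>L M x = id_blinfun" "\<And>x. x \<in> S \<Longrightarrow> M x o\<^sub>L L x = id_blinfun"
    and L: "Ck_on k S L"
  shows "Ck_on k S M"
proof -
  note bil = bounded_bilinear_blinfun_compose
  have idl: "id_blinfun o\<^sub>L a = a" "a o\<^sub>L id_blinfun = a" for a :: "'c \<Rightarrow>\<^sub>L 'c"
    by (auto intro!: blinfun_eqI)
  have res: "M q - M p = - (M q o\<^sub>L ((L q - L p) o\<^sub>L M p))" if "p \<in> S" "q \<in> S" for p q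
  proof -
    have "M q o\<^sub>L ((L q - L p) o\<^sub>L M p) = ((M q o\<^sub>L L q) o\<^sub>L M p) - (M q o\<^sub>L (L p o\<^sub>L M p))"
      by (auto intro!: blinfun_eqI simp: blinfun.bilinear_simps)
    then show ?thesis using LM that by (simp add: idl)
  qed
  have contL: "continuous_on S L" if "Ck_on k S L" for k
    using that
  proof (induction k)
    case (Suc k)
    then show ?case using Ck_on_SucD by blast
  qed simp
  have cont: "continuous (at p) M" if p: "p \<in> S" for p
  proof -
    have "((\<lambda>q. L q) \<longlongrightarrow> L p) (at p)"
      using contL[OF L] S p by (simp add: continuous_on_eq_continuous_at continuous_at)
    then have L0: "((\<lambda>q. norm (L q - L p)) \<longlongrightarrow> 0) (at p)" by (simp add: LIM_zero tendsto_norm_zero)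
    have inS: "\<forall>\<^sub>F q in at p. q \<in> S" using S p eventually_at_topological by blast
    have "\<forall>\<^sub>F q in at p. norm (L q - L p) * norm (M p) < 1/2"
      using order_tendstoD(2)[OF tendsto_mult_left_zero[OF L0, of "norm (M p)"], of "1/2"] by simp
    then have bd: "\<forall>\<^sub>F q in at p. norm (M q) \<le> 2 * norm (M p)" using inS
    proof eventually_elim
      case (elim q)
      have "norm (M q - M p) \<le> norm (M q) * (norm (L q - L p) * norm (M p))"
        unfolding res[OF p elim(2)] norm_minus_cancel
        by (meson norm_blinfun_compose mult_left_mono norm_ge_zero order_trans)
      also have "\<dots> \<le> norm (M q) * (1/2)" using elim by (intro mult_left_mono) auto
      finally show ?case using norm_triangle_sub[of "M q" "M p"] by simp
    qed
    have "((\<lambda>q. norm (M q - M p)) \<longlongrightarrow> 0) (at p)"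
    proof (rule tendsto_sandwich[OF _ _ tendsto_const])
      show "((\<lambda>q. norm (L q - L p) * (2 * norm (M p) * norm (M p))) \<longlongrightarrow> 0) (at p)"
        using tendsto_mult_left_zero[OF L0] by blast
      show "\<forall>\<^sub>F q in at p. norm (M q - M p) \<le> norm (L q - L p) * (2 * norm (M p) * norm (M p))"
        using bd inS
      proof eventually_elim
        case (elim q)
        have "norm (M q - M p) \<le> norm (M q) * (norm (L q - L p) * norm (M p))"
          unfolding res[OF p elim(2)] norm_minus_cancel
          by (meson norm_blinfun_compose mult_left_mono norm_ge_zero order_trans)
        also have "\<dots> \<le> (2 * norm (M p)) * (norm (L q - L p) * norm (M p))"
          using elim by (intro mult_right_mono) auto
        finally show ?case by (simp add: mult_ac)
      qed
    qed simp
    then show ?thesis unfolding continuous_at by (rule LIM_zero_cancel[OF tendsto_norm_zero_cancel])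
  qed
  have der: "(M has_derivative (\<lambda>v. - (M p o\<^sub>L (FD L p v o\<^sub>L M p)))) (at p)"
    if p: "p \<in> S" and d: "L differentiable (at p)" for p
  proof -
    have "((\<lambda>q. (L q - L p) o\<^sub>L M p) has_derivative (\<lambda>v. FD L p v o\<^sub>L M p)) (at p)"
      using bounded_linear.has_derivative[OF bounded_bilinear.bounded_linear_left[OF bil]
          has_derivative_diff[OF FD_works[OF d] has_derivative_const[of "L p"]]] by simp
    then have "((\<lambda>q. M q o\<^sub>L ((L q - L p) o\<^sub>L M p)) has_derivative (\<lambda>v. M p o\<^sub>L (FD L p v o\<^sub>L M p))) (at p)"
      by (intro has_derivative_bilinear_vanishing[OF bil cont[OF p]]) auto
    then have "((\<lambda>q. M p - (M q o\<^sub>L ((L q - L p) o\<^sub>L M p))) has_derivative (\<lambda>v. 0 - (M p o\<^sub>L (FD L p v o\<^sub>L M p)))) (at p)"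
      by (intro has_derivative_diff has_derivative_const)
    then have "((\<lambda>q. M p - (M q o\<^sub>L ((L q - L p) o\<^sub>L M p))) has_derivative (\<lambda>v. - (M p o\<^sub>L (FD L p v o\<^sub>L M p)))) (at p)"
      by simp
    then show ?thesis
    proof (rule has_derivative_transform_within_open[OF _ S p])
      show "M p - (M q o\<^sub>L ((L q - L p) o\<^sub>L M p)) = M q" if "q \<in> S" for q
        using res[OF p that] by (simp add: algebra_simps)
    qed
  qed
  show ?thesis using L
  proof (induction k)
    case 0
    then show ?case using cont by (simp add: continuous_at_imp_continuous_on)
  next
    case (Suc k)
    have M: "Ck_on k S M" using Suc.IH[OF Ck_on_SucD[OF Suc.prems]] .
    show ?case
    proof (rule Ck_on_SucI[OF S der])
      show "x \<in> S \<Longrightarrow> x \<in> S" "x \<in> S \<Longrightarrow> L differentiable at x" for x using Suc.prems by auto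
      show "Ck_on k S (\<lambda>x. - (M x o\<^sub>L (FD L x v o\<^sub>L M x)))" for v
        using Suc.prems M by (intro Ck_on_linear_comp[OF bounded_linear_minus[OF bounded_linear_ident]]
            Ck_on_bilinear[OF bil] S) auto
    qed
  qed
qed

section \<open>Flows\<close>

text \<open>The time interval is [0, 1]; functions are extended to the real line so as to live in the Banach
  space of bounded continuous functions.\<close>

definition bc_int :: "(real \<Rightarrow>\<^sub>C 'e) \<Rightarrow> (real \<Rightarrow>\<^sub>C 'e::euclidean_space)" where
  "bc_int f = Bcontfun (\<lambda>s. integral {0..min 1 (max 0 s)} f)"

definition bc_comp :: "('e \<Rightarrow> 'e) \<Rightarrow> (real \<Rightarrow>\<^sub>C 'e) \<Rightarrow> (real \<Rightarrow>\<^sub>C 'e::euclidean_space)" where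
  "bc_comp X u = Bcontfun (\<lambda>s. X (u s))"

definition bc_prod :: "'e \<Rightarrow> (real \<Rightarrow>\<^sub>C 'e) \<Rightarrow> (real \<Rightarrow>\<^sub>C 'e) \<Rightarrow> (real \<Rightarrow>\<^sub>C 'e::euclidean_space)" where
  "bc_prod b k f = Bcontfun (\<lambda>s. (k s \<bullet> b) *\<^sub>R f s)"

lemma Bcontfun_apply:
  assumes "continuous_on UNIV f" "\<And>s. norm (f s) \<le> c"
  shows "apply_bcontfun (Bcontfun f) = f"
  using bcontfun_normI[OF assms] by (simp add: Bcontfun_inverse)

lemma apply_integrable: "apply_bcontfun (f :: real \<Rightarrow>\<^sub>C 'e::euclidean_space) integrable_on {a..b}"
  by (intro integrable_continuous_real) simp

lemma norm_integral_bcontfun: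
  fixes f :: "real \<Rightarrow>\<^sub>C 'e::euclidean_space"
  shows "norm (integral {0..min 1 (max 0 s)} f) \<le> norm f"
proof -
  have "norm (integral {0..min 1 (max 0 s)} f) \<le> norm f * (min 1 (max 0 s) - 0)"
    by (rule integral_bound) (auto intro: norm_bounded)
  also have "\<dots> \<le> norm f * 1" by (intro mult_left_mono) auto
  finally show ?thesis by simp
qed

lemma bc_int_apply: "bc_int f s = integral {0..min 1 (max 0 s)} f"
proof -
  have "continuous_on {0..1} (\<lambda>x. integral {0..x} f)"
    by (rule indefinite_integral_continuous_1) (rule apply_integrable)
  then have "continuous_on UNIV (\<lambda>s. integral {0..min 1 (max 0 s)} f)"
    by (rule continuous_on_compose2) (auto intro!: continuous_intros)
  then show ?thesis
    unfolding bc_int_def using Bcontfun_apply norm_integral_bcontfun by metis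
qed

lemma norm_bc_int: "norm (bc_int f) \<le> norm f"
  by (intro norm_bound) (simp add: bc_int_apply norm_integral_bcontfun)

lemma bounded_linear_bc_int: "bounded_linear (bc_int :: (real \<Rightarrow>\<^sub>C 'e::euclidean_space) \<Rightarrow> _)"
proof
  show "bc_int (f + g) = bc_int f + bc_int g" for f g :: "real \<Rightarrow>\<^sub>C 'e"
    by (intro bcontfun_eqI) (simp add: bc_int_apply integral_add[OF apply_integrable apply_integrable])
  show "bc_int (r *\<^sub>R f) = r *\<^sub>R bc_int f" for f :: "real \<Rightarrow>\<^sub>C 'e" and r
    by (intro bcontfun_eqI) (simp add: bc_int_apply)
  show "\<exists>K. \<forall>x :: real \<Rightarrow>\<^sub>C 'e. norm (bc_int x) \<le> norm x * K"
    by (auto intro!: exI[of _ 1] norm_bc_int)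
qed

lemma bc_comp_apply:
  assumes "continuous_on UNIV X"
  shows "bc_comp X u s = X (u s)"
proof -
  have "compact (X ` cball 0 (norm u))"
    by (intro compact_continuous_image continuous_on_subset[OF assms]) auto
  then have "\<exists>c. \<forall>y\<in>X ` cball 0 (norm u). norm y \<le> c" using compact_imp_bounded bounded_iff by blast
  then obtain c where "\<forall>y\<in>X ` cball 0 (norm u). norm y \<le> c" by blast
  then have c: "norm (X y) \<le> c" if "norm y \<le> norm u" for y using that by simp
  have "continuous_on UNIV (\<lambda>s. X (u s))"
    using assms by (rule continuous_on_compose2) auto
  then have "apply_bcontfun (Bcontfun (\<lambda>s. X (u s))) = (\<lambda>s. X (u s))"
    using Bcontfun_apply c norm_bounded by metis
  then show ?thesis by (simp add: bc_comp_def)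
qed

lemma bc_prod_apply:
  assumes "b \<in> Basis"
  shows "bc_prod b k f s = (k s \<bullet> b) *\<^sub>R f s"
proof -
  have "norm ((k s \<bullet> b) *\<^sub>R f s) \<le> norm k * norm f" for s
    using Basis_le_norm[OF assms, of "k s"] norm_bounded[of k s] norm_bounded[of f s]
    by (auto intro!: mult_mono)
  then have "apply_bcontfun (Bcontfun (\<lambda>s. (k s \<bullet> b) *\<^sub>R f s)) = (\<lambda>s. (k s \<bullet> b) *\<^sub>R f s)"
    by (intro Bcontfun_apply) (auto intro!: continuous_intros)
  then show ?thesis by (simp add: bc_prod_def)
qed

lemma bounded_bilinear_bc_prod:
  assumes "b \<in> Basis" shows "bounded_bilinear (bc_prod (b::'e::euclidean_space))"
proof
  note [simp] = bc_prod_apply[OF assms]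
  show "bc_prod b (k + k') f = bc_prod b k f + bc_prod b k' f"
    "bc_prod b k (f + f') = bc_prod b k f + bc_prod b k f'" for k k' f f'
    by (auto intro!: bcontfun_eqI simp: algebra_simps)
  show "bc_prod b (r *\<^sub>R k) f = r *\<^sub>R bc_prod b k f" "bc_prod b k (r *\<^sub>R f) = r *\<^sub>R bc_prod b k f" for r k f
    by (auto intro!: bcontfun_eqI)
  have "norm (bc_prod b k f) \<le> norm k * norm f * 1" for k f
  proof (rule norm_bound)
    show "norm (bc_prod b k f s) \<le> norm k * norm f * 1" for s
      using Basis_le_norm[OF assms, of "k s"] norm_bounded[of k s] norm_bounded[of f s]
      by (auto intro!: mult_mono)
  qed
  then show "\<exists>K. \<forall>k f. norm (bc_prod b k f) \<le> norm k * norm f * K" by blast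
qed

lemma isCont_bc_comp:
  assumes X: "continuous_on UNIV X"
  shows "isCont (bc_comp X) u"
proof (rule continuous_at_eps_delta[THEN iffD2], safe)
  fix e :: real assume e: "e > 0"
  have "uniformly_continuous_on (cball 0 (norm u + 1)) X"
    by (intro compact_uniformly_continuous continuous_on_subset[OF X]) auto
  then obtain d where d: "d > 0" "\<And>x x'. \<lbrakk>norm x \<le> norm u + 1; norm x' \<le> norm u + 1; dist x' x < d\<rbrakk> \<Longrightarrow> dist (X x') (X x) < e/2"
    unfolding uniformly_continuous_on_def using e by (metis half_gt_zero mem_cball_0)
  have "dist (bc_comp X v) (bc_comp X u) < e" if v: "dist v u < min d 1" for v
  proof -
    have "dist (bc_comp X v) (bc_comp X u) \<le> e/2"
    proof (rule dist_bound)
      fix s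
      have "dist (v s) (u s) < min d 1" using dist_fun_lt_imp_dist_val_lt[OF v] .
      moreover have "norm (u s) \<le> norm u" by (rule norm_bounded)
      moreover have "norm (v s) \<le> norm (u s) + dist (v s) (u s)"
        by (metis dist_norm norm_triangle_sub)
      ultimately show "dist (bc_comp X v s) (bc_comp X u s) \<le> e/2"
        using d(2)[of "u s" "v s"] by (simp add: bc_comp_apply[OF X])
    qed
    then show ?thesis using e by simp
  qed
  then show "\<exists>d>0. \<forall>x'. dist x' u < d \<longrightarrow> dist (bc_comp X x') (bc_comp X u) < e"
    using d(1) by (metis min_less_iff_conj zero_less_one)
qed

definition bc_comp_deriv :: "('e \<Rightarrow> 'e) \<Rightarrow> (real \<Rightarrow>\<^sub>C 'e) \<Rightarrow> (real \<Rightarrow>\<^sub>C 'e) \<Rightarrow> (real \<Rightarrow>\<^sub>C 'e::euclidean_space)" where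
  "bc_comp_deriv X u k = (\<Sum>b\<in>Basis. bc_prod b k (bc_comp (\<lambda>y. FD X y b) u))"

lemma apply_bcontfun_sum: "apply_bcontfun (\<Sum>i\<in>I. f i) s = (\<Sum>i\<in>I. apply_bcontfun (f i) s)"
  for f :: "'i \<Rightarrow> 'a::topological_space \<Rightarrow>\<^sub>C 'b::real_normed_vector"
  by (induction I rule: infinite_finite_induct) auto

lemma Ck_on_1_facts:
  assumes "Ck_on (Suc 0) UNIV X"
  shows "continuous_on UNIV X" "continuous_on UNIV (\<lambda>y. FD X y b)" "(X has_derivative FD X y) (at y)"
  using assms Ck_on_SucD[OF assms] by (auto intro: FD_works)

lemma bc_comp_deriv_apply:
  fixes X :: "'e::euclidean_space \<Rightarrow> 'e"
  assumes "Ck_on (Suc 0) UNIV X"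
  shows "bc_comp_deriv X u k s = FD X (u s) (k s)"
proof -
  have "bounded_linear (FD X (u s))"
    using Ck_on_1_facts(3)[OF assms] has_derivative_bounded_linear by blast
  then show ?thesis
    unfolding bc_comp_deriv_def apply_bcontfun_sum
    using bounded_linear_basis_sum[of "FD X (u s)" "k s"]
    by (simp add: bc_prod_apply bc_comp_apply[OF Ck_on_1_facts(2)[OF assms]])
qed

lemma bounded_linear_bc_comp_deriv: "bounded_linear (bc_comp_deriv X u)"
  unfolding bc_comp_deriv_def
  by (intro bounded_linear_sum bounded_bilinear.bounded_linear_left[OF bounded_bilinear_bc_prod])

lemma bc_comp_has_derivative:
  fixes X :: "'e::euclidean_space \<Rightarrow> 'e"
  assumes X: "Ck_on (Suc 0) UNIV X"
  shows "(bc_comp X has_derivative bc_comp_deriv X u) (at u)"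
  unfolding has_derivative_at_alt
proof (intro conjI bounded_linear_bc_comp_deriv allI impI)
  fix e :: real assume e: "e > 0"
  define D where "D = real DIM('e)"
  have D: "D > 0" by (simp add: D_def)
  have blin: "bounded_linear (FD X y)" for y
    using Ck_on_1_facts(3)[OF X] has_derivative_bounded_linear by blast
  let ?K = "cball (0::'e) (norm u + 1)"
  have "uniformly_continuous_on ?K (\<lambda>y. FD X y b)" for b
    by (intro compact_uniformly_continuous continuous_on_subset[OF Ck_on_1_facts(2)[OF X]]) auto
  then have "\<exists>d>0. \<forall>x\<in>?K. \<forall>x'\<in>?K. dist x' x < d \<longrightarrow> dist (FD X x' b) (FD X x b) < e / D" for b
    unfolding uniformly_continuous_on_def using e D by (metis divide_pos_pos)
  then obtain d where d: "\<And>b. d b > 0" "\<And>b x x'. \<lbrakk>x \<in> ?K; x' \<in> ?K; dist x' x < d b\<rbrakk> \<Longrightarrow> dist (FD X x' b) (FD X x b) < e / D"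
    by metis
  define d0 where "d0 = min 1 (Min (d ` Basis))"
  have d0: "d0 > 0" "d0 \<le> 1" "\<And>b. b \<in> Basis \<Longrightarrow> d0 \<le> d b"
    using d(1) by (auto simp: d0_def min.coboundedI2)
  have "norm (bc_comp X v - bc_comp X u - bc_comp_deriv X u (v - u)) \<le> e * norm (v - u)"
    if v: "norm (v - u) < d0" for v
  proof (rule norm_bound)
    fix s
    let ?S = "cball (u s) (norm (v s - u s))"
    have vu: "norm (v s - u s) \<le> norm (v - u)" using norm_bounded[of "v - u" s] by simp
    have "norm (X (v s) - X (u s) - FD X (u s) (v s - u s)) \<le> norm (v s - u s) * e"
    proof (rule differentiable_bound_linearization[where S = ?S and f' = "FD X"])
      show "u s + t *\<^sub>R (v s - u s) \<in> ?S" if "t \<in> {0..1}" for t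
        using that by (simp add: dist_norm mult_left_le_one_le)
      show "(X has_derivative FD X x) (at x within ?S)" for x
        using Ck_on_1_facts(3)[OF X] has_derivative_at_withinI by blast
      show "u s \<in> ?S" by simp
      fix x assume x: "x \<in> ?S"
      have xK: "x \<in> ?K" "u s \<in> ?K"
      proof -
        have "norm x \<le> norm (u s) + norm (v s - u s)"
          using x norm_triangle_sub[of x "u s"] by (simp add: dist_norm norm_minus_commute)
        then show "x \<in> ?K" using norm_bounded[of u s] vu v d0 by simp
        show "u s \<in> ?K" using norm_bounded[of u s] by simp
      qed
      show "onorm (FD X x - FD X (u s)) \<le> e"
      proof (rule onorm_le)
        fix w :: 'e
        have "(FD X x - FD X (u s)) w = (\<Sum>b\<in>Basis. (w \<bullet> b) *\<^sub>R (FD X x b - FD X (u s) b))"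
          unfolding minus_apply bounded_linear_basis_sum[OF blin, of x w] bounded_linear_basis_sum[OF blin, of "u s" w]
          by (simp only: sum_subtractf scaleR_diff_right)
        also have "norm \<dots> \<le> (\<Sum>b\<in>(Basis::'e set). norm w * (e / D))"
        proof (rule sum_norm_le)
          fix b :: 'e assume b: "b \<in> Basis"
          have "dist (FD X x b) (FD X (u s) b) < e / D"
            using d(2)[of "u s" x b] xK x d0(3)[OF b] v vu by (simp add: dist_commute)
          then show "norm ((w \<bullet> b) *\<^sub>R (FD X x b - FD X (u s) b)) \<le> norm w * (e / D)"
            unfolding norm_scaleR dist_norm by (intro mult_mono Basis_le_norm[OF b]) simp_all
        qed
        also have "\<dots> = e * norm w" using D by (simp add: D_def)
        finally show "norm ((FD X x - FD X (u s)) w) \<le> e * norm w" .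
      qed
    qed
    also have "\<dots> \<le> e * norm (v - u)" using vu e by (simp add: mult.commute)
    finally show "norm ((bc_comp X v - bc_comp X u - bc_comp_deriv X u (v - u)) s) \<le> e * norm (v - u)"
      by (simp add: bc_comp_deriv_apply[OF X] bc_comp_apply[OF Ck_on_1_facts(1)[OF X]])
  qed
  then show "\<exists>d>0. \<forall>v. norm (v - u) < d \<longrightarrow> norm (bc_comp X v - bc_comp X u - bc_comp_deriv X u (v - u)) \<le> e * norm (v - u)"
    using d0 by blast
qed

lemma Ck_on_bc_comp:
  fixes U :: "'p::euclidean_space \<Rightarrow> (real \<Rightarrow>\<^sub>C 'e::euclidean_space)"
  assumes "open S" "Ck_on k S U" "Ck_on k UNIV X"
  shows "Ck_on k S (\<lambda>p. bc_comp X (U p))"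
  using assms(2,3)
proof (induction k arbitrary: X)
  case 0
  then show ?case
    using continuous_on_compose2[OF continuous_at_imp_continuous_on[of UNIV "bc_comp X"]] isCont_bc_comp
    by auto
next
  case (Suc k)
  have X1: "Ck_on (Suc 0) UNIV X"
  proof -
    have "Ck_on 0 UNIV f" if "Ck_on j UNIV f" for j and f :: "'e \<Rightarrow> 'e"
      using that
    proof (induction j)
      case (Suc j)
      then show ?case using Ck_on_SucD by blast
    qed
    then show ?thesis using Suc.prems(2) by auto
  qed
  show ?case
  proof (rule Ck_on_SucI[OF assms(1)])
    show "((\<lambda>p. bc_comp X (U p)) has_derivative (\<lambda>v. bc_comp_deriv X (U p) (FD U p v))) (at p)" if "p \<in> S" for p
      using has_derivative_compose[OF FD_works bc_comp_has_derivative[OF X1], of U p] Suc.prems(1) that by simp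
    show "Ck_on k S (\<lambda>p. bc_comp_deriv X (U p) (FD U p v))" for v
      unfolding bc_comp_deriv_def
    proof (intro Ck_on_sum[OF assms(1)] Ck_on_bilinear[OF bounded_bilinear_bc_prod assms(1)])
      show "Ck_on k S (\<lambda>x. bc_comp (\<lambda>y. FD X y i) (U x))" for i
        using Suc.IH[of "\<lambda>y. FD X y i"] Suc.prems Ck_on_SucD by auto
      show "Ck_on k S (\<lambda>x. FD U x v)" using Suc.prems by simp
    qed
  qed
qed

lemma blinfun_neumann:
  fixes K :: "'c::{real_normed_vector, complete_space} \<Rightarrow>\<^sub>L 'c"
  assumes "norm K \<le> 1/2"
  obtains M where "(id_blinfun - K) o\<^sub>L M = id_blinfun" "M o\<^sub>L (id_blinfun - K) = id_blinfun"
proof -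
  have nK: "norm (K x) \<le> norm x / 2" for x
    using norm_blinfun[of K x] mult_right_mono[OF assms, of "norm x"] by simp
  have ex1: "\<exists>!u. c + K u = u" for c
  proof (rule banach_fix_type[where c = "1/2"])
    show "\<forall>x y. dist (c + K x) (c + K y) \<le> 1/2 * dist x y"
      using nK[of "_ - _"] by (simp add: dist_norm blinfun.diff_right)
  qed auto
  define m where "m c = (THE u. c + K u = u)" for c
  have m: "c + K (m c) = m c" for c unfolding m_def by (rule theI'[OF ex1])
  have mI: "m c = u" if "c + K u = u" for c u using ex1 m that by blast
  have "bounded_linear m"
  proof
    show "m (a + b) = m a + m b" for a b
      by (rule mI) (metis (no_types, lifting) m add.assoc add.left_commute blinfun.add_right)
    show "m (r *\<^sub>R a) = r *\<^sub>R m a" for r a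
      by (rule mI) (metis m blinfun.scaleR_right scaleR_right_distrib)
    have "norm (m c) \<le> norm c * 2" for c
      using nK[of "m c"] norm_triangle_ineq[of c "K (m c)"] m[of c] by simp
    then show "\<exists>K. \<forall>x. norm (m x) \<le> norm x * K" by blast
  qed
  then have *: "blinfun_apply (Blinfun m) = m" by (rule bounded_linear_Blinfun_apply)
  show thesis
  proof (rule that[of "Blinfun m"]; rule blinfun_eqI)
    show "((id_blinfun - K) o\<^sub>L Blinfun m) c = id_blinfun c" for c
      using m[of c] by (simp add: * blinfun.bilinear_simps algebra_simps)
    show "(Blinfun m o\<^sub>L (id_blinfun - K)) c = id_blinfun c" for c
      by (simp add: * blinfun.bilinear_simps mI)
  qed
qed

lemma bounded_linear_const_bcontfun:
  "bounded_linear (const_bcontfun :: 'e::euclidean_space \<Rightarrow> (real \<Rightarrow>\<^sub>C 'e))"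
proof
  show "\<exists>K. \<forall>x::'e. norm (const_bcontfun x :: real \<Rightarrow>\<^sub>C 'e) \<le> norm x * K"
    by (intro exI[of _ 1] allI norm_bound) simp
qed (auto intro!: bcontfun_eqI)

lemma bounded_linear_eval_bcontfun:
  "bounded_linear (\<lambda>u :: real \<Rightarrow>\<^sub>C 'e::euclidean_space. apply_bcontfun u s)"
proof
  show "\<exists>K. \<forall>x :: real \<Rightarrow>\<^sub>C 'e. norm (apply_bcontfun x s) \<le> norm x * K"
    by (intro exI[of _ 1]) (simp add: norm_bounded)
qed auto

locale lipschitz_field =
  fixes X :: "'e::euclidean_space \<Rightarrow> 'e" and L :: real
  assumes smooth: "smooth_on UNIV X" and L: "L > 0"
    and bound: "\<And>y w. norm (FD X y w) \<le> L * norm w"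
begin

lemma X1: "Ck_on (Suc 0) UNIV X" and contX: "continuous_on UNIV X"
  using smooth smooth_on_continuous by (auto simp: smooth_on_def simp del: Ck_on.simps)

lemma FD_scaleR: "FD X y (r *\<^sub>R w) = r *\<^sub>R FD X y w"
proof -
  have "bounded_linear (FD X y)"
    using Ck_on_1_facts(3)[OF X1] has_derivative_bounded_linear by blast
  then show ?thesis by (simp add: linear_cmul bounded_linear.linear)
qed

lemma lipschitz: "norm (X y - X z) \<le> L * norm (y - z)"
proof (rule differentiable_bound[of UNIV X "FD X"])
  show "(X has_derivative FD X x) (at x within UNIV)" for x using Ck_on_1_facts(3)[OF X1] by simp
  show "onorm (FD X x) \<le> L" for x by (rule onorm_le) (rule bound)
qed auto

lemma norm_bc_comp_diff: "norm (bc_comp X u - bc_comp X v) \<le> L * norm (u - v)"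
proof (rule norm_bound)
  show "norm ((bc_comp X u - bc_comp X v) s) \<le> L * norm (u - v)" for s
    using order_trans[OF lipschitz[of "u s" "v s"] mult_left_mono[OF norm_bounded[of "u - v" s, simplified], of L]] L
    by (simp add: bc_comp_apply[OF contX])
qed

lemma norm_bc_comp_deriv: "norm (bc_comp_deriv X u k) \<le> L * norm k"
proof (rule norm_bound)
  show "norm (bc_comp_deriv X u k s) \<le> L * norm k" for s
    using order_trans[OF bound[of "u s" "k s"] mult_left_mono[OF norm_bounded[of k s], of L]] L
    by (simp add: bc_comp_deriv_apply[OF X1])
qed

definition flow_time where "flow_time = 1 / (2 * L)"

lemma flow_time_pos: "flow_time > 0" using L by (simp add: flow_time_def)

lemma contraction: assumes "\<bar>t\<bar> \<le> flow_time" "norm f \<le> L * a"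
  shows "norm (t *\<^sub>R bc_int f) \<le> a / 2"
proof -
  have "norm (t *\<^sub>R bc_int f) \<le> flow_time * (L * a)"
    using assms norm_bc_int[of f] flow_time_pos by (auto intro!: mult_mono)
  then show ?thesis using L by (simp add: flow_time_def)
qed

definition sol :: "real \<Rightarrow> (real \<Rightarrow>\<^sub>C 'e) \<Rightarrow> (real \<Rightarrow>\<^sub>C 'e)" where
  "sol t c = (THE u. c + t *\<^sub>R bc_int (bc_comp X u) = u)"

lemma sol_ex1: assumes "\<bar>t\<bar> \<le> flow_time" shows "\<exists>!u. c + t *\<^sub>R bc_int (bc_comp X u) = u"
proof (rule banach_fix_type[where c = "1/2"])
  have "norm (t *\<^sub>R bc_int (bc_comp X u) - t *\<^sub>R bc_int (bc_comp X v)) \<le> norm (u - v) / 2" for u v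
    using contraction[OF assms norm_bc_comp_diff, of u v]
    by (simp add: bounded_linear.linear[OF bounded_linear_bc_int, THEN linear_diff] scaleR_diff_right)
  then show "\<forall>u v. dist (c + t *\<^sub>R bc_int (bc_comp X u)) (c + t *\<^sub>R bc_int (bc_comp X v)) \<le> 1/2 * dist u v"
    by (simp add: dist_norm)
qed auto

lemma sol_eq: "\<bar>t\<bar> \<le> flow_time \<Longrightarrow> c + t *\<^sub>R bc_int (bc_comp X (sol t c)) = sol t c"
  unfolding sol_def by (rule theI'[OF sol_ex1])

lemma sol_unique: "\<bar>t\<bar> \<le> flow_time \<Longrightarrow> c + t *\<^sub>R bc_int (bc_comp X u) = u \<Longrightarrow> sol t c = u"
  using sol_ex1 sol_eq by blast

lemma bc_int_diff: "bc_int (f - g) = bc_int f - bc_int g"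
  by (simp add: bounded_linear.linear[OF bounded_linear_bc_int, THEN linear_diff])

lemma sol_lipschitz:
  assumes "\<bar>t\<bar> \<le> flow_time" "\<bar>t'\<bar> \<le> flow_time"
  shows "norm (sol t' c' - sol t c) \<le> 2 * (norm (c' - c) + \<bar>t' - t\<bar> * norm (bc_int (bc_comp X (sol t c))))"
proof -
  let ?u = "sol t c" and ?v = "sol t' c'"
  have "?v - ?u = (c' + t' *\<^sub>R bc_int (bc_comp X ?v)) - (c + t *\<^sub>R bc_int (bc_comp X ?u))"
    using sol_eq assms by simp
  also have "\<dots> = (c' - c) + (t' *\<^sub>R bc_int (bc_comp X ?v - bc_comp X ?u) + (t' - t) *\<^sub>R bc_int (bc_comp X ?u))"
    by (simp add: bc_int_diff algebra_simps)
  finally have "norm (?v - ?u) \<le> norm (c' - c) + (norm (t' *\<^sub>R bc_int (bc_comp X ?v - bc_comp X ?u)) + norm ((t' - t) *\<^sub>R bc_int (bc_comp X ?u)))"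
    by (metis (no_types) norm_triangle_le[OF add_left_mono[OF norm_triangle_ineq]])
  then show ?thesis using contraction[OF assms(2) norm_bc_comp_diff, of ?v ?u] by simp
qed

definition lin_op :: "real \<Rightarrow> (real \<Rightarrow>\<^sub>C 'e) \<Rightarrow> ((real \<Rightarrow>\<^sub>C 'e) \<Rightarrow>\<^sub>L (real \<Rightarrow>\<^sub>C 'e))" where
  "lin_op t u = t *\<^sub>R (\<Sum>b\<in>Basis. Blinfun bc_int o\<^sub>L bounded_bilinear.prod_left (bc_prod b) (bc_comp (\<lambda>y. FD X y b) u))"

lemma blinfun_sum_apply: "blinfun_apply (\<Sum>i\<in>I. f i) x = (\<Sum>i\<in>I. blinfun_apply (f i) x)"
  by (induction I rule: infinite_finite_induct) (auto simp: blinfun.bilinear_simps)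

lemma lin_op_apply: "lin_op t u k = t *\<^sub>R bc_int (bc_comp_deriv X u k)"
proof -
  have "bc_int (\<Sum>b\<in>Basis. f b) = (\<Sum>b\<in>Basis. bc_int (f b))" for f :: "'e \<Rightarrow> (real \<Rightarrow>\<^sub>C 'e)"
    by (simp add: bounded_linear.linear[OF bounded_linear_bc_int, THEN linear_sum])
  then show ?thesis
    by (simp add: lin_op_def blinfun.bilinear_simps blinfun_sum_apply bc_comp_deriv_def
        bounded_linear_Blinfun_apply[OF bounded_linear_bc_int]
        bounded_bilinear.prod_left.rep_eq[OF bounded_bilinear_bc_prod] cong: sum.cong)
qed

lemma norm_lin_op: assumes "\<bar>t\<bar> \<le> flow_time" shows "norm (lin_op t u) \<le> 1/2"
proof (rule norm_blinfun_bound)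
  show "norm (lin_op t u k) \<le> 1/2 * norm k" for k
    using contraction[OF assms norm_bc_comp_deriv, of u k] by (simp add: lin_op_apply)
qed simp

lemma sol_differentiable:
  assumes t: "\<bar>t\<bar> < flow_time"
  shows "(\<lambda>p. sol (fst p) (snd p)) differentiable (at (t, c))"
proof -
  define f where "f p = (fst p, snd p - fst p *\<^sub>R bc_int (bc_comp X (snd p)))" for p :: "real \<times> (real \<Rightarrow>\<^sub>C 'e)"
  define g where "g p = (fst p, sol (fst p) (snd p))" for p :: "real \<times> (real \<Rightarrow>\<^sub>C 'e)"
  define W :: "(real \<times> (real \<Rightarrow>\<^sub>C 'e)) set" where "W = {-flow_time<..<flow_time} \<times> UNIV"
  let ?u = "sol t c"
  let ?a = "bc_int (bc_comp X ?u)"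
  obtain M where M: "(id_blinfun - lin_op t ?u) o\<^sub>L M = id_blinfun" "M o\<^sub>L (id_blinfun - lin_op t ?u) = id_blinfun"
    using blinfun_neumann[OF norm_lin_op[of t ?u]] t by auto
  have MK: "M (k - lin_op t ?u k) = k" for k
    using arg_cong[OF M(2), of "\<lambda>B. blinfun_apply B k"] by (simp add: blinfun.bilinear_simps)
  have "(g has_derivative (\<lambda>(s, k). (s, M (k + s *\<^sub>R ?a)))) (at (t, c))"
  proof (rule has_derivative_inverse_basic)
    show "(f has_derivative (\<lambda>(s, k). (s, k - (s *\<^sub>R ?a + lin_op t ?u k)))) (at (g (t, c)))"
    proof -
      have 1: "((\<lambda>p. bc_int (bc_comp X (snd p))) has_derivative (\<lambda>p. bc_int (bc_comp_deriv X ?u (snd p)))) (at (t, ?u))"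
        using bounded_linear.has_derivative[OF bounded_linear_bc_int
            has_derivative_compose[OF has_derivative_snd[OF has_derivative_ident] bc_comp_has_derivative[OF X1]], of "(t, ?u)"]
        by simp
      show ?thesis unfolding f_def g_def
        by (rule has_derivative_eq_rhs) (auto intro!: derivative_eq_intros 1 simp: fun_eq_iff lin_op_apply split: prod.splits)
    qed
    show "bounded_linear (\<lambda>(s, k). (s, M (k + s *\<^sub>R ?a)))"
      unfolding case_prod_beta
      by (intro bounded_linear_Pair bounded_linear_fst bounded_linear_compose[OF blinfun.bounded_linear_right]
          bounded_linear_add bounded_linear_snd bounded_linear_compose[OF bounded_linear_scaleR_left])
    show "(\<lambda>(s, k). (s, M (k + s *\<^sub>R ?a))) \<circ> (\<lambda>(s, k). (s, k - (s *\<^sub>R ?a + lin_op t ?u k))) = id"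
      by (auto simp: fun_eq_iff MK algebra_simps)
    show "open W" "(t, c) \<in> W" using t by (auto simp: W_def open_Times)
    show "f (g p) = p" if "p \<in> W" for p
      using that sol_eq[of "fst p" "snd p"] by (auto simp: W_def f_def g_def algebra_simps prod_eq_iff)
    have "((\<lambda>p. sol (fst p) (snd p)) \<longlongrightarrow> sol t c) (at (t, c))"
    proof (rule LIM_zero_cancel, rule tendsto_norm_zero_cancel, rule tendsto_sandwich[OF _ _ tendsto_const])
      show "\<forall>\<^sub>F p in at (t, c). norm (sol (fst p) (snd p) - sol t c) \<le> 2 * (norm (snd p - c) + \<bar>fst p - t\<bar> * norm ?a)"
      proof -
        have "\<forall>\<^sub>F p in at (t, c). p \<in> W"
          using \<open>open W\<close> \<open>(t, c) \<in> W\<close> eventually_at_topological by blast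
        then show ?thesis
          by eventually_elim (rule sol_lipschitz, use t in \<open>auto simp: W_def\<close>)
      qed
      have "((\<lambda>p. 2 * (norm (snd p - c) + \<bar>fst p - t\<bar> * norm ?a)) \<longlongrightarrow> 2 * (norm (snd (t, c) - c) + \<bar>fst (t, c) - t\<bar> * norm ?a)) (at (t, c))"
        by (intro tendsto_intros)
      then show "((\<lambda>p. 2 * (norm (snd p - c) + \<bar>fst p - t\<bar> * norm ?a)) \<longlongrightarrow> 0) (at (t, c))" by simp
    qed simp
    then show "continuous (at (t, c)) g"
      unfolding continuous_at g_def
      using tendsto_fst[OF tendsto_ident_at, of "(t, c)"] by (auto intro!: tendsto_Pair)
  qed
  then have "(snd \<circ> g) differentiable (at (t, c))"
    using bounded_linear.has_derivative[OF bounded_linear_snd] by (auto simp: differentiable_def comp_def)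
  then show ?thesis by (simp add: g_def comp_def)
qed

definition curve :: "real \<times> 'e \<Rightarrow> (real \<Rightarrow>\<^sub>C 'e)" where
  "curve p = sol (fst p) (const_bcontfun (snd p))"

definition flow_dom :: "(real \<times> 'e) set" where "flow_dom = {-flow_time<..<flow_time} \<times> UNIV"

lemma open_flow_dom: "open flow_dom" by (simp add: flow_dom_def open_Times)

lemma flow_dom_time: "p \<in> flow_dom \<Longrightarrow> \<bar>fst p\<bar> \<le> flow_time" by (auto simp: flow_dom_def)

lemma curve_eq: "p \<in> flow_dom \<Longrightarrow> const_bcontfun (snd p) + fst p *\<^sub>R bc_int (bc_comp X (curve p)) = curve p"
  unfolding curve_def using flow_dom_time sol_eq by blast

lemma curve_differentiable:
  assumes "p \<in> flow_dom" shows "curve differentiable (at p)"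
proof -
  have "bounded_linear (\<lambda>p :: real \<times> 'e. (fst p, const_bcontfun (snd p) :: real \<Rightarrow>\<^sub>C 'e))"
    by (intro bounded_linear_Pair bounded_linear_fst bounded_linear_compose[OF bounded_linear_const_bcontfun bounded_linear_snd])
  then have 1: "(\<lambda>p :: real \<times> 'e. (fst p, const_bcontfun (snd p) :: real \<Rightarrow>\<^sub>C 'e)) differentiable (at p)"
    by (rule bounded_linear_imp_differentiable)
  have "(\<lambda>p. sol (fst p) (snd p)) differentiable (at (fst p, const_bcontfun (snd p)))"
    using assms by (intro sol_differentiable) (auto simp: flow_dom_def)
  then have "((\<lambda>p. sol (fst p) (snd p)) \<circ> (\<lambda>p. (fst p, const_bcontfun (snd p)))) differentiable (at p)"
    by (rule differentiable_chain_at[OF 1])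
  then show ?thesis by (simp add: curve_def[abs_def] comp_def)
qed

lemma FD_curve:
  assumes p: "p \<in> flow_dom"
  shows "FD curve p v - lin_op (fst p) (curve p) (FD curve p v) = const_bcontfun (snd v) + fst v *\<^sub>R bc_int (bc_comp X (curve p))"
proof -
  have 1: "((\<lambda>p. bc_int (bc_comp X (curve p))) has_derivative (\<lambda>v. bc_int (bc_comp_deriv X (curve p) (FD curve p v)))) (at p)"
    using bounded_linear.has_derivative[OF bounded_linear_bc_int
        has_derivative_compose[OF FD_works[OF curve_differentiable[OF p]] bc_comp_has_derivative[OF X1]]] .
  have "((\<lambda>p. const_bcontfun (snd p) + fst p *\<^sub>R bc_int (bc_comp X (curve p))) has_derivative
    (\<lambda>v. const_bcontfun (snd v) + (fst p *\<^sub>R bc_int (bc_comp_deriv X (curve p) (FD curve p v)) + fst v *\<^sub>R bc_int (bc_comp X (curve p))))) (at p)"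
    by (intro has_derivative_add has_derivative_scaleR has_derivative_fst has_derivative_ident 1
        bounded_linear.has_derivative[OF bounded_linear_const_bcontfun] has_derivative_snd)
  then have "(curve has_derivative
    (\<lambda>v. const_bcontfun (snd v) + (fst p *\<^sub>R bc_int (bc_comp_deriv X (curve p) (FD curve p v)) + fst v *\<^sub>R bc_int (bc_comp X (curve p))))) (at p)"
    by (rule has_derivative_transform_within_open[OF _ open_flow_dom p]) (rule curve_eq)
  from fun_cong[OF FD_eqI[OF this], of v] show ?thesis
    by (simp add: lin_op_apply algebra_simps)
qed

lemma Ck_on_curve: "Ck_on k flow_dom curve"
proof (induction k)
  case 0
  then show ?case
    by (auto intro!: continuous_at_imp_continuous_on differentiable_imp_continuous_within curve_differentiable)
next
  case (Suc k)
  have CX: "Ck_on k flow_dom (\<lambda>p. bc_comp X (curve p))" "Ck_on k flow_dom (\<lambda>p. bc_comp (\<lambda>y. FD X y b) (curve p))" for b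
    using smooth smooth_on_FD[OF smooth] by (auto intro!: Ck_on_bc_comp open_flow_dom Suc simp: smooth_on_def)
  have fst: "Ck_on k flow_dom fst" by (simp add: Ck_on_bounded_linear bounded_linear_fst)
  have "\<exists>M. (id_blinfun - lin_op (fst p) (curve p)) o\<^sub>L M = id_blinfun \<and> M o\<^sub>L (id_blinfun - lin_op (fst p) (curve p)) = id_blinfun"
    if "p \<in> flow_dom" for p
    using blinfun_neumann[OF norm_lin_op[OF flow_dom_time[OF that], of "curve p"]] by metis
  then obtain M where M: "p \<in> flow_dom \<Longrightarrow> (id_blinfun - lin_op (fst p) (curve p)) o\<^sub>L M p = id_blinfun"
      "p \<in> flow_dom \<Longrightarrow> M p o\<^sub>L (id_blinfun - lin_op (fst p) (curve p)) = id_blinfun" for p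
    by metis
  have "Ck_on k flow_dom (\<lambda>p. lin_op (fst p) (curve p))"
    unfolding lin_op_def
  proof (intro Ck_on_bilinear[OF bounded_bilinear_scaleR] open_flow_dom fst Ck_on_sum)
    fix b :: 'e assume b: "b \<in> Basis"
    show "Ck_on k flow_dom (\<lambda>p. Blinfun bc_int o\<^sub>L bounded_bilinear.prod_left (bc_prod b) (bc_comp (\<lambda>y. FD X y b) (curve p)))"
      by (intro Ck_on_linear_comp[OF _ open_flow_dom CX(2)]
          bounded_linear_compose[OF bounded_bilinear.bounded_linear_right[OF bounded_bilinear_blinfun_compose]]
          bounded_bilinear.bounded_linear_prod_left[OF bounded_bilinear_bc_prod[OF b]])
  qed
  then have "Ck_on k flow_dom (\<lambda>p. - lin_op (fst p) (curve p))"
    by (rule Ck_on_linear_comp[OF bounded_linear_minus[OF bounded_linear_ident] open_flow_dom])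
  then have "Ck_on k flow_dom (\<lambda>p. id_blinfun + - lin_op (fst p) (curve p))"
    by (intro Ck_on_add open_flow_dom) simp_all
  then have CM: "Ck_on k flow_dom M"
    by (intro Ck_on_inverse_blinfun[OF open_flow_dom M(1) M(2)]) (simp_all only: diff_conv_add_uminus)
  have FDU: "FD curve p v = M p (const_bcontfun (snd v) + fst v *\<^sub>R bc_int (bc_comp X (curve p)))" if "p \<in> flow_dom" for p v
    using arg_cong[OF M(2)[OF that], of "\<lambda>B. blinfun_apply B (FD curve p v)"]
    by (simp add: FD_curve[OF that, symmetric] blinfun.bilinear_simps)
  then have der: "(curve has_derivative (\<lambda>v. M p (const_bcontfun (snd v) + fst v *\<^sub>R bc_int (bc_comp X (curve p))))) (at p)"
    if "p \<in> flow_dom" for p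
  proof -
    have "FD curve p = (\<lambda>v. M p (const_bcontfun (snd v) + fst v *\<^sub>R bc_int (bc_comp X (curve p))))"
      using FDU[OF that] by (rule ext)
    then show ?thesis using FD_works[OF curve_differentiable[OF that]] by simp
  qed
  show ?case
    by (rule Ck_on_SucI[OF open_flow_dom der])
      (auto intro!: Ck_on_blinfun_bilinear open_flow_dom CM Ck_on_add Ck_on_linear_comp[OF bounded_linear_scaleR_right]
        Ck_on_linear_comp[OF bounded_linear_bc_int] CX)
qed

definition flow :: "real \<times> 'e \<Rightarrow> 'e" where "flow p = curve p 1"

lemma smooth_flow: "smooth_on flow_dom flow"
  unfolding flow_def[abs_def]
  by (intro smooth_on_linear_comp[OF bounded_linear_eval_bcontfun open_flow_dom]) (simp add: smooth_on_def Ck_on_curve)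

lemma flow_0: "flow (0, x) = x"
proof -
  have "(0, x) \<in> flow_dom" using flow_time_pos by (simp add: flow_dom_def)
  from curve_eq[OF this] have "curve (0, x) = const_bcontfun x" by simp
  then show ?thesis by (simp add: flow_def)
qed

lemma flow_translate:
  assumes v: "\<And>y. X (y + v) = X y" and p: "(t, x) \<in> flow_dom"
  shows "flow (t, x + v) = flow (t, x) + v"
proof -
  have "bc_comp X (curve (t, x) + const_bcontfun v) = bc_comp X (curve (t, x))"
    by (rule bcontfun_eqI) (simp add: bc_comp_apply[OF contX] v)
  then have "const_bcontfun (x + v) + t *\<^sub>R bc_int (bc_comp X (curve (t, x) + const_bcontfun v)) = curve (t, x) + const_bcontfun v"
    using curve_eq[OF p] bounded_linear.linear[OF bounded_linear_const_bcontfun, THEN linear_add, of x v]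
    by (simp add: algebra_simps)
  then have "curve (t, x + v) = curve (t, x) + const_bcontfun v"
    unfolding curve_def[of "(t, x + v)"] using sol_unique[of t] flow_dom_time[OF p] by simp
  then show ?thesis by (simp add: flow_def)
qed

lemma curve_has_vector_derivative:
  assumes p: "(t, x) \<in> flow_dom" and s: "s \<in> {0..1}"
  shows "(curve (t, x) has_vector_derivative t *\<^sub>R X (curve (t, x) s)) (at s within {0..1})"
proof -
  let ?u = "curve (t, x)"
  have "((\<lambda>s. integral {0..s} (bc_comp X ?u)) has_vector_derivative bc_comp X ?u s) (at s within {0..1})"
    using s by (intro integral_has_vector_derivative) auto
  then have "((\<lambda>s. x + t *\<^sub>R integral {0..s} (bc_comp X ?u)) has_vector_derivative t *\<^sub>R X (?u s)) (at s within {0..1})"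
    by (auto intro!: derivative_eq_intros simp: bc_comp_apply[OF contX])
  moreover have "x + t *\<^sub>R integral {0..s} (bc_comp X ?u) = ?u s" if "s \<in> {0..1}" for s
    using arg_cong[OF curve_eq[OF p], of "\<lambda>u. apply_bcontfun u s"] that by (simp add: bc_int_apply)
  ultimately show ?thesis
    using has_vector_derivative_transform[OF s, of ?u "\<lambda>s. x + t *\<^sub>R integral {0..s} (bc_comp X ?u)"] by metis
qed

text \<open>The curve \<open>s \<mapsto> s X(u(s))\<close> solves the linearized equation that characterizes the derivative of
  \<open>u\<close> with respect to the time parameter \<open>t\<close>.\<close>

lemma FD_flow:
  assumes p: "(t, x) \<in> flow_dom"
  shows "FD flow (t, x) (1, 0) = X (flow (t, x))"
proof -
  let ?u = "curve (t, x)"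
  let ?c = "\<lambda>s. min 1 (max 0 s) :: real"
  define V where "V = Bcontfun (\<lambda>s. ?c s *\<^sub>R X (?u s))"
  have V: "V s = ?c s *\<^sub>R X (?u s)" for s
  proof -
    have "norm (?c s *\<^sub>R X (?u s)) \<le> 1 * norm (bc_comp X ?u)" for s
      unfolding norm_scaleR using norm_bounded[of "bc_comp X ?u" s]
      by (intro mult_mono) (auto simp: bc_comp_apply[OF contX])
    then have "apply_bcontfun (Bcontfun (\<lambda>s. ?c s *\<^sub>R X (?u s))) = (\<lambda>s. ?c s *\<^sub>R X (?u s))"
      by (intro Bcontfun_apply) (auto intro!: continuous_intros continuous_on_compose2[OF contX])
    then show ?thesis by (simp add: V_def)
  qed
  have "V - lin_op t ?u V = bc_int (bc_comp X ?u)"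
  proof (rule bcontfun_eqI)
    fix s
    let ?s = "?c s"
    have s: "0 \<le> ?s" "?s \<le> 1" by auto
    have int1: "((\<lambda>\<sigma>. X (?u \<sigma>) + t *\<^sub>R (\<sigma> *\<^sub>R FD X (?u \<sigma>) (X (?u \<sigma>)))) has_integral (?s *\<^sub>R X (?u ?s) - 0 *\<^sub>R X (?u 0))) {0..?s}"
    proof (rule fundamental_theorem_of_calculus[OF s(1)])
      fix \<sigma> assume \<sigma>: "\<sigma> \<in> {0..?s}"
      have "(?u has_vector_derivative t *\<^sub>R X (?u \<sigma>)) (at \<sigma> within {0..?s})"
        using curve_has_vector_derivative[OF p, of \<sigma>] \<sigma> s
        by (auto intro: has_vector_derivative_within_subset)
      then have "((\<lambda>s. X (?u s)) has_derivative (\<lambda>h. FD X (?u \<sigma>) (h *\<^sub>R (t *\<^sub>R X (?u \<sigma>))))) (at \<sigma> within {0..?s})"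
        unfolding has_vector_derivative_def
        by (rule has_derivative_compose[OF _ Ck_on_1_facts(3)[OF X1]])
      moreover have "FD X (?u \<sigma>) (h *\<^sub>R (t *\<^sub>R X (?u \<sigma>))) = h *\<^sub>R (t *\<^sub>R FD X (?u \<sigma>) (X (?u \<sigma>)))" for h
        by (simp add: FD_scaleR)
      ultimately have "((\<lambda>s. X (?u s)) has_vector_derivative t *\<^sub>R FD X (?u \<sigma>) (X (?u \<sigma>))) (at \<sigma> within {0..?s})"
        by (simp add: has_vector_derivative_def)
      then show "((\<lambda>s. s *\<^sub>R X (?u s)) has_vector_derivative X (?u \<sigma>) + t *\<^sub>R (\<sigma> *\<^sub>R FD X (?u \<sigma>) (X (?u \<sigma>)))) (at \<sigma> within {0..?s})"
        by (auto intro!: derivative_eq_intros simp: algebra_simps)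
    qed
    have int2: "((\<lambda>\<sigma>. bc_comp X ?u \<sigma> + t *\<^sub>R bc_comp_deriv X ?u V \<sigma>) has_integral
        (integral {0..?s} (bc_comp X ?u) + t *\<^sub>R integral {0..?s} (bc_comp_deriv X ?u V))) {0..?s}"
      by (intro has_integral_add has_integral_cmul integrable_integral apply_integrable)
    have int_eq: "bc_comp X ?u \<sigma> + t *\<^sub>R bc_comp_deriv X ?u V \<sigma> = X (?u \<sigma>) + t *\<^sub>R (\<sigma> *\<^sub>R FD X (?u \<sigma>) (X (?u \<sigma>)))"
      if "\<sigma> \<in> {0..?s}" for \<sigma>
    proof -
      have "?c \<sigma> = \<sigma>" using that s by auto
      then show ?thesis
        by (simp add: bc_comp_apply[OF contX] bc_comp_deriv_apply[OF X1] V FD_scaleR)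
    qed
    have "((\<lambda>\<sigma>. X (?u \<sigma>) + t *\<^sub>R (\<sigma> *\<^sub>R FD X (?u \<sigma>) (X (?u \<sigma>)))) has_integral
        (integral {0..?s} (bc_comp X ?u) + t *\<^sub>R integral {0..?s} (bc_comp_deriv X ?u V))) {0..?s}"
      by (rule has_integral_eq[OF int_eq int2])
    from has_integral_unique[OF int1 this] have *: "?s *\<^sub>R X (?u ?s) = integral {0..?s} (bc_comp X ?u) + t *\<^sub>R integral {0..?s} (bc_comp_deriv X ?u V)"
      by simp
    have "?u ?s = ?u s"
      using arg_cong[OF curve_eq[OF p], of "\<lambda>u. apply_bcontfun u s"]
        arg_cong[OF curve_eq[OF p], of "\<lambda>u. apply_bcontfun u ?s"] by (simp add: bc_int_apply)
    with * show "(V - lin_op t ?u V) s = bc_int (bc_comp X ?u) s"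
      by (simp add: V lin_op_apply bc_int_apply)
  qed
  moreover have "FD curve (t, x) (1, 0) - lin_op t ?u (FD curve (t, x) (1, 0)) = bc_int (bc_comp X ?u)"
    using FD_curve[OF p, of "(1, 0)"] by simp
  ultimately have "V - lin_op t ?u V = FD curve (t, x) (1, 0) - lin_op t ?u (FD curve (t, x) (1, 0))" by simp
  moreover obtain M where M: "M o\<^sub>L (id_blinfun - lin_op t ?u) = id_blinfun"
    using blinfun_neumann[OF norm_lin_op[of t ?u]] flow_dom_time[OF p] by (metis fst_conv)
  have "M (k - lin_op t ?u k) = k" for k
    using arg_cong[OF M, of "\<lambda>B. blinfun_apply B k"] by (simp add: blinfun.bilinear_simps)
  ultimately have "V = FD curve (t, x) (1, 0)" by metis
  moreover have "FD flow (t, x) (1, 0) = FD curve (t, x) (1, 0) 1"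
    unfolding flow_def[abs_def]
    using FD_eqI[OF bounded_linear.has_derivative[OF bounded_linear_eval_bcontfun FD_works[OF curve_differentiable[OF p]]]] by metis
  ultimately show ?thesis using V[of 1] by (simp add: flow_def)
qed

end

section \<open>Bump functions\<close>

definition flat :: "nat \<Rightarrow> real \<Rightarrow> real" where
  "flat n x = (if x > 0 then inverse x ^ n * exp (- inverse x) else 0)"

lemma flat_nonneg: "flat n x \<ge> 0" by (simp add: flat_def)

lemma flat_tendsto_0: "(flat n \<longlongrightarrow> 0) (at 0)"
proof (rule filterlim_split_at)
  have "((\<lambda>x. inverse x ^ n / exp (inverse x)) \<longlongrightarrow> 0) (at_right (0::real))"
    using filterlim_compose[OF tendsto_power_div_exp_0 filterlim_inverse_at_top_right] .
  then show "(flat n \<longlongrightarrow> 0) (at_right 0)"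
  proof (rule Lim_transform_eventually)
    show "\<forall>\<^sub>F x in at_right 0. inverse x ^ n / exp (inverse x) = flat n x"
      by (auto simp: eventually_at_filter flat_def exp_minus field_simps)
  qed
  show "(flat n \<longlongrightarrow> 0) (at_left 0)"
    by (rule Lim_transform_eventually[OF tendsto_const]) (auto simp: eventually_at_filter flat_def)
qed

lemma flat_has_derivative:
  "(flat n has_field_derivative (flat (n + 2) x - real n * flat (n + 1) x)) (at x)"
proof (cases x "0::real" rule: linorder_cases)
  case less
  have "((\<lambda>x. 0) has_field_derivative (flat (n + 2) x - real n * flat (n + 1) x)) (at x)"
    using less by (auto simp: flat_def)
  then show ?thesis
    by (rule has_field_derivative_transform_within_open[where S = "{..<0}"]) (use less in \<open>auto simp: flat_def\<close>)
next
  case greater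
  have "((\<lambda>x. inverse x ^ n * exp (- inverse x)) has_field_derivative (flat (n + 2) x - real n * flat (n + 1) x)) (at x)"
  proof -
    have "real n * y ^ (n - Suc 0) * y\<^sup>2 = real n * y ^ (n + 1)" for y :: real
      by (cases n) (simp_all add: power2_eq_square)
    from this[of "inverse x"] have "real n * inverse x ^ (n - Suc 0) * - (inverse x)\<^sup>2 * exp (- inverse x)
        + inverse x ^ n * (exp (- inverse x) * (inverse x)\<^sup>2) = flat (n + 2) x - real n * flat (n + 1) x"
      using greater by (simp add: flat_def) (auto simp: power2_eq_square algebra_simps)
    moreover have "((\<lambda>x. inverse x ^ n * exp (- inverse x)) has_field_derivative
        (real n * inverse x ^ (n - Suc 0) * - (inverse x)\<^sup>2 * exp (- inverse x)
        + inverse x ^ n * (exp (- inverse x) * (inverse x)\<^sup>2))) (at x)"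
      using greater by (auto intro!: derivative_eq_intros simp: power2_eq_square)
    ultimately show ?thesis by simp
  qed
  then show ?thesis
    by (rule has_field_derivative_transform_within_open[where S = "{0<..}"]) (use greater in \<open>auto simp: flat_def\<close>)
next
  case equal
  have "((\<lambda>h. (flat n (0 + h) - flat n 0) / h) \<longlongrightarrow> 0) (at 0)"
    by (rule Lim_transform_eventually[OF flat_tendsto_0[of "n + 1"]])
      (auto simp: eventually_at_filter flat_def field_simps)
  then show ?thesis using equal by (simp add: DERIV_def flat_def)
qed

lemma smooth_flat: "smooth_on UNIV (flat n)"
proof -
  have D: "(flat n has_derivative (\<lambda>v. v * (flat (n + 2) x - real n * flat (n + 1) x))) (at x)" for n x
    using flat_has_derivative[of n x] by (simp add: has_field_derivative_def mult_commute_abs)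
  have "Ck_on k UNIV (flat n)" for k
  proof (induction k arbitrary: n)
    case 0
    show ?case
      by (auto intro!: continuous_at_imp_continuous_on has_derivative_continuous[OF D])
  next
    case (Suc k)
    show ?case
    proof (rule Ck_on_SucI[OF open_UNIV D])
      have "Ck_on k UNIV (\<lambda>x. v *\<^sub>R (flat (n + 2) x + (- real n) *\<^sub>R flat (n + 1) x))" for v
        by (intro Ck_on_linear_comp[OF bounded_linear_scaleR_right] Ck_on_add open_UNIV Suc)
      then show "Ck_on k UNIV (\<lambda>x. v * (flat (n + 2) x - real n * flat (n + 1) x))" for v by simp
    qed
  qed
  then show ?thesis by (simp add: smooth_on_def)
qed

lemma smooth_inverse: "smooth_on {0<..} (inverse :: real \<Rightarrow> real)"
proof -
  have D: "(inverse has_derivative (\<lambda>v. v * - (inverse x * inverse x))) (at x)" if "x \<in> {0<..}" for x :: real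
    using has_derivative_inverse'[of x UNIV] that by (simp add: mult_ac)
  have "Ck_on k {0<..} (inverse :: real \<Rightarrow> real)" for k
  proof (induction k)
    case 0
    then show ?case by (auto intro!: continuous_intros)
  next
    case (Suc k)
    show ?case
      by (rule Ck_on_SucI[OF open_greaterThan D])
        (auto intro!: Ck_on_bilinear[OF bounded_bilinear_mult] Suc
          Ck_on_linear_comp[OF bounded_linear_minus[OF bounded_linear_ident]])
  qed
  then show ?thesis by (simp add: smooth_on_def)
qed

lemma smooth_bump:
  fixes a :: "'e::euclidean_space"
  assumes "0 < r" "r < R"
  obtains \<rho> where "smooth_on UNIV \<rho>" "\<And>x. dist a x \<le> r \<Longrightarrow> \<rho> x = (1::real)" "\<And>x. R \<le> dist a x \<Longrightarrow> \<rho> x = 0"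
proof -
  define q where "q x = (x - a) \<bullet> (x - a)" for x
  have q: "q x = (dist a x)\<^sup>2" for x
    by (simp add: q_def dist_norm norm_minus_commute[of a x] power2_norm_eq_inner)
  define den where "den x = flat 0 (R\<^sup>2 - q x) + flat 0 (q x - r\<^sup>2)" for x
  define \<rho> where "\<rho> x = flat 0 (R\<^sup>2 - q x) * inverse (den x)" for x
  have rR: "r\<^sup>2 < R\<^sup>2" using assms by (simp add: power_strict_mono)
  have pos: "flat 0 x > 0" if "x > 0" for x using that by (simp add: flat_def)
  have den: "den x > 0" for x
    using pos[of "R\<^sup>2 - q x"] pos[of "q x - r\<^sup>2"] flat_nonneg[of 0 "R\<^sup>2 - q x"] flat_nonneg[of 0 "q x - r\<^sup>2"] rR
    unfolding den_def by (cases "R\<^sup>2 - q x > 0") linarith+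
  have sq: "smooth_on UNIV q" unfolding q_def by (intro smooth_intros) auto
  have s1: "smooth_on UNIV (\<lambda>x. flat 0 (R\<^sup>2 - q x))" "smooth_on UNIV (\<lambda>x. flat 0 (q x - r\<^sup>2))"
    by (auto intro!: smooth_on_compose[OF open_UNIV open_UNIV _ _ smooth_flat] smooth_on_diff sq)
  have "smooth_on UNIV (\<lambda>x. inverse (den x))"
    by (rule smooth_on_compose[OF open_UNIV open_greaterThan _ _ smooth_inverse])
      (use den s1 in \<open>auto simp: den_def[abs_def] intro!: smooth_intros\<close>)
  then have "smooth_on UNIV \<rho>" unfolding \<rho>_def using s1 by (intro smooth_intros) auto
  moreover have "\<rho> x = 1" if "dist a x \<le> r" for x
  proof -
    have "q x \<le> r\<^sup>2" unfolding q using that by (simp add: power_mono)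
    then have "flat 0 (q x - r\<^sup>2) = 0" by (simp add: flat_def)
    then show ?thesis using den[of x] by (simp add: \<rho>_def den_def)
  qed
  moreover have "\<rho> x = 0" if "R \<le> dist a x" for x
  proof -
    have "R\<^sup>2 \<le> q x" unfolding q using that assms by (simp add: power_mono)
    then show ?thesis by (simp add: \<rho>_def flat_def)
  qed
  ultimately show thesis using that by blast
qed

lemma smooth_on_extend_by_0:
  fixes f :: "'e::euclidean_space \<Rightarrow> 'b::real_normed_vector"
  assumes "open S" "closed C" "C \<subseteq> S" "smooth_on S f" "\<And>x. x \<notin> C \<Longrightarrow> f x = 0"
  shows "smooth_on UNIV (\<lambda>x. if x \<in> S then f x else 0)"
proof (rule smooth_on_local[OF open_UNIV])
  fix x :: 'e
  show "\<exists>T. open T \<and> x \<in> T \<and> smooth_on T (\<lambda>x. if x \<in> S then f x else 0)"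
  proof (cases "x \<in> S")
    case True
    then show ?thesis using assms(1,4) smooth_on_cong[OF assms(1) _ assms(4), of "\<lambda>x. if x \<in> S then f x else 0"]
      by auto
  next
    case False
    have "smooth_on (- C) (\<lambda>x. if x \<in> S then f x else 0)"
      by (rule smooth_on_cong[of _ "\<lambda>x. 0"]) (use assms in auto)
    then show ?thesis using False assms(2,3) by (metis ComplI open_Compl subsetD)
  qed
qed

lemma compact_support_FD_bound:
  fixes Z :: "'e::euclidean_space \<Rightarrow> 'b::real_normed_vector"
  assumes Z: "smooth_on UNIV Z" and C: "compact C" "\<And>y. y \<notin> C \<Longrightarrow> Z y = 0"
  obtains L where "L > 0" "\<And>y w. norm (FD Z y w) \<le> L * norm w"
proof -
  have "\<exists>M. \<forall>y. norm (FD Z y b) \<le> M" for b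
  proof -
    have "compact ((\<lambda>y. FD Z y b) ` C)"
      using smooth_on_continuous[OF smooth_on_FD[OF Z]] C(1)
      by (intro compact_continuous_image) (auto intro: continuous_on_subset)
    then obtain M where "\<forall>z\<in>(\<lambda>y. FD Z y b) ` C. norm z \<le> M" using compact_imp_bounded bounded_iff by blast
    then have M: "norm (FD Z y b) \<le> M" if "y \<in> C" for y using that by simp
    have "FD Z y b = 0" if "y \<notin> C" for y
    proof -
      have "FD Z y = FD (\<lambda>y. 0) y"
        by (rule FD_cong[of "- C"]) (use C compact_imp_closed that in auto)
      then show ?thesis by (simp add: FD_eqI)
    qed
    then have "norm (FD Z y b) \<le> max M 0" for y using M[of y] by (cases "y \<in> C") auto
    then show ?thesis by blast
  qed
  then obtain M where M: "norm (FD Z y b) \<le> M b" for y b by metis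
  define L where "L = (\<Sum>b\<in>Basis. M b) + 1"
  have M0: "M b \<ge> 0" for b using M[of undefined b] norm_ge_zero order_trans by blast
  show thesis
  proof (rule that[of L])
    show "L > 0" using sum_nonneg[of Basis M] M0 by (simp add: L_def)
    show "norm (FD Z y w) \<le> L * norm w" for y w
    proof -
      have "norm (FD Z y w) \<le> (\<Sum>b\<in>Basis. norm w * M b)"
        unfolding bounded_linear_basis_sum[OF smooth_on_bounded_linear_FD[OF Z UNIV_I], of y w]
      proof (rule sum_norm_le)
        show "norm ((w \<bullet> b) *\<^sub>R FD Z y b) \<le> norm w * M b" if "b \<in> Basis" for b
          unfolding norm_scaleR using Basis_le_norm[OF that, of w] M M0 by (intro mult_mono) auto
      qed
      also have "\<dots> \<le> L * norm w" 
        unfolding L_def sum_distrib_left[symmetric] by (simp add: algebra_simps)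
      finally show ?thesis .
    qed
  qed
qed

section \<open>The inverse function theorem for smooth maps\<close>

lemma smooth_on_Blinfun_FD:
  fixes f :: "'e::euclidean_space \<Rightarrow> 'b::real_normed_vector"
  assumes S: "open S" and f: "smooth_on S f"
  shows "smooth_on S (\<lambda>x. Blinfun (FD f x))"
proof (rule smooth_on_cong[OF S])
  define E :: "'e \<Rightarrow> 'b \<Rightarrow> 'e \<Rightarrow>\<^sub>L 'b" where "E b = bounded_bilinear.prod_left (\<lambda>k y. (k \<bullet> b) *\<^sub>R y)" for b
  have bil: "bounded_bilinear (\<lambda>k y. (k \<bullet> b) *\<^sub>R y :: 'b)" for b :: 'e
    by (rule bounded_bilinear.comp1[OF bounded_bilinear_scaleR bounded_linear_inner_left])
  show "(\<Sum>b\<in>Basis. E b (FD f x b)) = Blinfun (FD f x)" if "x \<in> S" for x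
  proof (rule blinfun_eqI)
    note blin = smooth_on_bounded_linear_FD[OF f that]
    have "blinfun_apply (\<Sum>b\<in>I. E b (FD f x b)) v = (\<Sum>b\<in>I. (v \<bullet> b) *\<^sub>R FD f x b)" for v I
      by (induction I rule: infinite_finite_induct)
        (auto simp: E_def bounded_bilinear.prod_left.rep_eq[OF bil] blinfun.bilinear_simps)
    then show "blinfun_apply (\<Sum>b\<in>Basis. E b (FD f x b)) v = blinfun_apply (Blinfun (FD f x)) v" for v
      using bounded_linear_basis_sum[OF blin, of v] by (simp add: bounded_linear_Blinfun_apply[OF blin])
  qed
  show "smooth_on S (\<lambda>x. \<Sum>b\<in>Basis. E b (FD f x b))"
    unfolding E_def
    by (intro smooth_on_sum S smooth_on_linear_comp[OF bounded_bilinear.bounded_linear_prod_left[OF bil]] smooth_on_FD f)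
qed

lemma smooth_inverse_function:
  fixes f :: "'e::euclidean_space \<Rightarrow> 'e"
  assumes S: "open S" "a \<in> S" and f: "smooth_on S f" and inj: "\<And>v. FD f a v = 0 \<Longrightarrow> v = 0"
  obtains U V g where "open U" "U \<subseteq> S" "a \<in> U" "open V" "f a \<in> V" "homeomorphism U V f g"
    "smooth_on V g" "\<And>x v. x \<in> U \<Longrightarrow> FD g (f x) (FD f x v) = v"
proof -
  note blin = smooth_on_bounded_linear_FD[OF f]
  define f' where "f' x = Blinfun (FD f x)" for x
  have f'_apply: "blinfun_apply (f' x) = FD f x" if "x \<in> S" for x
    unfolding f'_def using bounded_linear_Blinfun_apply[OF blin[OF that]] .
  have Ckf': "Ck_on k S f'" for k
    using smooth_on_Blinfun_FD[OF S(1) f] by (simp add: f'_def[abs_def] smooth_on_def)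
  have lin: "linear (FD f a)" using blin[OF S(2)] by (rule bounded_linear.linear)
  moreover have "inj (FD f a)" using linear_injective_0[OF lin] inj by blast
  ultimately obtain h where h: "linear h" "h \<circ> FD f a = id"
    using linear_injective_left_inverse by blast
  have inv: "Blinfun h o\<^sub>L f' a = id_blinfun"
    using h by (auto intro!: blinfun_eqI simp: f'_apply[OF S(2)] bounded_linear_Blinfun_apply linear_linear fun_eq_iff)
  obtain U V g g' where U: "open U" "U \<subseteq> S" "a \<in> U" "open V" "f a \<in> V" "homeomorphism U V f g"
    and g: "\<And>y. y \<in> V \<Longrightarrow> (g has_derivative (g' y)) (at y)"
      "\<And>y. y \<in> V \<Longrightarrow> g' y = inv (blinfun_apply (f' (g y)))"
      "\<And>y. y \<in> V \<Longrightarrow> bij (blinfun_apply (f' (g y)))"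
  proof (rule inverse_function_theorem[of S f f', OF S(1) _ _ S(2) inv])
    show "(f has_derivative blinfun_apply (f' x)) (at x)" if "x \<in> S" for x
      using smooth_on_has_derivative[OF f that] by (simp add: f'_apply[OF that])
    show "continuous_on S f'" using Ckf'[of 0] by simp
  qed blast
  have gV: "g ` V = U" using U(6) by (auto simp: homeomorphism_def)
  have gU: "g y \<in> S" if "y \<in> V" for y using that gV U(2) by blast
  have bl: "bounded_linear (g' y)" if "y \<in> V" for y using g(1)[OF that] has_derivative_bounded_linear by blast
  have "Ck_on k V g" for k
  proof (induction k)
    case 0
    show ?case
      by (auto intro!: continuous_at_imp_continuous_on has_derivative_continuous[OF g(1)])
  next
    case (Suc k)
    have L: "Ck_on k V (\<lambda>y. f' (g y))"
      by (rule Ck_on_compose[OF U(4) S(1) _ Suc Ckf']) (use gU in auto)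
    have "Ck_on k V (\<lambda>y. Blinfun (g' y))"
    proof (rule Ck_on_inverse_blinfun[OF U(4) _ _ L])
      fix y assume y: "y \<in> V"
      show "f' (g y) o\<^sub>L Blinfun (g' y) = id_blinfun" "Blinfun (g' y) o\<^sub>L f' (g y) = id_blinfun"
        using bij_is_surj[OF g(3)[OF y]] bij_is_inj[OF g(3)[OF y]]
          bounded_linear_Blinfun_apply[OF bl[OF y], unfolded g(2)[OF y]]
        by (auto intro!: blinfun_eqI simp: g(2)[OF y] surj_f_inv_f)
    qed
    then have "Ck_on k V (\<lambda>y. blinfun_apply (Blinfun (g' y)) v)" for v
      by (intro Ck_on_blinfun_bilinear U(4)) auto
    then have "Ck_on k V (\<lambda>y. g' y v)" for v
      by (rule Ck_on_cong[OF U(4), rotated]) (simp add: bounded_linear_Blinfun_apply[OF bl])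
    then show ?case using Ck_on_SucI[OF U(4) g(1)] by blast
  qed
  then have "smooth_on V g" by (simp add: smooth_on_def)
  moreover have "FD g (f x) (FD f x v) = v" if x: "x \<in> U" for x v
  proof -
    have fx: "f x \<in> V" "g (f x) = x" using x U(6) by (auto simp: homeomorphism_def)
    have "FD g (f x) = inv (FD f x)" "inj (FD f x)"
      using FD_eqI[OF g(1)[OF fx(1)]] g(2)[OF fx(1)] f'_apply[of x] fx x U(2) bij_is_inj[OF g(3)[OF fx(1)]] by auto
    then show ?thesis by simp
  qed
  ultimately show thesis using that U by blast
qed

lemma constant_along_direction:
  fixes f :: "'e::euclidean_space \<Rightarrow> 'b::real_normed_vector"
  assumes "convex B" "x \<in> B" "y \<in> B" and f: "\<And>z. z \<in> B \<Longrightarrow> (f has_derivative f' z) (at z)"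
    and 0: "\<And>z. z \<in> B \<Longrightarrow> f' z (y - x) = 0"
  shows "f y = f x"
proof -
  let ?l = "\<lambda>t. x + t *\<^sub>R (y - x)"
  have "\<exists>c. \<forall>t\<in>{0..1::real}. f (?l t) = c"
  proof (rule has_derivative_zero_constant)
    fix t :: real assume t: "t \<in> {0..1}"
    have B: "?l t \<in> B"
      using convexD_alt[OF assms(1-3), of t] t by (simp add: algebra_simps)
    have "((\<lambda>t. f (?l t)) has_derivative (\<lambda>h. f' (?l t) (h *\<^sub>R (y - x)))) (at t within {0..1})"
      by (rule has_derivative_compose[of ?l "\<lambda>h. h *\<^sub>R (y - x)" t "{0..1}" f, OF _ f[OF B]])
        (auto intro!: derivative_eq_intros)
    moreover have "f' (?l t) (h *\<^sub>R (y - x)) = 0" for h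
      using 0[OF B] has_derivative_bounded_linear[OF f[OF B]] by (simp add: linear_cmul bounded_linear.linear)
    ultimately show "((\<lambda>t. f (?l t)) has_derivative (\<lambda>h. 0)) (at t within {0..1})" by simp
  qed simp
  then obtain c where c: "\<And>t. t \<in> {0..1} \<Longrightarrow> f (?l t) = c" by blast
  from c[of 0] c[of 1] show ?thesis by simp
qed

section \<open>Straightening commuting vector fields\<close>

lemma FD_compose:
  assumes "f differentiable (at x)" "g differentiable (at (f x))"
  shows "FD (\<lambda>x. g (f x)) x v = FD g (f x) (FD f x v)"
  using FD_eqI[OF has_derivative_compose[OF FD_works[OF assms(1)] FD_works[OF assms(2)]]] by metis

lemma FD_linear: "bounded_linear L \<Longrightarrow> FD L x v = L v"
  using FD_eqI[OF bounded_linear_imp_has_derivative] by metis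

lemma FD_const [simp]: "FD (\<lambda>x. c) x v = 0"
  by (simp add: FD_eqI)

definition delete_coords :: "'e set \<Rightarrow> 'e \<Rightarrow> 'e::euclidean_space" where
  "delete_coords E y = y - (\<Sum>b\<in>E. (y \<bullet> b) *\<^sub>R b)"

lemma delete_coords_inner:
  assumes "E \<subseteq> Basis" "b \<in> Basis"
  shows "delete_coords E y \<bullet> b = (if b \<in> E then 0 else y \<bullet> b)"
proof -
  have "finite E" using assms(1) finite_subset finite_Basis by blast
  have "(\<Sum>c\<in>E. (y \<bullet> c) *\<^sub>R c) \<bullet> b = (\<Sum>c\<in>E. if c = b then y \<bullet> b else 0)"
    unfolding inner_sum_left
    by (rule sum.cong) (use assms in \<open>auto simp: inner_Basis subset_iff\<close>)
  also have "\<dots> = (if b \<in> E then y \<bullet> b else 0)" using \<open>finite E\<close> by simp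
  finally show ?thesis by (simp add: delete_coords_def inner_diff_left)
qed

lemma norm_delete_coords: "E \<subseteq> Basis \<Longrightarrow> norm (delete_coords E y) \<le> norm y"
  by (rule norm_le_componentwise) (simp add: delete_coords_inner)

lemma bounded_linear_delete_coords: "bounded_linear (delete_coords E)"
  unfolding delete_coords_def
  by (intro bounded_linear_sub bounded_linear_ident bounded_linear_sum
      bounded_linear_compose[OF bounded_linear_scaleR_left bounded_linear_inner_left])

text \<open>The flow of a cut-off of \<open>Y\<close>, started on the hyperplane orthogonal to \<open>b\<close>. The cut-off is
  taken after deletion of the coordinates on which \<open>Y\<close> does not depend, so that it stays invariant.\<close>

lemma straighten_invariant_field:
  fixes Y :: "'e::euclidean_space \<Rightarrow> 'e"
  assumes W: "open W" "0 \<in> W" and Y: "smooth_on W Y"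
    and E: "E \<subseteq> Basis" and inv: "\<And>y e. y \<in> W \<Longrightarrow> e \<in> E \<Longrightarrow> FD Y y e = 0"
    and b: "b \<in> Basis" "b \<notin> E" "Y 0 \<bullet> b \<noteq> 0"
  obtains U V g f where "open U" "open V" "0 \<in> V" "V \<subseteq> W" "homeomorphism U V f g" "smooth_on U f"
    "smooth_on V g" "g 0 = 0"
    "\<And>y e. y \<in> V \<Longrightarrow> e \<in> E \<Longrightarrow> FD g y e = e" "\<And>y. y \<in> V \<Longrightarrow> FD g y (Y y) = b"
proof -
  let ?\<pi> = "delete_coords E"
  obtain d where d: "d > 0" "cball 0 d \<subseteq> W" using W open_contains_cball by blast
  obtain \<rho> where \<rho>: "smooth_on UNIV \<rho>" "\<And>x. dist 0 x \<le> d / 2 \<Longrightarrow> \<rho> x = (1::real)"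
      "\<And>x::'e. d \<le> dist 0 x \<Longrightarrow> \<rho> x = 0"
    using smooth_bump[of "d/2" d "0::'e"] d by auto
  have Yinv: "Y (?\<pi> y) = Y y" if y: "norm y < d" for y
  proof (rule constant_along_direction[where f = Y and x = y and y = "?\<pi> y" and B = "ball 0 d" and f' = "FD Y"])
    show "y \<in> ball 0 d" "?\<pi> y \<in> ball 0 d" using y norm_delete_coords[OF E, of y] by auto
    fix z :: 'e assume "z \<in> ball 0 d"
    then have z: "z \<in> W" using d(2) by auto
    show "(Y has_derivative FD Y z) (at z)" using smooth_on_has_derivative[OF Y z] .
    have "linear (FD Y z)" using smooth_on_bounded_linear_FD[OF Y z] bounded_linear.linear by blast
    then show "FD Y z (?\<pi> y - y) = 0"
      by (simp add: delete_coords_def linear_neg linear_sum linear_cmul inv[OF z])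
  qed simp
  define Z where "Z y = (if y \<in> W then \<rho> y *\<^sub>R Y y else 0)" for y
  have Zs: "smooth_on UNIV Z"
    unfolding Z_def
  proof (rule smooth_on_extend_by_0[OF W(1) closed_cball d(2)])
    show "smooth_on W (\<lambda>y. \<rho> y *\<^sub>R Y y)"
      by (intro smooth_on_scaleR W(1) Y smooth_on_subset[OF \<rho>(1)]) simp
    show "\<rho> x *\<^sub>R Y x = 0" if "x \<notin> cball 0 d" for x using \<rho>(3)[of x] that by simp
  qed
  have Z0: "Z y = 0" if "y \<notin> cball 0 d" for y
    using \<rho>(3)[of y] that by (simp add: Z_def)
  obtain L where L: "L > 0" "\<And>y w. norm (FD Z y w) \<le> L * norm w"
    using compact_support_FD_bound[OF Zs compact_cball Z0] by blast
  define X where "X y = Z (?\<pi> y)" for y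
  have sX: "smooth_on UNIV X"
    unfolding X_def
    by (rule smooth_on_compose[OF open_UNIV open_UNIV _ smooth_on_bounded_linear[OF bounded_linear_delete_coords] Zs]) simp
  have XY: "X y = Y y" if "norm y < d / 2" for y
  proof -
    have n: "norm (?\<pi> y) \<le> d / 2" "norm y < d" using norm_delete_coords[OF E, of y] norm_ge_zero[of y] that by linarith+
    then have "?\<pi> y \<in> W" using d by auto
    then show ?thesis using \<rho>(2)[of "?\<pi> y"] n(1) Yinv[OF n(2)] by (simp add: X_def Z_def)
  qed
  interpret lipschitz_field X L
  proof
    show "norm (FD X y w) \<le> L * norm w" for y w
    proof -
      have "FD X y w = FD Z (?\<pi> y) (?\<pi> w)"
        unfolding X_def
        using FD_compose[of ?\<pi> y Z w] bounded_linear_imp_differentiable[OF bounded_linear_delete_coords[of E]]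
          smooth_on_differentiable[OF Zs] FD_linear[OF bounded_linear_delete_coords[of E]] by simp
      then have "norm (FD X y w) \<le> L * norm (?\<pi> w)" using L(2) by simp
      also have "\<dots> \<le> L * norm w" using L(1) norm_delete_coords[OF E] by simp
      finally show ?thesis .
    qed
  qed (use sX L in auto)
  have Xinv: "X (y + s *\<^sub>R e) = X y" if e: "e \<in> E" for y s e
  proof -
    have "?\<pi> e = 0"
      by (rule euclidean_eqI) (use e E in \<open>auto simp: delete_coords_inner[OF E] inner_Basis subset_iff\<close>)
    then have "?\<pi> (y + s *\<^sub>R e) = ?\<pi> y"
      using bounded_linear.linear[OF bounded_linear_delete_coords, of E] by (simp add: linear_add linear_cmul)
    then show ?thesis by (simp add: X_def)
  qed
  define A where "A x = (x \<bullet> b, x - (x \<bullet> b) *\<^sub>R b)" for x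
  have A: "bounded_linear A"
    unfolding A_def by (intro bounded_linear_Pair bounded_linear_inner_left bounded_linear_sub bounded_linear_ident
      bounded_linear_compose[OF bounded_linear_scaleR_left bounded_linear_inner_left])
  define f where "f x = flow (A x)" for x
  define B where "B = {x::'e. A x \<in> flow_dom}"
  have Bo: "open B"
    using open_vimage[OF open_flow_dom linear_continuous_on[OF A]] by (simp add: B_def vimage_def)
  have fs: "smooth_on B f"
    unfolding f_def
    by (rule smooth_on_compose[OF Bo open_flow_dom _ smooth_on_bounded_linear[OF A] smooth_flow]) (auto simp: B_def)
  have bb: "b \<bullet> b = 1" using b(1) by simp
  have eb: "e \<bullet> b = 0" if "e \<in> E" for e using that b E by (auto simp: inner_Basis)
  have A0: "A 0 = (0, 0)" by (simp add: A_def)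
  have B0: "0 \<in> B" using flow_time_pos by (auto simp: B_def A0 flow_dom_def)
  have f0: "f 0 = 0" by (simp add: f_def A0 flow_0)
  have FDf: "FD f x v = FD flow (A x) (A v)" if "x \<in> B" for x v
    unfolding f_def
    using FD_compose[of A x flow v] bounded_linear_imp_differentiable[OF A] FD_linear[OF A]
      smooth_on_differentiable[OF smooth_flow] that by (simp add: B_def)
  have FDb: "FD f x b = X (f x)" if "x \<in> B" for x
    using FDf[OF that, of b] FD_flow[of "x \<bullet> b" "x - (x \<bullet> b) *\<^sub>R b"] that
    by (simp add: A_def bb B_def f_def)
  have FDe: "FD f x e = e" if x: "x \<in> B" and e: "e \<in> E" for x e
  proof -
    have 1: "f (x + s *\<^sub>R e) = f x + s *\<^sub>R e" for s
      using flow_translate[of "s *\<^sub>R e" "x \<bullet> b" "x - (x \<bullet> b) *\<^sub>R b"] Xinv[OF e] x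
      by (simp add: f_def A_def B_def eb[OF e] inner_add_left algebra_simps)
    have "((\<lambda>s. f (x + s *\<^sub>R e)) has_derivative (\<lambda>h. FD f x (h *\<^sub>R e))) (at 0)"
      by (rule has_derivative_compose[of "\<lambda>s. x + s *\<^sub>R e" "\<lambda>h. h *\<^sub>R e" 0 UNIV f])
        (use smooth_on_has_derivative[OF fs x] in \<open>auto intro!: derivative_eq_intros\<close>)
    moreover have "((\<lambda>s. f (x + s *\<^sub>R e)) has_derivative (\<lambda>h. h *\<^sub>R e)) (at 0)"
      unfolding 1 by (auto intro!: derivative_eq_intros)
    ultimately have "(\<lambda>h. FD f x (h *\<^sub>R e)) = (\<lambda>h. h *\<^sub>R e)" by (rule has_derivative_unique)
    from fun_cong[OF this, of 1] show ?thesis by simp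
  qed
  have inj: "v = 0" if "FD f 0 v = 0" for v
  proof -
    have lin: "linear (FD f 0)" using smooth_on_bounded_linear_FD[OF fs B0] bounded_linear.linear by blast
    define v' where "v' = v - (v \<bullet> b) *\<^sub>R b"
    have v'b: "v' \<bullet> b = 0" by (simp add: v'_def inner_diff_left bb)
    have f_slice: "f (s *\<^sub>R v') = s *\<^sub>R v'" for s by (simp add: f_def A_def v'b flow_0)
    have "((\<lambda>s. f (s *\<^sub>R v')) has_derivative (\<lambda>h. FD f 0 (h *\<^sub>R v'))) (at 0)"
      by (rule has_derivative_compose[of "\<lambda>s. s *\<^sub>R v'" "\<lambda>h. h *\<^sub>R v'" 0 UNIV f])
        (use smooth_on_has_derivative[OF fs B0] in \<open>auto intro!: derivative_eq_intros\<close>)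
    moreover have "((\<lambda>s. f (s *\<^sub>R v')) has_derivative (\<lambda>h. h *\<^sub>R v')) (at 0)"
      unfolding f_slice by (auto intro!: derivative_eq_intros)
    ultimately have "(\<lambda>h. FD f 0 (h *\<^sub>R v')) = (\<lambda>h. h *\<^sub>R v')" by (rule has_derivative_unique)
    from fun_cong[OF this, of 1] have "FD f 0 v' = v'" by simp
    moreover have "FD f 0 b = Y 0" using FDb[OF B0] XY[of 0] d(1) by (simp add: f0)
    moreover have "FD f 0 v = (v \<bullet> b) *\<^sub>R FD f 0 b + FD f 0 v'"
      using linear_add[OF lin, of "(v \<bullet> b) *\<^sub>R b" v'] by (simp add: linear_cmul[OF lin] v'_def)
    ultimately have *: "(v \<bullet> b) *\<^sub>R Y 0 + v' = 0" using that by simp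
    then have "((v \<bullet> b) *\<^sub>R Y 0 + v') \<bullet> b = 0" by simp
    then have "v \<bullet> b = 0" using b(3) by (simp add: inner_add_left v'b)
    then show "v = 0" using * by (simp add: v'_def)
  qed
  define S where "S = B \<inter> f -` ball 0 (d/2)"
  have So: "open S" "0 \<in> S"
    using continuous_open_preimage[OF smooth_on_continuous[OF fs] Bo open_ball] B0 f0 d(1) by (auto simp: S_def)
  obtain U V g where U: "open U" "U \<subseteq> S" "0 \<in> U" "open V" "f 0 \<in> V" and h: "homeomorphism U V f g"
    and g: "smooth_on V g" "\<And>x v. x \<in> U \<Longrightarrow> FD g (f x) (FD f x v) = v"
    using smooth_inverse_function[OF So smooth_on_subset[OF fs] inj] by (auto simp: S_def)
  have fU: "f ` U = V" and gf: "\<And>x. x \<in> U \<Longrightarrow> g (f x) = x" using h by (auto simp: homeomorphism_def)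
  have US: "x \<in> B" "norm (f x) < d / 2" if "x \<in> U" for x using U(2) that by (auto simp: S_def)
  show thesis
  proof (rule that[OF U(1,4) _ _ h _ g(1)])
    show "0 \<in> V" using U(5) f0 by simp
    show "V \<subseteq> W" using US(2) d fU by fastforce
    show "smooth_on U f" using smooth_on_subset[OF fs] US(1) by blast
    show "g 0 = 0" using gf[OF U(3)] f0 by simp
    show "FD g y e = e" if y: "y \<in> V" and e: "e \<in> E" for y e
    proof -
      obtain x where x: "x \<in> U" "y = f x" using fU y by blast
      show ?thesis using g(2)[OF x(1), of e] FDe[OF US(1)[OF x(1)] e] x(2) by simp
    qed
    show "FD g y (Y y) = b" if y: "y \<in> V" for y
    proof -
      obtain x where x: "x \<in> U" "y = f x" using fU y by blast
      show ?thesis using g(2)[OF x(1), of b] FDb[OF US(1)[OF x(1)]] x(2) XY[OF US(2)[OF x(1)]] by simp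
    qed
  qed
qed

proposition straighten_commuting:
  fixes X :: "nat \<Rightarrow> 'e::euclidean_space \<Rightarrow> 'e"
  assumes S: "open S" "m \<in> S" and X: "\<And>i. i < k \<Longrightarrow> smooth_on S (X i)"
    and comm: "\<And>i j T F x. \<lbrakk>i < k; j < k; open T; T \<subseteq> S; smooth_on T (F :: 'e \<Rightarrow> 'e); x \<in> T\<rbrakk> \<Longrightarrow>
      FD (\<lambda>y. FD F y (X i y)) x (X j x) = FD (\<lambda>y. FD F y (X j y)) x (X i x)"
    and indep: "\<And>c. (\<Sum>i<k. c i *\<^sub>R X i m) = 0 \<Longrightarrow> \<forall>i<k. c i = (0::real)"
  obtains T \<Psi> \<Phi> e where "open T" "m \<in> T" "T \<subseteq> S" "open (\<Psi> ` T)" "smooth_on T \<Psi>" "smooth_on (\<Psi> ` T) \<Phi>"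
    "\<Psi> m = (0 :: 'e)" "\<And>x. x \<in> T \<Longrightarrow> \<Phi> (\<Psi> x) = x" "inj_on e {..<k}" "e ` {..<k} \<subseteq> Basis"
    "\<And>x i. x \<in> T \<Longrightarrow> i < k \<Longrightarrow> FD \<Psi> x (X i x) = e i"
proof -
  have "\<exists>T \<Psi> \<Phi> e. open T \<and> m \<in> T \<and> T \<subseteq> S \<and> open (\<Psi> ` T) \<and> smooth_on T \<Psi> \<and> smooth_on (\<Psi> ` T) \<Phi> \<and>
    \<Psi> m = (0 :: 'e) \<and> (\<forall>x\<in>T. \<Phi> (\<Psi> x) = x) \<and> inj_on e {..<k} \<and> e ` {..<k} \<subseteq> Basis \<and>
    (\<forall>x\<in>T. \<forall>i<k. FD \<Psi> x (X i x) = e i)"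
    using X comm indep
  proof (induction k)
    case 0
    have "open ((\<lambda>x. x - m) ` S)" using open_translation_subtract[OF S(1)] .
    moreover have "smooth_on S (\<lambda>x. x - m)" using S(1) by (intro smooth_intros) auto
    moreover have "smooth_on ((\<lambda>x. x - m) ` S) (\<lambda>x. x + m)"
      using open_translation_subtract[OF S(1)] by (intro smooth_intros) auto
    ultimately show ?case using S
      by (intro exI[of _ S] exI[of _ "\<lambda>x. x - m"] exI[of _ "\<lambda>x. x + m"]) auto
  next
    case (Suc k)
    have "\<forall>i<k. c i = 0" if "(\<Sum>i<k. c i *\<^sub>R X i m) = 0" for c
    proof -
      have "(\<Sum>i<Suc k. (if i < k then c i else 0) *\<^sub>R X i m) = 0" using that by simp
      from Suc.prems(3)[OF this] show ?thesis by (metis less_Suc_eq)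
    qed
    note indep = this
    have "\<exists>T \<Psi> \<Phi> e. open T \<and> m \<in> T \<and> T \<subseteq> S \<and> open (\<Psi> ` T) \<and> smooth_on T \<Psi> \<and> smooth_on (\<Psi> ` T) \<Phi> \<and>
      \<Psi> m = (0 :: 'e) \<and> (\<forall>x\<in>T. \<Phi> (\<Psi> x) = x) \<and> inj_on e {..<k} \<and> e ` {..<k} \<subseteq> Basis \<and>
      (\<forall>x\<in>T. \<forall>i<k. FD \<Psi> x (X i x) = e i)"
    proof (rule Suc.IH)
      show "smooth_on S (X i)" if "i < k" for i using Suc.prems(1)[of i] that by simp
      show "FD (\<lambda>y. FD F y (X i y)) x (X j x) = FD (\<lambda>y. FD F y (X j y)) x (X i x)"
        if "i < k" "j < k" "open T" "T \<subseteq> S" "smooth_on T F" "x \<in> T" for i j T and F :: "'e \<Rightarrow> 'e" and x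
        using Suc.prems(2)[of i j T F x] that by simp
    qed (rule indep)
    then obtain T \<Psi> \<Phi> e where *: "open T \<and> m \<in> T \<and> T \<subseteq> S \<and> open (\<Psi> ` T) \<and> smooth_on T \<Psi> \<and>
      smooth_on (\<Psi> ` T) \<Phi> \<and> \<Psi> m = (0 :: 'e) \<and> (\<forall>x\<in>T. \<Phi> (\<Psi> x) = x) \<and> inj_on e {..<k} \<and>
      e ` {..<k} \<subseteq> Basis \<and> (\<forall>x\<in>T. \<forall>i<k. FD \<Psi> x (X i x) = e i)"
      by (elim exE) (rule that)
    then have T: "open T" "m \<in> T" "T \<subseteq> S" and \<Psi>: "open (\<Psi> ` T)" "smooth_on T \<Psi>" "\<Psi> m = 0"
      and \<Phi>: "smooth_on (\<Psi> ` T) \<Phi>" "\<And>x. x \<in> T \<Longrightarrow> \<Phi> (\<Psi> x) = x" and e: "inj_on e {..<k}" "e ` {..<k} \<subseteq> Basis"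
      and \<Psi>X: "\<And>x i. x \<in> T \<Longrightarrow> i < k \<Longrightarrow> FD \<Psi> x (X i x) = e i"
      by blast+
    let ?W = "\<Psi> ` T"
    define G where "G x = FD \<Psi> x (X k x)" for x
    have G: "smooth_on T G"
      unfolding G_def by (intro smooth_on_FD_apply T \<Psi> smooth_on_subset[OF Suc.prems(1)]) simp
    define Y where "Y y = G (\<Phi> y)" for y
    have Y: "smooth_on ?W Y"
      unfolding Y_def by (rule smooth_on_compose[OF \<Psi>(1) T(1) _ \<Phi>(1) G]) (use \<Phi>(2) in auto)
    have Y\<Psi>: "Y (\<Psi> x) = G x" if "x \<in> T" for x using \<Phi>(2)[OF that] by (simp add: Y_def)
    have FD\<Phi>: "FD \<Phi> (\<Psi> x) (FD \<Psi> x v) = v" if x: "x \<in> T" for x v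
    proof -
      have "FD (\<lambda>x. \<Phi> (\<Psi> x)) x v = FD \<Phi> (\<Psi> x) (FD \<Psi> x v)"
        using FD_compose[of \<Psi> x \<Phi> v] smooth_on_differentiable[OF \<Psi>(2) x] smooth_on_differentiable[OF \<Phi>(1)] x by simp
      moreover have "FD (\<lambda>x. \<Phi> (\<Psi> x)) x = FD (\<lambda>x. x) x" by (rule FD_cong[OF T(1) x]) (rule \<Phi>(2))
      moreover have "FD (\<lambda>x. x) x v = v" using FD_linear[OF bounded_linear_ident] .
      ultimately show ?thesis by simp
    qed
    have inv: "FD Y y (e i) = 0" if y: "y \<in> ?W" and i: "i < k" for y i
    proof -
      obtain x where x: "x \<in> T" "y = \<Psi> x" using y by blast
      have "FD G x (X i x) = FD (\<lambda>x. Y (\<Psi> x)) x (X i x)"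
        using FD_cong[OF T(1) x(1), of G "\<lambda>x. Y (\<Psi> x)"] Y\<Psi> by simp
      also have "\<dots> = FD Y y (e i)"
        using FD_compose[of \<Psi> x Y "X i x"] smooth_on_differentiable[OF \<Psi>(2) x(1)]
          smooth_on_differentiable[OF Y] x \<Psi>X[OF x(1) i] by simp
      finally have "FD Y y (e i) = FD (\<lambda>z. FD \<Psi> z (X k z)) x (X i x)" by (simp add: G_def[abs_def])
      also have "\<dots> = FD (\<lambda>z. FD \<Psi> z (X i z)) x (X k x)"
        using Suc.prems(2)[of k i T \<Psi> x] T \<Psi> x i by simp
      also have "\<dots> = FD (\<lambda>z. e i) x (X k x)"
        using FD_cong[OF T(1) x(1), of "\<lambda>z. FD \<Psi> z (X i z)" "\<lambda>z. e i"] \<Psi>X i by simp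
      finally show ?thesis by simp
    qed
    have "\<exists>b\<in>Basis. b \<notin> e ` {..<k} \<and> Y 0 \<bullet> b \<noteq> 0"
    proof (rule ccontr)
      assume "\<not> ?thesis"
      then have 0: "Y 0 \<bullet> b = 0" if "b \<in> Basis" "b \<notin> e ` {..<k}" for b using that by blast
      have "Y 0 = (\<Sum>b\<in>Basis. (Y 0 \<bullet> b) *\<^sub>R b)" by (simp add: euclidean_representation)
      also have "\<dots> = (\<Sum>b\<in>e ` {..<k}. (Y 0 \<bullet> b) *\<^sub>R b)"
        by (rule sum.mono_neutral_right) (use e(2) 0 in auto)
      also have "\<dots> = (\<Sum>i<k. (Y 0 \<bullet> e i) *\<^sub>R e i)" by (rule sum.reindex_cong[OF e(1)]) auto
      finally have Y0: "Y 0 = (\<Sum>i<k. (Y 0 \<bullet> e i) *\<^sub>R e i)" .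
      have lin: "linear (FD \<Phi> 0)"
        using smooth_on_bounded_linear_FD[OF \<Phi>(1), of 0] T(2) \<Psi>(3) bounded_linear.linear by force
      have "X k m = FD \<Phi> 0 (Y 0)" using FD\<Phi>[OF T(2), of "X k m"] Y\<Psi>[OF T(2)] by (simp add: \<Psi>(3) G_def)
      also have "\<dots> = (\<Sum>i<k. (Y 0 \<bullet> e i) *\<^sub>R FD \<Phi> 0 (e i))"
        by (subst Y0) (simp add: linear_sum[OF lin] linear_cmul[OF lin])
      also have "\<dots> = (\<Sum>i<k. (Y 0 \<bullet> e i) *\<^sub>R X i m)"
        by (rule sum.cong) (use FD\<Phi>[OF T(2)] \<Psi>X[OF T(2)] \<Psi>(3) in \<open>auto simp flip: \<Psi>X[OF T(2)]\<close>)
      finally have "(\<Sum>i<Suc k. (if i = k then -1 else Y 0 \<bullet> e i) *\<^sub>R X i m) = 0" by simp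
      from Suc.prems(3)[OF this] show False by (metis lessI neg_equal_0_iff_equal one_neq_zero)
    qed
    then obtain b where b: "b \<in> Basis" "b \<notin> e ` {..<k}" "Y 0 \<bullet> b \<noteq> 0" by blast
    have W0: "0 \<in> ?W" using T(2) \<Psi>(3) by force
    obtain U V g f where U: "open U" "open V" "0 \<in> V" "V \<subseteq> ?W" and h: "homeomorphism U V f g"
      and s: "smooth_on U f" "smooth_on V g" and g0: "g 0 = 0"
      and ge: "\<And>y c. y \<in> V \<Longrightarrow> c \<in> e ` {..<k} \<Longrightarrow> FD g y c = c" and gY: "\<And>y. y \<in> V \<Longrightarrow> FD g y (Y y) = b"
    proof (rule straighten_invariant_field[OF \<Psi>(1) W0 Y e(2) _ b])
      show "FD Y y c = 0" if "y \<in> ?W" "c \<in> e ` {..<k}" for y c using that inv by auto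
    qed blast
    have h': "f ` U = V" "g ` V = U" "\<And>y. y \<in> V \<Longrightarrow> f (g y) = y" using h by (auto simp: homeomorphism_def)
    define T' where "T' = T \<inter> \<Psi> -` V"
    have T': "open T'" using continuous_open_preimage[OF smooth_on_continuous[OF \<Psi>(2)] T(1) U(2)] by (simp add: T'_def)
    have im: "\<Psi> ` T' = V" using U(4) by (auto simp: T'_def)
    then have im': "(\<lambda>x. g (\<Psi> x)) ` T' = U" using h'(2) by (metis image_image)
    define e' where "e' = e(k := b)"
    have "FD (\<lambda>x. g (\<Psi> x)) x (X i x) = e' i" if x: "x \<in> T'" and i: "i < Suc k" for x i
    proof -
      have xT: "x \<in> T" and xV: "\<Psi> x \<in> V" using x by (auto simp: T'_def)
      have "FD (\<lambda>x. g (\<Psi> x)) x (X i x) = FD g (\<Psi> x) (FD \<Psi> x (X i x))"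
        using FD_compose smooth_on_differentiable[OF \<Psi>(2) xT] smooth_on_differentiable[OF s(2) xV] by blast
      also have "\<dots> = e' i"
      proof (cases "i = k")
        case True
        then show ?thesis using gY[OF xV] Y\<Psi>[OF xT] by (simp add: G_def e'_def)
      next
        case False
        then have "i < k" using i by simp
        then show ?thesis using ge[OF xV, of "e i"] \<Psi>X[OF xT, of i] by (simp add: e'_def)
      qed
      finally show ?thesis .
    qed
    moreover have "inj_on e' {..<Suc k}" using e(1) b(2)
      by (auto simp: e'_def lessThan_Suc inj_on_def)
    moreover have "e' ` {..<Suc k} \<subseteq> Basis" using e(2) b(1) by (auto simp: e'_def less_Suc_eq)
    moreover have "smooth_on T' (\<lambda>x. g (\<Psi> x))"
      by (rule smooth_on_compose[OF T' U(2) _ smooth_on_subset[OF \<Psi>(2)] s(2)]) (auto simp: T'_def)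
    moreover have "smooth_on U (\<lambda>x. \<Phi> (f x))"
      by (rule smooth_on_compose[OF U(1) \<Psi>(1) _ s(1) \<Phi>(1)]) (use h' U(4) in auto)
    moreover have "\<forall>x\<in>T'. \<Phi> (f (g (\<Psi> x))) = x" using h'(3) \<Phi>(2) by (auto simp: T'_def)
    moreover have "m \<in> T'" using T(2) \<Psi>(3) U(3) by (simp add: T'_def)
    moreover have "T' \<subseteq> S" using T(3) by (auto simp: T'_def)
    ultimately show ?case using T' im' U(1) g0 \<Psi>(3)
      by (intro exI[of _ T'] exI[of _ "\<lambda>x. g (\<Psi> x)"] exI[of _ "\<lambda>x. \<Phi> (f x)"] exI[of _ e']) auto
  qed
  then show thesis by (elim exE conjE) (rule that, assumption+, blast+)
qed

section \<open>Coordinates in Euclidean space\<close>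

lemma bij_basis_enum: "bij_betw (basis_enum :: nat \<Rightarrow> 'e::euclidean_space) {..<DIM('e)} Basis"
proof -
  have "\<exists>b. bij_betw b {..<DIM('e)} (Basis :: 'e set)"
    using ex_bij_betw_nat_finite[OF finite_Basis] by (simp add: atLeast0LessThan)
  then show ?thesis unfolding basis_enum_def by (rule someI_ex)
qed

lemma basis_enum_Basis: "k < DIM('e) \<Longrightarrow> (basis_enum k :: 'e::euclidean_space) \<in> Basis"
  using bij_basis_enum by (auto simp: bij_betw_def)

lemma basis_enum_inner:
  "k < DIM('e) \<Longrightarrow> l < DIM('e) \<Longrightarrow> (basis_enum k :: 'e::euclidean_space) \<bullet> basis_enum l = (if k = l then 1 else 0)"
  using bij_basis_enum[where 'e='e] by (auto simp: bij_betw_def inj_on_def inner_Basis basis_enum_Basis)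

lemma coord_map_inner:
  assumes "length xs = DIM('e)" "k < DIM('e)"
  shows "(coord_map xs y :: 'e::euclidean_space) \<bullet> basis_enum k = (xs ! k) y"
proof -
  have "(coord_map xs y :: 'e) \<bullet> basis_enum k = (\<Sum>l<DIM('e). if l = k then (xs ! l) y else 0)"
    unfolding coord_map_def inner_sum_left assms(1)
    by (rule sum.cong) (use assms in \<open>auto simp: basis_enum_inner\<close>)
  then show ?thesis using assms by simp
qed

lemma euclidean_eqI_enum:
  fixes x y :: "'e::euclidean_space"
  assumes "\<And>k. k < DIM('e) \<Longrightarrow> x \<bullet> basis_enum k = y \<bullet> basis_enum k"
  shows "x = y"
proof (rule euclidean_eqI)
  fix b :: 'e assume "b \<in> Basis"
  then obtain k where "k < DIM('e)" "b = basis_enum k" using bij_basis_enum[where 'e='e] by (auto simp: bij_betw_def)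
  then show "x \<bullet> b = y \<bullet> b" using assms by simp
qed

lemma smooth_coord_map:
  assumes "open W" "\<And>k. k < length xs \<Longrightarrow> smooth_on W (xs ! k)"
  shows "smooth_on W (coord_map xs)"
  unfolding coord_map_def using assms by (intro smooth_intros) auto

lemma FD_coord_map:
  fixes xs :: "('f::euclidean_space \<Rightarrow> real) list"
  assumes "length xs = DIM('e)" "\<And>k. k < DIM('e) \<Longrightarrow> (xs ! k) differentiable (at x)" "k < DIM('e)"
  shows "(FD (coord_map xs) x v :: 'e::euclidean_space) \<bullet> basis_enum k = FD (xs ! k) x v"
proof -
  have "((coord_map xs :: _ \<Rightarrow> 'e) has_derivative (\<lambda>v. \<Sum>k<length xs. FD (xs ! k) x v *\<^sub>R basis_enum k)) (at x)"
    unfolding coord_map_def[abs_def] using assms(1,2)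
    by (intro has_derivative_sum bounded_linear.has_derivative[OF bounded_linear_scaleR_left] FD_works) auto
  from FD_eqI[OF this] show ?thesis
    using coord_map_inner[of "map (\<lambda>f u. FD f x v) xs" k, where 'e='e] assms(1,3)
    by (simp add: coord_map_def)
qed

lemma coord_chart:
  fixes xs :: "('e::euclidean_space \<Rightarrow> real) list"
  assumes len: "length xs = DIM('e)" and W: "open W" "m \<in> W"
    and s: "\<And>k. k < DIM('e) \<Longrightarrow> smooth_on W (xs ! k)" and 0: "\<And>k. k < DIM('e) \<Longrightarrow> (xs ! k) m = 0"
    and inj: "\<And>v. (\<And>k. k < DIM('e) \<Longrightarrow> FD (xs ! k) m v = 0) \<Longrightarrow> v = 0"
  obtains U g \<epsilon> where "open U" "U \<subseteq> W" "m \<in> U" "\<epsilon> > 0"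
    "homeomorphism U (ball 0 \<epsilon>) (coord_map xs) (g :: 'e \<Rightarrow> 'e)"
    "smooth_on (ball 0 \<epsilon>) g" "\<And>x v. x \<in> U \<Longrightarrow> FD g (coord_map xs x) (FD (coord_map xs) x v) = v"
proof -
  let ?f = "coord_map xs :: 'e \<Rightarrow> 'e"
  have f: "smooth_on W ?f" using W(1) s len by (intro smooth_coord_map) auto
  have f0: "?f m = 0" by (rule euclidean_eqI_enum) (simp add: coord_map_inner[OF len] 0)
  have "v = 0" if "FD ?f m v = 0" for v
  proof (rule inj)
    show "FD (xs ! k) m v = 0" if "k < DIM('e)" for k
      using FD_coord_map[OF len _ that, where x=m and v=v] \<open>FD ?f m v = 0\<close> smooth_on_differentiable[OF s W(2)] by simp
  qed
  then obtain U V g where U: "open U" "U \<subseteq> W" "m \<in> U" "open V" "?f m \<in> V" and h: "homeomorphism U V ?f g"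
    and g: "smooth_on V g" "\<And>x v. x \<in> U \<Longrightarrow> FD g (?f x) (FD ?f x v) = v"
    using smooth_inverse_function[OF W f] by blast
  obtain \<epsilon> where \<epsilon>: "\<epsilon> > 0" "ball 0 \<epsilon> \<subseteq> V" using U(4,5) f0 open_contains_ball by metis
  have h': "?f ` U = V" "g ` V = U" "\<And>x. x \<in> U \<Longrightarrow> g (?f x) = x" "\<And>y. y \<in> V \<Longrightarrow> ?f (g y) = y"
    using h by (auto simp: homeomorphism_def)
  define U' where "U' = U \<inter> ?f -` ball 0 \<epsilon>"
  show thesis
  proof (rule that[of U' \<epsilon> g])
    show "open U'" unfolding U'_def
      using continuous_open_preimage[OF smooth_on_continuous[OF smooth_on_subset[OF f U(2)]] U(1) open_ball] .
    show "U' \<subseteq> W" "m \<in> U'" "\<epsilon> > 0" using U \<epsilon> f0 by (auto simp: U'_def)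
    show "homeomorphism U' (ball 0 \<epsilon>) ?f g"
    proof (rule homeomorphism_of_subsets[OF h])
      have "?f ` U' = ?f ` U \<inter> ball 0 \<epsilon>" unfolding U'_def by blast
      then show "?f ` U' = ball 0 \<epsilon>" using \<epsilon>(2) h'(1) by blast
    qed (use \<epsilon> in \<open>auto simp: U'_def\<close>)
    show "smooth_on (ball 0 \<epsilon>) g" using smooth_on_subset[OF g(1) \<epsilon>(2)] .
    show "FD g (?f x) (FD ?f x v) = v" if "x \<in> U'" for x v using g(2) that by (simp add: U'_def)
  qed
qed

lemma pqz_index_cases:
  fixes k r s :: nat
  assumes "k < 2 * r + s"
  obtains i where "i < r" "k = 2 * i" | i where "i < r" "k = 2 * i + 1" | j where "j < s" "k = 2 * r + j"
proof (cases "k < 2 * r")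
  case True
  then show thesis using that(1)[of "k div 2"] that(2)[of "k div 2"] by (cases "even k") auto
next
  case False
  then show thesis using that(3)[of "k - 2 * r"] assms by simp
qed

section \<open>Poisson brackets on open subsets of Euclidean space\<close>

locale poisson_domain =
  fixes D :: "'e::euclidean_space set" and \<Theta> :: "'e \<Rightarrow> 'e \<Rightarrow> 'e \<Rightarrow> real"
  assumes open_D: "open D"
    and smooth_\<Theta>: "\<And>b c. b \<in> Basis \<Longrightarrow> c \<in> Basis \<Longrightarrow> smooth_on D (\<Theta> b c)"
    and skew_\<Theta>: "\<And>b c y. b \<in> Basis \<Longrightarrow> c \<in> Basis \<Longrightarrow> y \<in> D \<Longrightarrow> \<Theta> b c y = - \<Theta> c b y"
begin

definition br :: "('e \<Rightarrow> real) \<Rightarrow> ('e \<Rightarrow> real) \<Rightarrow> 'e \<Rightarrow> real" where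
  "br F G y = (\<Sum>b\<in>Basis. \<Sum>c\<in>Basis. FD F y b * FD G y c * \<Theta> b c y)"

definition ham :: "('e \<Rightarrow> real) \<Rightarrow> 'e \<Rightarrow> 'e" where
  "ham G y = (\<Sum>b\<in>Basis. (\<Sum>c\<in>Basis. FD G y c * \<Theta> b c y) *\<^sub>R b)"

lemma br_ham:
  assumes "F differentiable (at y)"
  shows "br F G y = FD F y (ham G y)"
proof -
  have "ham G y \<bullet> b = (\<Sum>c\<in>Basis. FD G y c * \<Theta> b c y)" if "b \<in> Basis" for b
    unfolding ham_def using that by simp
  moreover have "FD F y (ham G y) = (\<Sum>b\<in>Basis. (ham G y \<bullet> b) *\<^sub>R FD F y b)"
    by (rule bounded_linear_basis_sum[OF has_derivative_bounded_linear[OF FD_works[OF assms]]])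
  ultimately have "FD F y (ham G y) = (\<Sum>b\<in>Basis. (\<Sum>c\<in>Basis. FD G y c * \<Theta> b c y) *\<^sub>R FD F y b)"
    by (simp cong: sum.cong)
  then show ?thesis
    unfolding br_def by (simp add: sum_distrib_left mult.commute mult.left_commute)
qed

lemma br_cong: "open S \<Longrightarrow> y \<in> S \<Longrightarrow> (\<And>x. x \<in> S \<Longrightarrow> F x = F' x) \<Longrightarrow> br F G y = br F' G y"
  unfolding br_def using FD_cong[of S y F F'] by simp

lemma br_skew: "y \<in> D \<Longrightarrow> br F G y = - br G F y"
proof -
  assume y: "y \<in> D"
  have "br F G y = (\<Sum>b\<in>Basis. \<Sum>c\<in>Basis. - (FD G y c * FD F y b * \<Theta> c b y))"
    unfolding br_def
  proof (intro sum.cong refl)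
    show "FD F y b * FD G y c * \<Theta> b c y = - (FD G y c * FD F y b * \<Theta> c b y)" if "b \<in> Basis" "c \<in> Basis" for b c
      using skew_\<Theta>[OF that y] by simp
  qed
  also have "\<dots> = - br G F y"
    unfolding br_def sum_negf by (subst sum.swap) simp
  finally show ?thesis .
qed

lemma br_const [simp]: "br (\<lambda>x. c) G y = 0"
  by (simp add: br_def)

lemma br_minus:
  assumes "F differentiable (at y)"
  shows "br (\<lambda>x. - F x) G y = - br F G y"
  unfolding br_def using FD_eqI[OF has_derivative_minus[OF FD_works[OF assms]]] by (simp add: sum_negf)

lemma smooth_br:
  assumes "open S" "S \<subseteq> D" "smooth_on S F" "smooth_on S G"
  shows "smooth_on S (br F G)"
  unfolding br_def
  by (intro smooth_intros assms smooth_on_FD smooth_on_subset[OF smooth_\<Theta>]) auto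

lemma smooth_ham:
  assumes "open S" "S \<subseteq> D" "smooth_on S G"
  shows "smooth_on S (ham G)"
  unfolding ham_def
  by (intro smooth_intros assms smooth_on_FD smooth_on_subset[OF smooth_\<Theta>] smooth_on_const) auto

end

locale poisson_domain_jacobi = poisson_domain +
  assumes jacobi: "\<And>S F G H y. open S \<Longrightarrow> S \<subseteq> D \<Longrightarrow> smooth_on S F \<Longrightarrow> smooth_on S G \<Longrightarrow> smooth_on S H \<Longrightarrow> y \<in> S \<Longrightarrow>
    br (br F G) H y + br (br G H) F y + br (br H F) G y = 0"
begin

lemma br_br_commute:
  assumes S: "open S" "S \<subseteq> D" "smooth_on S F" "smooth_on S G" "smooth_on S H" "y \<in> S"
    and c: "\<And>x. x \<in> S \<Longrightarrow> br G H x = c"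
  shows "br (br F G) H y = br (br F H) G y"
proof -
  have "br (br G H) F y = 0"
    using br_cong[OF S(1,6), of "br G H" "\<lambda>x. c" F] c by simp
  moreover have "br (br H F) G y = - br (br F H) G y"
  proof -
    have "br (br H F) G y = br (\<lambda>x. - br F H x) G y"
      by (rule br_cong[OF S(1,6)]) (use br_skew S(2) in blast)
    then show ?thesis
      using br_minus[OF smooth_on_differentiable[OF smooth_br[OF S(1,2,3,5)] S(6)]] by simp
  qed
  ultimately show ?thesis using jacobi[OF S] by simp
qed

lemma br_br_zero:
  assumes S: "open S" "S \<subseteq> D" "smooth_on S F" "smooth_on S G" "smooth_on S H" "y \<in> S"
    and 0: "\<And>x. x \<in> S \<Longrightarrow> br F H x = 0" "\<And>x. x \<in> S \<Longrightarrow> br G H x = 0"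
  shows "br (br F G) H y = 0"
  using br_br_commute[OF S 0(2)] br_cong[OF S(1,6), of "br F H" "\<lambda>x. 0" G] 0(1) by simp

lemma straighten_hamiltonians:
  fixes h :: "nat \<Rightarrow> 'a \<Rightarrow> real"
  assumes S: "open S" "S \<subseteq> D" "m \<in> S" and h: "\<And>i. i < k \<Longrightarrow> smooth_on S (h i)"
    and c: "\<And>i j x. i < k \<Longrightarrow> j < k \<Longrightarrow> x \<in> S \<Longrightarrow> br (h i) (h j) x = c i j"
    and indep: "\<And>c. (\<Sum>i<k. c i *\<^sub>R ham (h i) m) = 0 \<Longrightarrow> \<forall>i<k. c i = (0::real)"
  obtains T \<Psi> e where "open T" "m \<in> T" "T \<subseteq> S" "smooth_on T \<Psi>" "\<Psi> m = (0 :: 'a)"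
    "\<And>v. FD \<Psi> m v = 0 \<Longrightarrow> v = 0" "inj_on e {..<k}" "e ` {..<k} \<subseteq> Basis"
    "\<And>x i. x \<in> T \<Longrightarrow> i < k \<Longrightarrow> FD \<Psi> x (ham (h i) x) = e i"
proof -
  have hs: "smooth_on S (ham (h i))" if "i < k" for i using smooth_ham[OF S(1,2) h[OF that]] .
  have comm: "FD (\<lambda>y. FD F y (ham (h i) y)) x (ham (h j) x) = FD (\<lambda>y. FD F y (ham (h j) y)) x (ham (h i) x)"
    if ij: "i < k" "j < k" and T: "open T" "T \<subseteq> S" and F: "smooth_on T F" and x: "x \<in> T" for i j T and F :: "'a \<Rightarrow> 'a" and x
  proof (rule euclidean_eqI)
    fix b :: 'a
    define Fb where "Fb y = F y \<bullet> b" for y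
    have Fb: "smooth_on T Fb" unfolding Fb_def by (intro smooth_on_inner T F) simp
    have TD: "T \<subseteq> D" using T S by blast
    have *: "FD (\<lambda>y. FD F y (ham (h i) y)) x v \<bullet> b = FD (br Fb (h i)) x v" if i: "i < k" for i v
    proof -
      have 1: "smooth_on T (\<lambda>y. FD F y (ham (h i) y))"
        by (intro smooth_on_FD_apply T F smooth_on_subset[OF hs[OF i]])
      have comp: "FD (\<lambda>y. f y \<bullet> b) y v = FD f y v \<bullet> b" if "f differentiable (at y)" for f :: "'a \<Rightarrow> 'a" and y v
        using FD_eqI[OF bounded_linear.has_derivative[OF bounded_linear_inner_left FD_works[OF that]]] by metis
      have "FD (\<lambda>y. FD F y (ham (h i) y)) x v \<bullet> b = FD (\<lambda>y. FD F y (ham (h i) y) \<bullet> b) x v"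
        using comp[OF smooth_on_differentiable[OF 1 x]] by simp
      also have "FD (\<lambda>y. FD F y (ham (h i) y) \<bullet> b) x = FD (br Fb (h i)) x"
      proof (rule FD_cong[OF T(1) x])
        show "FD F y (ham (h i) y) \<bullet> b = br Fb (h i) y" if "y \<in> T" for y
          using comp[OF smooth_on_differentiable[OF F that]] br_ham[OF smooth_on_differentiable[OF Fb that]]
          by (simp add: Fb_def[abs_def])
      qed
      finally show ?thesis .
    qed
    have hT: "smooth_on T (h i)" if "i < k" for i using smooth_on_subset[OF h[OF that] T(2)] .
    have "FD (br Fb (h i)) x (ham (h j) x) = br (br Fb (h i)) (h j) x" if "i < k" for i j
      using br_ham[OF smooth_on_differentiable[OF smooth_br[OF T(1) TD Fb hT[OF that]] x]] by simp
    moreover have "br (br Fb (h i)) (h j) x = br (br Fb (h j)) (h i) x"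
      by (rule br_br_commute[OF T(1) TD Fb hT[OF ij(1)] hT[OF ij(2)] x, of "c i j"]) (use c ij T in blast)
    ultimately show "FD (\<lambda>y. FD F y (ham (h i) y)) x (ham (h j) x) \<bullet> b = FD (\<lambda>y. FD F y (ham (h j) y)) x (ham (h i) x) \<bullet> b"
      using * ij by simp
  qed
  obtain T \<Psi> \<Phi> e where T: "open T" "m \<in> T" "T \<subseteq> S" "open (\<Psi> ` T)" "smooth_on T \<Psi>" "smooth_on (\<Psi> ` T) \<Phi>"
    "\<Psi> m = (0 :: 'a)" "\<And>x. x \<in> T \<Longrightarrow> \<Phi> (\<Psi> x) = x" "inj_on e {..<k}" "e ` {..<k} \<subseteq> Basis"
    "\<And>x i. x \<in> T \<Longrightarrow> i < k \<Longrightarrow> FD \<Psi> x (ham (h i) x) = e i"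
  proof (rule straighten_commuting[where X = "\<lambda>i. ham (h i)" and k = k, OF S(1,3)])
    show "smooth_on S (ham (h i))" if "i < k" for i using hs[OF that] .
    show "FD (\<lambda>y. FD F y (ham (h i) y)) x (ham (h j) x) = FD (\<lambda>y. FD F y (ham (h j) y)) x (ham (h i) x)"
      if "i < k" "j < k" "open T" "T \<subseteq> S" "smooth_on T F" "x \<in> T" for i j T and F :: "'a \<Rightarrow> 'a" and x
      using comm[OF that] .
    show "\<forall>i<k. c i = 0" if "(\<Sum>i<k. c i *\<^sub>R ham (h i) m) = 0" for c using indep[OF that] .
  qed (rule that, assumption+)
  have "v = 0" if "FD \<Psi> m v = 0" for v
  proof -
    have "FD (\<lambda>x. \<Phi> (\<Psi> x)) m v = FD \<Phi> (\<Psi> m) (FD \<Psi> m v)"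
      using FD_compose[OF smooth_on_differentiable[OF T(5,2)] smooth_on_differentiable[OF T(6)]] T(2) by blast
    moreover have "FD (\<lambda>x. \<Phi> (\<Psi> x)) m = FD (\<lambda>x. x) m" by (rule FD_cong[OF T(1,2)]) (rule T(8))
    moreover have "FD (\<lambda>x. x) m v = v" using FD_linear[OF bounded_linear_ident] .
    moreover have "linear (FD \<Phi> (\<Psi> m))"
      using smooth_on_bounded_linear_FD[OF T(6)] T(2) bounded_linear.linear by blast
    ultimately show ?thesis using that linear_0 by metis
  qed
  with T show thesis by (intro that[of T \<Psi> e]) simp_all
qed

end

lemma FD_inner_left:
  "f differentiable (at x) \<Longrightarrow> FD (\<lambda>y. f y \<bullet> b) x v = FD f x v \<bullet> b"
  using FD_eqI[OF bounded_linear.has_derivative[OF bounded_linear_inner_left FD_works]] by metis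

section \<open>Canonical coordinates for an involutive family\<close>

lemma index_even_odd: "k < 2 * r \<Longrightarrow> \<exists>i<r. k = 2 * i \<or> k = 2 * i + 1" for k r :: nat
  by presburger

text \<open>The matrix of a bivector in coordinates \<open>p\<^sub>0, q\<^sub>0, p\<^sub>1, q\<^sub>1, \<dots>, z\<^sub>0, z\<^sub>1, \<dots>\<close>
  with \<open>{q\<^sub>i, p\<^sub>i} = 1\<close> and no other nonzero brackets except \<open>{z\<^sub>i, z\<^sub>j}\<close>.\<close>

definition canonical_matrix :: "nat \<Rightarrow> nat \<Rightarrow> (nat \<Rightarrow> nat \<Rightarrow> real) \<Rightarrow> bool" where
  "canonical_matrix r s B \<longleftrightarrow> (\<forall>k l. B k l = - B l k) \<and>
    (\<forall>i<r. \<forall>j<r. B (2 * i) (2 * j) = 0 \<and> B (2 * i + 1) (2 * j + 1) = 0 \<and> B (2 * i + 1) (2 * j) = (if i = j then 1 else 0)) \<and>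
    (\<forall>i<s. \<forall>j<r. B (2 * r + i) (2 * j) = 0 \<and> B (2 * r + i) (2 * j + 1) = 0)"

lemma canonical_matrixD:
  assumes "canonical_matrix r s B"
  shows "B k l = - B l k"
    "i < r \<Longrightarrow> j < r \<Longrightarrow> B (2 * i) (2 * j) = 0" "i < r \<Longrightarrow> j < r \<Longrightarrow> B (2 * i + 1) (2 * j + 1) = 0"
    "i < r \<Longrightarrow> j < r \<Longrightarrow> B (2 * i + 1) (2 * j) = (if i = j then 1 else 0)"
    "i < r \<Longrightarrow> j < r \<Longrightarrow> B (2 * i) (2 * j + 1) = (if i = j then -1 else 0)"
    "t < s \<Longrightarrow> j < r \<Longrightarrow> B (2 * r + t) (2 * j) = 0" "t < s \<Longrightarrow> j < r \<Longrightarrow> B (2 * r + t) (2 * j + 1) = 0"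
    "t < s \<Longrightarrow> j < r \<Longrightarrow> B (2 * j) (2 * r + t) = 0" "t < s \<Longrightarrow> j < r \<Longrightarrow> B (2 * j + 1) (2 * r + t) = 0"
proof -
  show skew: "B k l = - B l k" for k l using assms unfolding canonical_matrix_def by blast
  show 1: "i < r \<Longrightarrow> j < r \<Longrightarrow> B (2 * i) (2 * j) = 0" "i < r \<Longrightarrow> j < r \<Longrightarrow> B (2 * i + 1) (2 * j + 1) = 0"
    "i < r \<Longrightarrow> j < r \<Longrightarrow> B (2 * i + 1) (2 * j) = (if i = j then 1 else 0)"
    "t < s \<Longrightarrow> j < r \<Longrightarrow> B (2 * r + t) (2 * j) = 0" "t < s \<Longrightarrow> j < r \<Longrightarrow> B (2 * r + t) (2 * j + 1) = 0" for i j t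
    using assms unfolding canonical_matrix_def by blast+
  show "i < r \<Longrightarrow> j < r \<Longrightarrow> B (2 * i) (2 * j + 1) = (if i = j then -1 else 0)"
    using skew[of "2 * i" "2 * j + 1"] 1(3)[of j i] by auto
  show "t < s \<Longrightarrow> j < r \<Longrightarrow> B (2 * j) (2 * r + t) = 0" "t < s \<Longrightarrow> j < r \<Longrightarrow> B (2 * j + 1) (2 * r + t) = 0"
    using skew[of "2 * j" "2 * r + t"] skew[of "2 * j + 1" "2 * r + t"] 1(4,5)[of t j] by auto
qed

lemma canonical_matrix_z:
  assumes "canonical_matrix r s B" "t < s" "l < 2 * r"
  shows "B (2 * r + t) l = 0" "B l (2 * r + t) = 0"
  using canonical_matrixD(6-9)[OF assms(1,2)] index_even_odd[OF assms(3)] by auto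

lemma canonical_matrix_cong:
  assumes "canonical_matrix r s B" "\<And>k l. k < 2 * r + s \<Longrightarrow> l < 2 * r + s \<Longrightarrow> B' k l = B k l"
    "\<And>k l. B' k l = - B' l k"
  shows "canonical_matrix r s B'"
  unfolding canonical_matrix_def
proof (intro conjI)
  show "\<forall>k l. B' k l = - B' l k" using assms(3) by blast
qed (use canonical_matrixD(2-4,6,7)[OF assms(1)] in \<open>simp_all add: assms(2)\<close>)

locale involutive_family = poisson_domain_jacobi D \<Theta>
  for D :: "'e::euclidean_space set" and \<Theta> +
  fixes V :: "'e set" and m :: 'e and r :: nat and p :: "nat \<Rightarrow> 'e \<Rightarrow> real"
  assumes V: "open V" "V \<subseteq> D" "m \<in> V"
    and smooth_p: "\<And>i. i < r \<Longrightarrow> smooth_on V (p i)"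
    and involution: "\<And>i j x. i < r \<Longrightarrow> j < r \<Longrightarrow> x \<in> V \<Longrightarrow> br (p i) (p j) x = 0"
    and p_m: "\<And>i. i < r \<Longrightarrow> p i m = 0"
    and indep: "\<And>c. (\<Sum>i<r. c i *\<^sub>R ham (p i) m) = 0 \<Longrightarrow> \<forall>i<r. c i = (0::real)"
begin

definition conjugate :: "'e set \<Rightarrow> (nat \<Rightarrow> 'e \<Rightarrow> real) \<Rightarrow> nat \<Rightarrow> bool" where
  "conjugate W q j \<longleftrightarrow> open W \<and> m \<in> W \<and> W \<subseteq> V \<and> (\<forall>i<j. smooth_on W (q i) \<and> q i m = 0) \<and>
    (\<forall>x\<in>W. \<forall>i<j. (\<forall>l<r. br (q i) (p l) x = (if i = l then 1 else 0)) \<and> (\<forall>l<j. br (q i) (q l) x = 0))"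

definition fam :: "(nat \<Rightarrow> 'e \<Rightarrow> real) \<Rightarrow> nat \<Rightarrow> 'e \<Rightarrow> real" where
  "fam q i = (if i < r then p i else q (i - r))"

lemma conjugateD:
  assumes "conjugate W q j"
  shows "open W" "m \<in> W" "W \<subseteq> V" "W \<subseteq> D" "i < j \<Longrightarrow> smooth_on W (q i)" "i < j \<Longrightarrow> q i m = 0"
    "x \<in> W \<Longrightarrow> i < j \<Longrightarrow> l < r \<Longrightarrow> br (q i) (p l) x = (if i = l then 1 else 0)"
    "x \<in> W \<Longrightarrow> i < j \<Longrightarrow> l < j \<Longrightarrow> br (q i) (q l) x = 0"
    "x \<in> W \<Longrightarrow> i < j \<Longrightarrow> l < r \<Longrightarrow> br (p l) (q i) x = (if i = l then -1 else 0)"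
    "x \<in> W \<Longrightarrow> l < r \<Longrightarrow> i < r \<Longrightarrow> br (p l) (p i) x = 0"
    "i < r + j \<Longrightarrow> smooth_on W (fam q i)"
proof -
  show 1: "open W" "m \<in> W" "W \<subseteq> V" and 2: "W \<subseteq> D" and 3: "i < j \<Longrightarrow> smooth_on W (q i)" and "i < j \<Longrightarrow> q i m = 0"
    and 4: "x \<in> W \<Longrightarrow> i < j \<Longrightarrow> l < r \<Longrightarrow> br (q i) (p l) x = (if i = l then 1 else 0)"
    and "x \<in> W \<Longrightarrow> i < j \<Longrightarrow> l < j \<Longrightarrow> br (q i) (q l) x = 0" for i l x
    using assms V(2) unfolding conjugate_def by blast+
  show "br (p l) (q i) x = (if i = l then -1 else 0)" if "x \<in> W" "i < j" "l < r"
    using br_skew[of x "p l" "q i"] 2 4[OF that] that by auto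
  show "x \<in> W \<Longrightarrow> l < r \<Longrightarrow> i < r \<Longrightarrow> br (p l) (p i) x = 0" using involution 1 by blast
  show "smooth_on W (fam q i)" if "i < r + j"
  proof (cases "i < r")
    case True
    then show ?thesis using smooth_on_subset[OF smooth_p 1(3)] by (simp add: fam_def)
  next
    case False
    then have "smooth_on W (q (i - r))" using 3[of "i - r"] that by simp
    then show ?thesis using False by (simp add: fam_def)
  qed
qed

lemma conjugate_indep:
  assumes c: "conjugate W q j" "j \<le> r" and 0: "(\<Sum>i<r + j. a i *\<^sub>R ham (fam q i) m) = 0"
  shows "\<forall>i<r + j. a i = (0::real)"
proof -
  note cD = conjugateD[OF c(1)]
  have split: "(\<Sum>i<r + j. a i *\<^sub>R f (fam q i)) = (\<Sum>i<r. a i *\<^sub>R f (p i)) + (\<Sum>i<j. a (r + i) *\<^sub>R f (q i))" for f :: "_ \<Rightarrow> 'c::real_vector"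
  proof -
    have "(\<Sum>i<r + j. a i *\<^sub>R f (fam q i)) = (\<Sum>i<r. a i *\<^sub>R f (fam q i)) + (\<Sum>i = r..<r + j. a i *\<^sub>R f (fam q i))"
      using sum.atLeastLessThan_concat[of 0 r "r + j" "\<lambda>i. a i *\<^sub>R f (fam q i)"] by (simp add: atLeast0LessThan)
    also have "(\<Sum>i = r..<r + j. a i *\<^sub>R f (fam q i)) = (\<Sum>i<j. a (r + i) *\<^sub>R f (q i))"
      using sum.shift_bounds_nat_ivl[of "\<lambda>i. a i *\<^sub>R f (fam q i)" 0 r j]
      by (simp add: fam_def atLeast0LessThan add.commute)
    finally show ?thesis by (simp add: fam_def)
  qed
  have q0: "a (r + l) = 0" if l: "l < j" for l
  proof -
    have lr: "l < r" using l c by simp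
    have d: "p l differentiable (at m)"
      using smooth_on_differentiable[OF smooth_p[OF lr] V(3)] .
    have "linear (FD (p l) m)" using FD_works[OF d] has_derivative_linear by blast
    then have "FD (p l) m (\<Sum>i<r + j. a i *\<^sub>R ham (fam q i) m) = (\<Sum>i<r + j. a i *\<^sub>R br (p l) (fam q i) m)"
      by (simp add: linear_sum linear_cmul br_ham[OF d])
    also have "\<dots> = (\<Sum>i<r. a i *\<^sub>R br (p l) (p i) m) + (\<Sum>i<j. a (r + i) *\<^sub>R br (p l) (q i) m)"
      by (rule split)
    also have "(\<Sum>i<r. a i *\<^sub>R br (p l) (p i) m) = 0"
      using cD(10)[OF cD(2)] lr by simp
    also have "(\<Sum>i<j. a (r + i) *\<^sub>R br (p l) (q i) m) = (\<Sum>i<j. if i = l then - a (r + i) else 0)"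
      using cD(9)[OF cD(2)] lr by (intro sum.cong) auto
    also have "0 + \<dots> = - a (r + l)" using l by simp
    finally have "FD (p l) m (\<Sum>i<r + j. a i *\<^sub>R ham (fam q i) m) = - a (r + l)" .
    then show ?thesis using 0 \<open>linear (FD (p l) m)\<close> linear_0 by fastforce
  qed
  then have "(\<Sum>i<r. a i *\<^sub>R ham (p i) m) = 0"
    using 0 unfolding split[of "\<lambda>h. ham h m"] by simp
  then have "\<forall>i<r. a i = 0" by (rule indep)
  then show ?thesis using q0 by (metis add_diff_inverse_nat nat_add_left_cancel_less)
qed

lemma conjugate_straighten:
  assumes c: "conjugate W q j" "j \<le> r"
  obtains T \<Psi> e where "open T" "m \<in> T" "T \<subseteq> W" "smooth_on T \<Psi>" "\<Psi> m = (0 :: 'e)"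
    "\<And>v. FD \<Psi> m v = 0 \<Longrightarrow> v = 0" "inj_on e {..<r + j}" "e ` {..<r + j} \<subseteq> Basis"
    "\<And>x i. x \<in> T \<Longrightarrow> i < r + j \<Longrightarrow> FD \<Psi> x (ham (fam q i) x) = e i"
    "\<And>x i b. x \<in> T \<Longrightarrow> i < r + j \<Longrightarrow> br (\<lambda>y. \<Psi> y \<bullet> b) (fam q i) x = e i \<bullet> b"
proof -
  note cD = conjugateD[OF c(1)]
  define c where "c i l = br (fam q i) (fam q l) m" for i l
  have const: "br (fam q i) (fam q l) x = c i l" if "i < r + j" "l < r + j" "x \<in> W" for i l x
    using that cD(2) cD(7-10)[of x] cD(7-10)[of m] by (auto simp: fam_def c_def)
  obtain T \<Psi> e where T: "open T" "m \<in> T" "T \<subseteq> W" "smooth_on T \<Psi>" "\<Psi> m = (0 :: 'e)"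
    "\<And>v. FD \<Psi> m v = 0 \<Longrightarrow> v = 0" "inj_on e {..<r + j}" "e ` {..<r + j} \<subseteq> Basis"
    "\<And>x i. x \<in> T \<Longrightarrow> i < r + j \<Longrightarrow> FD \<Psi> x (ham (fam q i) x) = e i"
  proof (rule straighten_hamiltonians[where h = "fam q" and k = "r + j" and c = c, OF cD(1,4,2)])
    show "smooth_on W (fam q i)" if "i < r + j" for i using cD(11)[OF that] .
    show "br (fam q i) (fam q l) x = c i l" if "i < r + j" "l < r + j" "x \<in> W" for i l x using const[OF that] .
    show "\<forall>i<r + j. a i = 0" if "(\<Sum>i<r + j. a i *\<^sub>R ham (fam q i) m) = 0" for a
      using conjugate_indep[OF assms that] .
  qed (rule that, assumption+)
  have "br (\<lambda>y. \<Psi> y \<bullet> b) (fam q i) x = e i \<bullet> b" if "x \<in> T" "i < r + j" for x i b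
  proof -
    have "smooth_on T (\<lambda>y. \<Psi> y \<bullet> b)" by (intro smooth_on_inner T smooth_on_const)
    from br_ham[OF smooth_on_differentiable[OF this that(1)]]
    show ?thesis
      using FD_inner_left[OF smooth_on_differentiable[OF T(4) that(1)]] T(9)[OF that] by simp
  qed
  with T show thesis by (intro that[of T \<Psi> e]) simp_all
qed

lemma conjugate_extend:
  assumes c: "conjugate W q j" "j < r"
  obtains W' q' where "conjugate W' q' (Suc j)"
proof -
  note cD = conjugateD[OF c(1)]
  obtain T \<Psi> e where T: "open T" "m \<in> T" "T \<subseteq> W" "smooth_on T \<Psi>" "\<Psi> m = (0 :: 'e)"
    and e: "inj_on e {..<r + j}" "e ` {..<r + j} \<subseteq> Basis"
    and br: "\<And>x i b. x \<in> T \<Longrightarrow> i < r + j \<Longrightarrow> br (\<lambda>y. \<Psi> y \<bullet> b) (fam q i) x = e i \<bullet> b"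
    by (rule conjugate_straighten[OF c(1) less_imp_le[OF c(2)]]) (rule that, assumption+)
  define Q where "Q y = \<Psi> y \<bullet> e j" for y
  have ee: "e i \<bullet> e j = (if i = j then 1 else 0)" if "i < r + j" for i
    using e c(2) that by (auto simp: inj_on_def inner_Basis image_subset_iff)
  have Qfam: "br Q (fam q i) x = (if i = j then 1 else 0)" if "x \<in> T" "i < r + j" for x i
    using br[OF that, of "e j"] ee[OF that(2)] by (simp add: Q_def[abs_def])
  have Qp: "br Q (p i) x = (if j = i then 1 else 0)" if "x \<in> T" "i < r" for x i
    using Qfam[of x i] that by (auto simp: fam_def)
  have Qq: "br Q (q i) x = 0" if "x \<in> T" "i < j" for x i
    using Qfam[of x "r + i"] that c(2) by (auto simp: fam_def)
  have TD: "T \<subseteq> D" using T(3) cD(4) by blast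
  have qQ: "br (q i) Q x = 0" if "x \<in> T" "i < j" for x i
    using br_skew[of x "q i" Q] Qq[OF that] TD that(1) by auto
  have QQ: "br Q Q x = 0" if "x \<in> T" for x
    using br_skew[of x Q Q] TD that by auto
  have "smooth_on T Q" unfolding Q_def by (intro smooth_on_inner T smooth_on_const)
  moreover have "Q m = 0" by (simp add: Q_def T(5))
  moreover have "T \<subseteq> V" using T(3) cD(3) by blast
  ultimately have "conjugate T (q(j := Q)) (Suc j)"
    unfolding conjugate_def
    using T(1,2,3) cD(6-8) smooth_on_subset[OF cD(5) T(3)] Qp Qq qQ QQ
    by (auto simp: less_Suc_eq subset_iff)
  then show thesis by (rule that)
qed

lemma conjugate_exists: obtains W q where "conjugate W q r"
proof -
  have "\<exists>W q. conjugate W q j" if "j \<le> r" for j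
    using that
  proof (induction j)
    case 0
    have "conjugate V q 0" for q using V by (simp add: conjugate_def)
    then show ?case by blast
  next
    case (Suc j)
    then show ?case using conjugate_extend[of _ _ j] by (metis Suc_le_eq less_imp_le)
  qed
  then show thesis using that by blast
qed

theorem canonical_coordinates:
  obtains U q z xs g \<epsilon> where "open U" "m \<in> U" "U \<subseteq> V" "2 * r \<le> DIM('e)" "xs = pqz r (DIM('e) - 2 * r) p q z"
    "homeomorphism U (ball 0 \<epsilon>) (coord_map xs) (g :: 'e \<Rightarrow> 'e)" "smooth_on (ball 0 \<epsilon>) g"
    "\<And>k. k < DIM('e) \<Longrightarrow> smooth_on U (xs ! k)" "\<And>k. k < DIM('e) \<Longrightarrow> (xs ! k) m = 0"
    "\<And>x. x \<in> U \<Longrightarrow> canonical_matrix r (DIM('e) - 2 * r) (\<lambda>k l. br (xs ! k) (xs ! l) x)"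
    "\<And>F x y. \<lbrakk>smooth_on U F; \<forall>x\<in>U. \<forall>l<2 * r. br F (xs ! l) x = 0;
       x \<in> U; y \<in> U; \<forall>k<DIM('e) - 2 * r. z k x = z k y\<rbrakk> \<Longrightarrow> F x = F y"
proof -
  obtain W q where c: "conjugate W q r" by (rule conjugate_exists)
  note cD = conjugateD[OF c]
  obtain T \<Psi> e where T: "open T" "m \<in> T" "T \<subseteq> W" "smooth_on T \<Psi>" "\<Psi> m = (0 :: 'e)"
    and inj: "\<And>v. FD \<Psi> m v = 0 \<Longrightarrow> v = 0"
    and e: "inj_on e {..<r + r}" "e ` {..<r + r} \<subseteq> Basis"
    and \<Psi>e: "\<And>x i. x \<in> T \<Longrightarrow> i < r + r \<Longrightarrow> FD \<Psi> x (ham (fam q i) x) = e i"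
    and br: "\<And>x i b. x \<in> T \<Longrightarrow> i < r + r \<Longrightarrow> br (\<lambda>y. \<Psi> y \<bullet> b) (fam q i) x = e i \<bullet> b"
    by (rule conjugate_straighten[OF c order_refl]) (rule that, assumption+)
  let ?n = "DIM('e)" and ?s = "DIM('e) - 2 * r"
  have TD: "T \<subseteq> D" using T(3) cD(4) by blast
  have card_e: "card (e ` {..<r + r}) = 2 * r" using card_image[OF e(1)] by simp
  then have r: "2 * r \<le> ?n" using card_mono[OF finite_Basis e(2)] by simp
  have "card (Basis - e ` {..<r + r}) = ?s"
    using card_Diff_subset[OF finite_subset[OF e(2) finite_Basis] e(2)] card_e by simp
  then obtain d where d: "bij_betw d {..<?s} (Basis - e ` {..<r + r})"
    using ex_bij_betw_nat_finite[of "Basis - e ` {..<r + r}"] by (auto simp: atLeast0LessThan)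
  define z where "z k y = \<Psi> y \<bullet> d k" for k y
  have dB: "d k \<in> Basis" "d k \<notin> e ` {..<r + r}" if "k < ?s" for k using d that by (auto simp: bij_betw_def)
  have zs: "smooth_on T (z k)" for k unfolding z_def by (intro smooth_on_inner T smooth_on_const)
  have zfam: "br (z k) (fam q i) x = 0" if "x \<in> T" "k < ?s" "i < r + r" for x k i
  proof -
    have "e i \<in> e ` {..<r + r}" using that(3) by simp
    then have "e i \<in> Basis" "e i \<noteq> d k" using e(2) dB(2)[OF that(2)] by auto
    then show ?thesis using br[OF that(1,3), of "d k"] dB(1)[OF that(2)] by (simp add: z_def[abs_def] inner_Basis)
  qed
  have zp: "br (z k) (p i) x = 0" if "x \<in> T" "k < ?s" "i < r" for x k i
    using zfam[of x k i] that by (simp add: fam_def)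
  have zq: "br (z k) (q i) x = 0" if "x \<in> T" "k < ?s" "i < r" for x k i
    using zfam[of x k "r + i"] that by (simp add: fam_def)
  define xs where "xs = pqz r ?s p q z"
  have len: "length xs = ?n" using r by (simp add: xs_def length_pqz)
  have nth: "xs ! (2 * i) = p i" "xs ! (2 * i + 1) = q i" if "i < r" for i
    using that pqz_nth(1,2) by (auto simp: xs_def)
  have nth_z: "xs ! (2 * r + k) = z k" if "k < ?s" for k using that pqz_nth(3) by (simp add: xs_def)
  have cases: "P (xs ! k)" if "k < ?n" "\<And>i. i < r \<Longrightarrow> P (p i)" "\<And>i. i < r \<Longrightarrow> P (q i)" "\<And>j. j < ?s \<Longrightarrow> P (z j)"
    for P k
  proof -
    have "k < 2 * r + ?s" using that(1) r by simp
    then show ?thesis by (rule pqz_index_cases) (use that(2-4) nth nth_z in auto)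
  qed
  have xs_s: "smooth_on T (xs ! k)" if "k < ?n" for k
    using that
  proof (rule cases)
    show "smooth_on T (p i)" if "i < r" for i using smooth_on_subset[OF smooth_p[OF that]] T(3) cD(3) by blast
    show "smooth_on T (q i)" if "i < r" for i using smooth_on_subset[OF cD(5)[OF that] T(3)] .
  qed (rule zs)
  have xs_0: "(xs ! k) m = 0" if "k < ?n" for k
    using that by (rule cases) (simp_all add: p_m cD(6) z_def T(5))
  have xs_inj: "v = 0" if 0: "\<And>k. k < ?n \<Longrightarrow> FD (xs ! k) m v = 0" for v
  proof -
    have p0: "FD (p i) m v = 0" and q0: "FD (q i) m v = 0" if "i < r" for i
      using 0[of "2 * i"] 0[of "2 * i + 1"] nth[OF that] that r by auto
    have z0: "FD (z k) m v = 0" if "k < ?s" for k using 0[of "2 * r + k"] nth_z[OF that] that r by auto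
    have lin\<Psi>: "linear (FD \<Psi> m)" using smooth_on_bounded_linear_FD[OF T(4,2)] bounded_linear.linear by blast
    define a where "a i = FD \<Psi> m v \<bullet> e i" for i
    have "FD \<Psi> m v \<bullet> b = 0" if "b \<in> Basis - e ` {..<r + r}" for b
    proof -
      have "b \<in> d ` {..<?s}" using d that by (simp add: bij_betw_def)
      then obtain k where k: "k < ?s" "b = d k" by blast
      show ?thesis using z0[OF k(1)] FD_inner_left[OF smooth_on_differentiable[OF T(4,2)], of "d k" v] k(2)
        by (simp add: z_def[abs_def])
    qed
    then have "(\<Sum>b\<in>Basis. (FD \<Psi> m v \<bullet> b) *\<^sub>R b) = (\<Sum>b\<in>e ` {..<r + r}. (FD \<Psi> m v \<bullet> b) *\<^sub>R b)"
      by (intro sum.mono_neutral_right) (use e(2) in auto)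
    then have "FD \<Psi> m v = (\<Sum>b\<in>e ` {..<r + r}. (FD \<Psi> m v \<bullet> b) *\<^sub>R b)"
      by (simp add: euclidean_representation)
    also have "\<dots> = (\<Sum>i<r + r. a i *\<^sub>R e i)" by (rule sum.reindex_cong[OF e(1)]) (auto simp: a_def)
    also have "\<dots> = FD \<Psi> m (\<Sum>i<r + r. a i *\<^sub>R ham (fam q i) m)"
      using \<Psi>e[OF T(2)] by (simp add: linear_sum[OF lin\<Psi>] linear_cmul[OF lin\<Psi>])
    finally have "FD \<Psi> m (v - (\<Sum>i<r + r. a i *\<^sub>R ham (fam q i) m)) = 0"
      by (simp add: linear_diff[OF lin\<Psi>])
    from inj[OF this] have v: "v = (\<Sum>i<r + r. a i *\<^sub>R ham (fam q i) m)" by simp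
    have app: "FD f m v = (\<Sum>i<r + r. a i * br f (fam q i) m)" if f: "f differentiable (at m)" for f :: "'e \<Rightarrow> real"
    proof -
      have "linear (FD f m)" using FD_works[OF f] has_derivative_linear by blast
      then show ?thesis by (subst v) (simp add: linear_sum linear_cmul br_ham[OF f])
    qed
    have "a i = 0" if i: "i < r + r" for i
    proof (cases "i < r")
      case True
      have "(\<Sum>l<r + r. a l * br (q i) (fam q l) m) = (\<Sum>l<r + r. if l = i then a l else 0)"
        using cD(7,8)[OF cD(2)] True by (intro sum.cong) (auto simp: fam_def)
      then show ?thesis
        using app[OF smooth_on_differentiable[OF cD(5)[OF True] cD(2)]] q0[OF True] i by simp
    next
      case False
      then have ir: "i - r < r" using i by simp
      have "(\<Sum>l<r + r. a l * br (p (i - r)) (fam q l) m) = (\<Sum>l<r + r. if l = i then - a l else 0)"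
        using cD(9,10)[OF cD(2)] ir False by (intro sum.cong) (auto simp: fam_def)
      then show ?thesis
        using app[OF smooth_on_differentiable[OF smooth_p[OF ir] V(3)]] p0[OF ir] i by simp
    qed
    then show "v = 0" using v by simp
  qed
  obtain U g \<epsilon> where U: "open U" "U \<subseteq> T" "m \<in> U" "\<epsilon> > 0"
    and h: "homeomorphism U (ball 0 \<epsilon>) (coord_map xs) (g :: 'e \<Rightarrow> 'e)"
    and g: "smooth_on (ball 0 \<epsilon>) g" "\<And>x v. x \<in> U \<Longrightarrow> FD g (coord_map xs x) (FD (coord_map xs) x v) = v"
  proof (rule coord_chart[OF len T(1,2)])
    show "smooth_on T (xs ! k)" "(xs ! k) m = 0" if "k < ?n" for k using xs_s[OF that] xs_0[OF that] .
    show "v = 0" if "\<And>k. k < ?n \<Longrightarrow> FD (xs ! k) m v = 0" for v using xs_inj[OF that] .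
  qed (rule that, assumption+)
  have UW: "U \<subseteq> W" using U(2) T(3) by blast
  have B: "canonical_matrix r ?s (\<lambda>k l. br (xs ! k) (xs ! l) x)" if x: "x \<in> U" for x
    unfolding canonical_matrix_def
  proof (intro conjI allI impI)
    have xTW: "x \<in> T" "x \<in> W" using x U(2) UW by blast+
    show "br (xs ! k) (xs ! l) x = - br (xs ! l) (xs ! k) x" for k l using br_skew xTW(1) TD by blast
    show "br (xs ! (2 * i)) (xs ! (2 * j)) x = 0" "br (xs ! (2 * i + 1)) (xs ! (2 * j + 1)) x = 0"
      "br (xs ! (2 * i + 1)) (xs ! (2 * j)) x = (if i = j then 1 else 0)" if "i < r" "j < r" for i j
      by (simp_all only: nth that cD(10)[OF xTW(2) that] cD(7,8)[OF xTW(2) that])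
    show "br (xs ! (2 * r + i)) (xs ! (2 * j)) x = 0" "br (xs ! (2 * r + i)) (xs ! (2 * j + 1)) x = 0"
      if "i < ?s" "j < r" for i j
      by (simp_all only: nth nth_z that zp[OF xTW(1) that] zq[OF xTW(1) that])
  qed
  have const: "F x = F y" if F: "smooth_on U F" and F0: "\<forall>x\<in>U. \<forall>l<2 * r. br F (xs ! l) x = 0"
    and x: "x \<in> U" and y: "y \<in> U" and zxy: "\<forall>k<?s. z k x = z k y" for F x y
  proof -
    let ?f = "coord_map xs :: 'e \<Rightarrow> 'e" and ?B = "ball (0::'e) \<epsilon>"
    have hh: "?f ` U = ?B" "g ` ?B = U" "\<And>x. x \<in> U \<Longrightarrow> g (?f x) = x" "\<And>w. w \<in> ?B \<Longrightarrow> ?f (g w) = w"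
      using h by (auto simp: homeomorphism_def)
    have xd: "(xs ! k) differentiable (at u)" if "k < ?n" "u \<in> U" for k u
      using smooth_on_differentiable[OF xs_s[OF that(1)]] that(2) U(2) by blast
    have Xf: "FD ?f u (ham G u) \<bullet> basis_enum k = br (xs ! k) G u" if "k < ?n" "u \<in> U" for k u G
      using FD_coord_map[OF len xd[OF _ that(2)] that(1)] br_ham[OF xd[OF that]] by simp
    have Fg: "FD (\<lambda>w. F (g w)) w (FD ?f (g w) v) = FD F (g w) v" if w: "w \<in> ?B" for w v
    proof -
      have gw: "g w \<in> U" using hh(2) w by blast
      show ?thesis
        using FD_compose[OF smooth_on_differentiable[OF g(1) w] smooth_on_differentiable[OF F gw], of "FD ?f (g w) v"]
          g(2)[OF gw, of v] hh(4)[OF w] by simp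
    qed
    have "F (g (?f y)) = F (g (?f x))"
    proof (rule constant_along_direction[where f = "\<lambda>w. F (g w)" and x = "?f x" and y = "?f y" and B = ?B
          and f' = "FD (\<lambda>w. F (g w))"])
      show "?f x \<in> ?B" "?f y \<in> ?B" using hh(1) x y by blast+
      fix w assume w: "w \<in> ?B"
      then have gw: "g w \<in> U" using hh(2) by blast
      have Fdiff: "F differentiable (at (g w))" using smooth_on_differentiable[OF F gw] .
      have d: "(\<lambda>w. F (g w)) differentiable (at w)"
        using differentiable_chain_at[OF smooth_on_differentiable[OF g(1) w] Fdiff] by (simp add: comp_def)
      then show "((\<lambda>w. F (g w)) has_derivative FD (\<lambda>w. F (g w)) w) (at w)" by (rule FD_works)
      have lin: "linear (FD (\<lambda>w. F (g w)) w)" using FD_works[OF d] has_derivative_linear by blast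
      define u where "u = ?f y - ?f x"
      have u: "u \<bullet> basis_enum k = (xs ! k) y - (xs ! k) x" if "k < ?n" for k
        unfolding u_def inner_diff_left using coord_map_inner[OF len that] by simp
      define d where "d k = (xs ! k) y - (xs ! k) x" for k
      let ?h = "\<lambda>k. FD ?f (g w) (ham (xs ! k) (g w))"
      note M = canonical_matrixD[OF B[OF gw]]
      have "u = (\<Sum>i<r. d (2 * i + 1) *\<^sub>R ?h (2 * i) - d (2 * i) *\<^sub>R ?h (2 * i + 1))" (is "u = ?u'")
      proof (rule euclidean_eqI_enum)
        fix k assume k: "k < ?n"
        have "d k = (\<Sum>i<r. d (2 * i + 1) * br (xs ! k) (xs ! (2 * i)) (g w) - d (2 * i) * br (xs ! k) (xs ! (2 * i + 1)) (g w))"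
          (is "_ = sum ?t _")
        proof -
          have "k < 2 * r + ?s" using k r by simp
          then show ?thesis
          proof (rule pqz_index_cases)
            fix l assume l: "l < r" "k = 2 * l"
            have "sum ?t {..<r} = (\<Sum>i<r. if i = l then d k else 0)"
              by (rule sum.cong[OF refl]) (use M(2,5) l in auto)
            then show ?thesis using l(1) by simp
          next
            fix l assume l: "l < r" "k = 2 * l + 1"
            have "sum ?t {..<r} = (\<Sum>i<r. if i = l then d k else 0)"
              by (rule sum.cong[OF refl]) (use M(3,4) l in auto)
            then show ?thesis using l(1) by simp
          next
            fix l assume l: "l < ?s" "k = 2 * r + l"
            then show ?thesis using M(6,7)[OF l(1)] zxy nth_z[OF l(1)] by (simp add: d_def)
          qed
        qed
        then show "u \<bullet> basis_enum k = ?u' \<bullet> basis_enum k"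
          using u[OF k] by (simp add: d_def inner_sum_left inner_diff_left Xf[OF k gw])
      qed
      moreover have "FD (\<lambda>w. F (g w)) w (?h l) = 0" if "l < 2 * r" for l
        using F0 gw that by (simp add: Fg[OF w] br_ham[OF Fdiff, symmetric])
      then have "FD (\<lambda>w. F (g w)) w ?u' = 0"
        by (simp add: linear_sum[OF lin] linear_diff[OF lin] linear_cmul[OF lin])
      ultimately show "FD (\<lambda>w. F (g w)) w (?f y - ?f x) = 0" by (simp add: u_def)
    qed simp
    then show ?thesis using hh(3) x y by simp
  qed
  show thesis
  proof (rule that[of U xs q z \<epsilon> g, OF U(1,3) _ r xs_def h g(1) _ _ B const])
    show "U \<subseteq> V" using UW cD(3) by blast
    show "smooth_on U (xs ! k)" "(xs ! k) m = 0" if "k < ?n" for k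
      using smooth_on_subset[OF xs_s[OF that] U(2)] xs_0[OF that] .
  qed
qed

end

section \<open>Hadamard's lemma\<close>

lemma segment_in_ball:
  fixes a :: "'e::real_normed_vector"
  assumes "x \<in> ball a \<epsilon>" "t \<in> {0..1::real}"
  shows "a + t *\<^sub>R (x - a) \<in> ball a \<epsilon>"
proof -
  have "norm (t *\<^sub>R (x - a)) \<le> norm (x - a)" using assms(2) by (simp add: mult_left_le_one_le)
  then show ?thesis using assms(1) by (simp add: dist_norm norm_minus_commute)
qed

lemma smooth_on_ray_integral:
  fixes G :: "'e::euclidean_space \<Rightarrow> real"
  assumes "smooth_on (ball a \<epsilon>) G"
  shows "smooth_on (ball a \<epsilon>) (\<lambda>x. integral {0..1} (\<lambda>t. t ^ j * G (a + t *\<^sub>R (x - a))))"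
proof -
  let ?B = "ball a \<epsilon>"
  have cont: "continuous_on (?B \<times> {0..1}) (\<lambda>(x, t). H (a + t *\<^sub>R (x - a)))"
    if "smooth_on ?B H" for H :: "'e \<Rightarrow> 'c::real_normed_vector"
    using segment_in_ball[of _ a \<epsilon>] unfolding case_prod_beta
    by (intro continuous_on_compose2[OF smooth_on_continuous[OF that]] continuous_intros) force
  have cont1: "continuous_on {0..1} (\<lambda>t. H (a + t *\<^sub>R (x - a)))"
    if "smooth_on ?B H" "x \<in> ?B" for x and H :: "'e \<Rightarrow> 'c::real_normed_vector"
    using segment_in_ball[OF that(2)]
    by (intro continuous_on_compose2[OF smooth_on_continuous[OF that(1)]] continuous_intros) force
  have D: "((\<lambda>x. integral {0..1} (\<lambda>t. t ^ j * G (a + t *\<^sub>R (x - a)))) has_derivative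
      (\<lambda>v. integral {0..1} (\<lambda>t. t ^ Suc j * FD G (a + t *\<^sub>R (x - a)) v))) (at x)"
    if G: "smooth_on ?B G" and x: "x \<in> ?B" for G :: "'e \<Rightarrow> real" and j x
  proof -
    define fx where "fx x t = t ^ Suc j *\<^sub>R Blinfun (FD G (a + t *\<^sub>R (x - a)))" for x t
    have fx: "blinfun_apply (fx x t) = (\<lambda>v. t ^ Suc j * FD G (a + t *\<^sub>R (x - a)) v)" if "x \<in> ?B" "t \<in> {0..1}" for x t
      using bounded_linear_Blinfun_apply[OF smooth_on_bounded_linear_FD[OF G segment_in_ball[OF that]]]
      by (simp add: fx_def fun_eq_iff blinfun.bilinear_simps)
    have sB: "smooth_on ?B (\<lambda>y. Blinfun (FD G y))" by (intro smooth_on_Blinfun_FD G open_ball)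
    have "((\<lambda>x. integral (cbox 0 1) (\<lambda>t. t ^ j * G (a + t *\<^sub>R (x - a)))) has_derivative integral (cbox 0 1) (fx x)) (at x within ?B)"
    proof (rule leibniz_rule[OF _ _ _ x convex_ball])
      fix x and t :: real assume xt: "x \<in> ?B" "t \<in> cbox 0 1"
      have y: "a + t *\<^sub>R (x - a) \<in> ?B" using segment_in_ball[OF xt(1)] xt(2) by simp
      have lin: "linear (FD G (a + t *\<^sub>R (x - a)))"
        using smooth_on_bounded_linear_FD[OF G y] bounded_linear.linear by blast
      have "((\<lambda>x. G (a + t *\<^sub>R (x - a))) has_derivative (\<lambda>v. FD G (a + t *\<^sub>R (x - a)) (t *\<^sub>R v))) (at x within ?B)"
        by (rule has_derivative_compose[of "\<lambda>x. a + t *\<^sub>R (x - a)" "\<lambda>v. t *\<^sub>R v" x ?B G])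
          (use smooth_on_has_derivative[OF G y] in \<open>auto intro!: derivative_eq_intros\<close>)
      then have "((\<lambda>x. t ^ j * G (a + t *\<^sub>R (x - a))) has_derivative (\<lambda>v. t ^ j * FD G (a + t *\<^sub>R (x - a)) (t *\<^sub>R v))) (at x within ?B)"
        by (rule has_derivative_mult_right)
      then show "((\<lambda>x. t ^ j * G (a + t *\<^sub>R (x - a))) has_derivative blinfun_apply (fx x t)) (at x within ?B)"
        using xt by (simp add: fx linear_cmul[OF lin] mult_ac)
    next
      show "(\<lambda>t. t ^ j * G (a + t *\<^sub>R (x - a))) integrable_on cbox 0 1" if "x \<in> ?B" for x
        unfolding box_real using cont1[OF G that]
        by (intro integrable_continuous_real continuous_intros) auto
      show "continuous_on (?B \<times> cbox 0 1) (\<lambda>(x, t). fx x t)"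
        using cont[OF sB] unfolding fx_def case_prod_beta box_real by (intro continuous_intros) auto
    qed
    moreover have "at x within ?B = at x" by (rule at_within_open[OF x open_ball])
    moreover have "blinfun_apply (integral (cbox 0 1) (fx x)) v = integral {0..1} (\<lambda>t. t ^ Suc j * FD G (a + t *\<^sub>R (x - a)) v)" for v
    proof -
      have "fx x integrable_on {0..1}"
        unfolding fx_def using cont1[OF sB x] by (intro integrable_continuous_real continuous_intros) auto
      from integral_linear[OF this blinfun.bounded_linear_left, of v]
      have "blinfun_apply (integral {0..1} (fx x)) v = integral {0..1} (\<lambda>t. blinfun_apply (fx x t) v)"
        by (simp add: comp_def)
      also have "\<dots> = integral {0..1} (\<lambda>t. t ^ Suc j * FD G (a + t *\<^sub>R (x - a)) v)"
        by (rule integral_cong) (simp add: fx[OF x])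
      finally show ?thesis by simp
    qed
    then have "blinfun_apply (integral (cbox 0 1) (fx x)) = (\<lambda>v. integral {0..1} (\<lambda>t. t ^ Suc j * FD G (a + t *\<^sub>R (x - a)) v))"
      by (rule ext)
    ultimately show ?thesis unfolding box_real by simp
  qed
  have "Ck_on k ?B (\<lambda>x. integral {0..1} (\<lambda>t. t ^ j * G (a + t *\<^sub>R (x - a))))"
    if "smooth_on ?B G" for k j and G :: "'e \<Rightarrow> real"
    using that
  proof (induction k arbitrary: j G)
    case 0
    then show ?case by (auto intro!: continuous_at_imp_continuous_on has_derivative_continuous[OF D])
  next
    case (Suc k)
    show ?case
    proof (rule Ck_on_SucI[OF open_ball D[OF Suc.prems]])
      show "Ck_on k ?B (\<lambda>x. integral {0..1} (\<lambda>t. t ^ Suc j * FD G (a + t *\<^sub>R (x - a)) v))" for v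
        by (rule Suc.IH[OF smooth_on_FD[OF Suc.prems]])
    qed
  qed
  then show ?thesis using assms by (simp add: smooth_on_def)
qed

lemma hadamard:
  fixes F :: "'e::euclidean_space \<Rightarrow> real"
  assumes F: "smooth_on (ball a \<epsilon>) F" and "\<epsilon> > 0"
  obtains h :: "'e \<Rightarrow> 'e \<Rightarrow> real" where "\<And>b. smooth_on (ball a \<epsilon>) (h b)" "\<And>b. h b a = FD F a b"
    "\<And>y. y \<in> ball a \<epsilon> \<Longrightarrow> F y = F a + (\<Sum>b\<in>Basis. ((y - a) \<bullet> b) * h b y)"
proof -
  define h where "h b y = integral {0..1} (\<lambda>t. FD F (a + t *\<^sub>R (y - a)) b)" for b y
  have "smooth_on (ball a \<epsilon>) (h b)" for b
    using smooth_on_ray_integral[OF smooth_on_FD[OF F, of b], where j = 0] by (simp add: h_def[abs_def])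
  moreover have "h b a = FD F a b" for b by (simp add: h_def)
  moreover have "F y = F a + (\<Sum>b\<in>Basis. ((y - a) \<bullet> b) * h b y)" if y: "y \<in> ball a \<epsilon>" for y
  proof -
    have int: "((\<lambda>t. FD F (a + t *\<^sub>R (y - a)) b) has_integral h b y) {0..1}" for b
      unfolding h_def
    proof (intro integrable_integral integrable_continuous_real)
      show "continuous_on {0..1} (\<lambda>t. FD F (a + t *\<^sub>R (y - a)) b)"
        using segment_in_ball[OF y]
        by (intro continuous_on_compose2[OF smooth_on_continuous[OF smooth_on_FD[OF F]]] continuous_intros) force
    qed
    have int1: "((\<lambda>t. FD F (a + t *\<^sub>R (y - a)) (y - a)) has_integral (F (a + 1 *\<^sub>R (y - a)) - F (a + 0 *\<^sub>R (y - a)))) {0..1}"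
    proof (rule fundamental_theorem_of_calculus)
      fix t :: real assume t: "t \<in> {0..1}"
      have z: "a + t *\<^sub>R (y - a) \<in> ball a \<epsilon>" using segment_in_ball[OF y t] .
      have "((\<lambda>t. F (a + t *\<^sub>R (y - a))) has_derivative (\<lambda>s. FD F (a + t *\<^sub>R (y - a)) (s *\<^sub>R (y - a)))) (at t within {0..1})"
        by (rule has_derivative_compose[of "\<lambda>t. a + t *\<^sub>R (y - a)" "\<lambda>s. s *\<^sub>R (y - a)" t "{0..1}" F])
          (use smooth_on_has_derivative[OF F z] in \<open>auto intro!: derivative_eq_intros\<close>)
      moreover have "linear (FD F (a + t *\<^sub>R (y - a)))"
        using smooth_on_bounded_linear_FD[OF F z] bounded_linear.linear by blast
      ultimately show "((\<lambda>t. F (a + t *\<^sub>R (y - a))) has_vector_derivative FD F (a + t *\<^sub>R (y - a)) (y - a)) (at t within {0..1})"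
        by (simp add: has_vector_derivative_def linear_cmul)
    qed simp
    have int2: "FD F (a + t *\<^sub>R (y - a)) (y - a) = (\<Sum>b\<in>Basis. ((y - a) \<bullet> b) * FD F (a + t *\<^sub>R (y - a)) b)"
      if "t \<in> {0..1}" for t
      using bounded_linear_basis_sum[OF smooth_on_bounded_linear_FD[OF F segment_in_ball[OF y that]], of "y - a"] by simp
    have int3: "((\<lambda>t. \<Sum>b\<in>Basis. ((y - a) \<bullet> b) * FD F (a + t *\<^sub>R (y - a)) b) has_integral (F y - F a)) {0..1}"
      using has_integral_eq[OF int2 int1] by simp
    have int4: "((\<lambda>t. \<Sum>b\<in>Basis. ((y - a) \<bullet> b) * FD F (a + t *\<^sub>R (y - a)) b) has_integral (\<Sum>b\<in>Basis. ((y - a) \<bullet> b) * h b y)) {0..1}"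
      by (intro has_integral_sum has_integral_mult_right int) simp
    show ?thesis using has_integral_unique[OF int3 int4] by simp
  qed
  ultimately show thesis using that by blast
qed

section \<open>Charts\<close>

locale smooth_mfd =
  fixes A :: "('a::{t2_space, second_countable_topology}, 'e::euclidean_space) chart set"
  assumes mfd: "smooth_manifold A"
begin

lemma chart_covers: obtains U \<phi> where "(U, \<phi>) \<in> A" "x \<in> U"
  using mfd unfolding smooth_manifold_def by (metis UN_E UNIV_I fst_eqD surj_pair)

lemma atlas_maximal: "c \<in> A \<Longrightarrow> c \<in> maximal_atlas A"
  using mfd unfolding smooth_manifold_def maximal_atlas_def by blast

lemma maximal_is_chart: "c \<in> maximal_atlas A \<Longrightarrow> is_chart c"
  unfolding maximal_atlas_def by blast

lemma chart_facts:
  assumes "is_chart ((U, \<phi>) :: ('a, 'e) chart)"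
  shows "open U" "open (\<phi> ` U)" "inj_on \<phi> U" "continuous_on U \<phi>" "continuous_on (\<phi> ` U) (inv_into U \<phi>)"
    "x \<in> U \<Longrightarrow> inv_into U \<phi> (\<phi> x) = x" "y \<in> \<phi> ` U \<Longrightarrow> \<phi> (inv_into U \<phi> y) = y"
    "y \<in> \<phi> ` U \<Longrightarrow> inv_into U \<phi> y \<in> U"
    "open W \<Longrightarrow> open (\<phi> ` (U \<inter> W))" "open S \<Longrightarrow> open (U \<inter> \<phi> -` S)"
proof -
  obtain \<psi> where h: "open U" "open (\<phi> ` U)" "homeomorphism U (\<phi> ` U) \<phi> \<psi>"
    using assms by (auto simp: is_chart_def)
  then show "open U" "open (\<phi> ` U)" by blast+
  show inj: "inj_on \<phi> U" using h(3) by (metis homeomorphism_def inj_on_inverseI)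
  show c: "continuous_on U \<phi>" using h(3) by (simp add: homeomorphism_def)
  have eq: "inv_into U \<phi> y = \<psi> y" if "y \<in> \<phi> ` U" for y
    using that h(3) inj by (auto simp: homeomorphism_def)
  have c\<psi>: "continuous_on (\<phi> ` U) \<psi>" using h(3) by (simp add: homeomorphism_def)
  then show "continuous_on (\<phi> ` U) (inv_into U \<phi>)" using eq continuous_on_cong by metis
  show "x \<in> U \<Longrightarrow> inv_into U \<phi> (\<phi> x) = x" using inj by simp
  show "y \<in> \<phi> ` U \<Longrightarrow> \<phi> (inv_into U \<phi> y) = y" by (rule f_inv_into_f)
  show "y \<in> \<phi> ` U \<Longrightarrow> inv_into U \<phi> y \<in> U" by (rule inv_into_into)
  show "open (\<phi> ` (U \<inter> W))" if "open W"
  proof -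
    have "\<phi> ` (U \<inter> W) = \<phi> ` U \<inter> \<psi> -` W" using h(3) by (auto simp: homeomorphism_def)
    then show ?thesis using continuous_open_preimage[OF c\<psi> h(2) that] by simp
  qed
  show "open S \<Longrightarrow> open (U \<inter> \<phi> -` S)" using continuous_open_preimage[OF c h(1)] .
qed

lemma maximal_transition:
  assumes "(U, \<phi>) \<in> maximal_atlas A" "(U', \<phi>') \<in> A"
  shows "smooth_on (\<phi> ` (U \<inter> U')) (\<lambda>y. \<phi>' (inv_into U \<phi> y))" "smooth_on (\<phi>' ` (U' \<inter> U)) (\<lambda>y. \<phi> (inv_into U' \<phi>' y))"
  using assms unfolding maximal_atlas_def smooth_transition_def by (auto simp: comp_def)

lemma smooth_fun_subset: "smooth_fun A W f \<Longrightarrow> W' \<subseteq> W \<Longrightarrow> smooth_fun A W' f"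
  unfolding smooth_fun_def by (fast intro: smooth_on_subset)

lemma smooth_fun_iff_chart:
  assumes c: "(U, \<phi>) \<in> maximal_atlas A" and W: "open W" "W \<subseteq> U"
  shows "smooth_fun A W f \<longleftrightarrow> smooth_on (\<phi> ` W) (\<lambda>y. f (inv_into U \<phi> y))"
proof
  note F = chart_facts[OF maximal_is_chart[OF c]]
  have W_eq: "U \<inter> W = W" using W by blast
  have oW: "open (\<phi> ` W)" using F(9)[OF W(1)] W_eq by simp
  {
    assume f: "smooth_fun A W f"
    show "smooth_on (\<phi> ` W) (\<lambda>y. f (inv_into U \<phi> y))"
    proof (rule smooth_on_local[OF oW])
      fix y assume "y \<in> \<phi> ` W"
      then obtain x where x: "x \<in> W" "y = \<phi> x" by blast
      obtain U' \<phi>' where d: "(U', \<phi>') \<in> A" "x \<in> U'" by (rule chart_covers)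
      note F' = chart_facts[OF maximal_is_chart[OF atlas_maximal[OF d(1)]]]
      let ?T = "\<phi> ` (U \<inter> (W \<inter> U'))"
      have oT: "open ?T" using F(9)[of "W \<inter> U'"] W F'(1) by blast
      have "smooth_on ?T (\<lambda>y. f (inv_into U' \<phi>' (\<phi>' (inv_into U \<phi> y))))"
      proof (rule smooth_on_compose[OF oT F'(9)[OF W(1)]])
        show "(\<lambda>y. \<phi>' (inv_into U \<phi> y)) ` ?T \<subseteq> \<phi>' ` (U' \<inter> W)" using F(6) by auto
        show "smooth_on ?T (\<lambda>y. \<phi>' (inv_into U \<phi> y))"
          using maximal_transition(1)[OF c d(1)] by (rule smooth_on_subset) blast
        show "smooth_on (\<phi>' ` (U' \<inter> W)) (\<lambda>y. f (inv_into U' \<phi>' y))"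
          using f d(1) unfolding smooth_fun_def by (auto simp: comp_def)
      qed
      then have "smooth_on ?T (\<lambda>y. f (inv_into U \<phi> y))"
        by (rule smooth_on_cong[OF oT, rotated]) (use F(6) F'(6) in auto)
      then show "\<exists>T. open T \<and> y \<in> T \<and> smooth_on T (\<lambda>y. f (inv_into U \<phi> y))"
        using oT x d(2) W(2) by blast
    qed
  }
  assume f: "smooth_on (\<phi> ` W) (\<lambda>y. f (inv_into U \<phi> y))"
  show "smooth_fun A W f"
    unfolding smooth_fun_def
  proof safe
    fix U' \<phi>' assume d: "(U', \<phi>') \<in> A"
    note F' = chart_facts[OF maximal_is_chart[OF atlas_maximal[OF d]]]
    let ?T = "\<phi>' ` (U' \<inter> W)"
    have oT: "open ?T" using F'(9)[OF W(1)] .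
    have "smooth_on ?T (\<lambda>y. f (inv_into U \<phi> (\<phi> (inv_into U' \<phi>' y))))"
    proof (rule smooth_on_compose[OF oT oW _ _ f])
      show "(\<lambda>y. \<phi> (inv_into U' \<phi>' y)) ` ?T \<subseteq> \<phi> ` W" using F'(6) by auto
      show "smooth_on ?T (\<lambda>y. \<phi> (inv_into U' \<phi>' y))"
        using maximal_transition(2)[OF c d] by (rule smooth_on_subset) (use W(2) in blast)
    qed
    then have "smooth_on ?T (\<lambda>y. f (inv_into U' \<phi>' y))"
      by (rule smooth_on_cong[OF oT, rotated]) (use F(6) F'(6) W(2) in auto)
    then show "smooth_on ?T (f \<circ> inv_into U' \<phi>')" by (simp add: comp_def)
  qed
qed

lemma smooth_fun_local:
  assumes "open W" "\<And>x. x \<in> W \<Longrightarrow> \<exists>N. open N \<and> x \<in> N \<and> smooth_fun A N f"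
  shows "smooth_fun A W f"
  unfolding smooth_fun_def
proof safe
  fix U \<phi> assume d: "(U, \<phi>) \<in> A"
  note F = chart_facts[OF maximal_is_chart[OF atlas_maximal[OF d]]]
  show "smooth_on (\<phi> ` (U \<inter> W)) (f \<circ> inv_into U \<phi>)"
  proof (rule smooth_on_local[OF F(9)[OF assms(1)]])
    fix y assume "y \<in> \<phi> ` (U \<inter> W)"
    then obtain x where x: "x \<in> U" "x \<in> W" "y = \<phi> x" by blast
    then obtain N where N: "open N" "x \<in> N" "smooth_fun A N f" using assms(2) by blast
    then have "smooth_on (\<phi> ` (U \<inter> N)) (f \<circ> inv_into U \<phi>)" using d by (auto simp: smooth_fun_def)
    then show "\<exists>T. open T \<and> y \<in> T \<and> smooth_on T (f \<circ> inv_into U \<phi>)" using F(9)[OF N(1)] x N(2) by blast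
  qed
qed

lemma smooth_fun_cong:
  assumes "open W" "smooth_fun A W f" "\<And>x. x \<in> W \<Longrightarrow> f x = g x"
  shows "smooth_fun A W g"
  unfolding smooth_fun_def
proof safe
  fix U \<phi> assume d: "(U, \<phi>) \<in> A"
  note F = chart_facts[OF maximal_is_chart[OF atlas_maximal[OF d]]]
  have "smooth_on (\<phi> ` (U \<inter> W)) (f \<circ> inv_into U \<phi>)" using assms(2) d by (auto simp: smooth_fun_def)
  then show "smooth_on (\<phi> ` (U \<inter> W)) (g \<circ> inv_into U \<phi>)"
    by (rule smooth_on_cong[OF F(9)[OF assms(1)], rotated]) (use F(6) assms(3) in auto)
qed

lemma smooth_fun_cmult:
  assumes "open W" "smooth_fun A W f"
  shows "smooth_fun A W (\<lambda>x. c * f x)"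
  unfolding smooth_fun_def
proof safe
  fix U \<phi> assume d: "(U, \<phi>) \<in> A"
  note F = chart_facts[OF maximal_is_chart[OF atlas_maximal[OF d]]]
  have "smooth_on (\<phi> ` (U \<inter> W)) (f \<circ> inv_into U \<phi>)" using assms(2) d by (auto simp: smooth_fun_def)
  then show "smooth_on (\<phi> ` (U \<inter> W)) ((\<lambda>x. c * f x) \<circ> inv_into U \<phi>)"
    using smooth_on_mult[OF F(9)[OF assms(1)] smooth_on_const] by (simp add: comp_def)
qed

lemma smooth_near_chart:
  assumes c: "(U, \<phi>) \<in> maximal_atlas A" and x: "x \<in> U" and f: "f \<in> smooth_near A x"
  obtains W where "open W" "x \<in> W" "W \<subseteq> U" "smooth_fun A W f" "smooth_on (\<phi> ` W) (\<lambda>y. f (inv_into U \<phi> y))" "open (\<phi> ` W)"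
proof -
  note F = chart_facts[OF maximal_is_chart[OF c]]
  obtain V where V: "open V" "x \<in> V" "smooth_fun A V f" using f by (auto simp: smooth_near_def)
  have W: "open (U \<inter> V)" "U \<inter> V \<subseteq> U" using V F(1) by auto
  have s: "smooth_fun A (U \<inter> V) f" using smooth_fun_subset[OF V(3)] by blast
  show thesis
    by (rule that[of "U \<inter> V"])
      (use W V x s smooth_fun_iff_chart[OF c W] F(9)[OF V(1)] in auto)
qed

lemma smooth_nearI: "open W \<Longrightarrow> x \<in> W \<Longrightarrow> smooth_fun A W f \<Longrightarrow> f \<in> smooth_near A x"
  by (auto simp: smooth_near_def)

lemma smooth_fun_inner_chart:
  assumes c: "(U, \<phi>) \<in> maximal_atlas A"
  shows "smooth_fun A U (\<lambda>y. \<phi> y \<bullet> b)"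
proof -
  note F = chart_facts[OF maximal_is_chart[OF c]]
  have "smooth_on (\<phi> ` U) (\<lambda>y. y \<bullet> b)" using F(2) by (intro smooth_on_inner) auto
  then have "smooth_on (\<phi> ` U) (\<lambda>y. \<phi> (inv_into U \<phi> y) \<bullet> b)"
    by (rule smooth_on_cong[OF F(2), rotated]) (simp add: F(7))
  then show ?thesis using smooth_fun_iff_chart[OF c F(1)] by simp
qed

lemma smooth_near_ops:
  assumes "f \<in> smooth_near A x" "g \<in> smooth_near A x"
  shows "f + g \<in> smooth_near A x" "f * g \<in> smooth_near A x" "fscale a f \<in> smooth_near A x"
proof -
  obtain U \<phi> where d: "(U, \<phi>) \<in> A" "x \<in> U" by (rule chart_covers)
  note c = atlas_maximal[OF d(1)]
  note F = chart_facts[OF maximal_is_chart[OF c]]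
  obtain V1 V2 where V: "open V1" "x \<in> V1" "smooth_fun A V1 f" "open V2" "x \<in> V2" "smooth_fun A V2 g"
    using assms by (auto simp: smooth_near_def)
  define W where "W = U \<inter> (V1 \<inter> V2)"
  have W: "open W" "x \<in> W" "W \<subseteq> U" using V d F(1) by (auto simp: W_def)
  have oW: "open (\<phi> ` W)" using F(9)[of "V1 \<inter> V2"] V by (auto simp: W_def)
  have s: "smooth_on (\<phi> ` W) (\<lambda>y. f (inv_into U \<phi> y))" "smooth_on (\<phi> ` W) (\<lambda>y. g (inv_into U \<phi> y))"
    using smooth_fun_iff_chart[OF c W(1,3)] smooth_fun_subset[OF V(3), of W] smooth_fun_subset[OF V(6), of W]
    by (auto simp: W_def)
  have "smooth_on (\<phi> ` W) (\<lambda>y. (f + g) (inv_into U \<phi> y))" "smooth_on (\<phi> ` W) (\<lambda>y. (f * g) (inv_into U \<phi> y))"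
    "smooth_on (\<phi> ` W) (\<lambda>y. (fscale a f) (inv_into U \<phi> y))"
    unfolding plus_fun_apply times_fun_apply fscale_def by (intro smooth_intros oW s smooth_on_const)+
  then show "f + g \<in> smooth_near A x" "f * g \<in> smooth_near A x" "fscale a f \<in> smooth_near A x"
    using smooth_fun_iff_chart[OF c W(1,3)] smooth_nearI[OF W(1,2)] by blast+
qed

lemma smooth_near_cong:
  assumes "f \<in> smooth_near A x" "open N" "x \<in> N" "\<And>y. y \<in> N \<Longrightarrow> f y = g y"
  shows "g \<in> smooth_near A x"
proof -
  obtain V where V: "open V" "x \<in> V" "smooth_fun A V f" using assms(1) by (auto simp: smooth_near_def)
  have "smooth_fun A (V \<inter> N) g"
    by (rule smooth_fun_cong[of _ f]) (use V assms smooth_fun_subset in auto)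
  then show ?thesis using V assms(2,3) by (intro smooth_nearI[of "V \<inter> N"]) auto
qed

lemma smooth_near_const: "(\<lambda>y. a) \<in> smooth_near A x"
  by (rule smooth_nearI[of UNIV]) (auto simp: smooth_fun_def comp_def)

lemma smooth_near_sum:
  "finite I \<Longrightarrow> (\<And>i. i \<in> I \<Longrightarrow> f i \<in> smooth_near A x) \<Longrightarrow> (\<Sum>i\<in>I. f i) \<in> smooth_near A x"
proof (induction I rule: finite_induct)
  case empty
  then show ?case using smooth_near_const[of 0 x] by (simp add: zero_fun_def)
next
  case (insert i I)
  show ?case unfolding sum.insert[OF insert(1,2)]
    by (rule smooth_near_ops(1)) (use insert in auto)
qed

end

section \<open>Tangent vectors, covectors and bivectors in charts\<close>

lemma sum_fun_apply: "(\<Sum>i\<in>I. f i) x = (\<Sum>i\<in>I. f i x)"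
  for f :: "'i \<Rightarrow> 'b \<Rightarrow> real"
  by (induction I rule: infinite_finite_induct) auto

context smooth_mfd
begin

lemma tangentD:
  assumes "v \<in> tangent_space A x"
  shows "f \<in> smooth_near A x \<Longrightarrow> g \<in> smooth_near A x \<Longrightarrow> v (f + g) = v f + v g"
    "f \<in> smooth_near A x \<Longrightarrow> v (fscale c f) = c * v f"
    "f \<in> smooth_near A x \<Longrightarrow> g \<in> smooth_near A x \<Longrightarrow> v (f * g) = f x * v g + g x * v f"
    "f \<notin> smooth_near A x \<Longrightarrow> v f = 0"
  using assms unfolding tangent_space_def by blast+

lemma tangent_const:
  assumes "v \<in> tangent_space A x"
  shows "v (\<lambda>y. a) = 0"
proof -
  have "v ((\<lambda>y. 1) * (\<lambda>y. 1)) = 1 * v (\<lambda>y. 1) + 1 * v (\<lambda>y. 1)"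
    by (rule tangentD(3)[OF assms smooth_near_const smooth_near_const])
  moreover have "(\<lambda>y. 1) * (\<lambda>y. 1) = (\<lambda>y::'a. 1::real)" by (simp add: fun_eq_iff)
  ultimately have "v (\<lambda>y. 1) = 0" by simp
  moreover have "fscale a (\<lambda>y. 1) = (\<lambda>y::'a. a)" by (simp add: fscale_def)
  ultimately show ?thesis using tangentD(2)[OF assms smooth_near_const[of 1], of a] by simp
qed

lemma tangent_local:
  assumes v: "v \<in> tangent_space A x" and fg: "f \<in> smooth_near A x" "g \<in> smooth_near A x"
    and N: "open N" "x \<in> N" "\<And>y. y \<in> N \<Longrightarrow> f y = g y"
  shows "v f = v g"
proof -
  define \<iota> :: "'a \<Rightarrow> real" where "\<iota> y = (if y \<in> N then 1 else 0)" for y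
  have \<iota>: "\<iota> \<in> smooth_near A x"
    by (rule smooth_near_cong[OF smooth_near_const[of 1] N(1,2)]) (simp add: \<iota>_def)
  have "\<iota> * \<iota> = \<iota>" by (simp add: fun_eq_iff \<iota>_def)
  moreover have \<iota>x: "\<iota> x = 1" using N by (simp add: \<iota>_def)
  ultimately have v\<iota>: "v \<iota> = 0" using tangentD(3)[OF v \<iota> \<iota>] by simp
  have "f * \<iota> = g * \<iota>" using N(3) by (auto simp: fun_eq_iff \<iota>_def)
  then show ?thesis using tangentD(3)[OF v fg(1) \<iota>] tangentD(3)[OF v fg(2) \<iota>] v\<iota> \<iota>x by simp
qed

lemma tangent_sum:
  assumes v: "v \<in> tangent_space A x" and "finite I" "\<And>i. i \<in> I \<Longrightarrow> f i \<in> smooth_near A x"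
  shows "v (\<Sum>i\<in>I. f i) = (\<Sum>i\<in>I. v (f i))"
  using assms(2,3)
proof (induction I rule: finite_induct)
  case empty
  then show ?case using tangent_const[OF v, of 0] by (simp add: zero_fun_def)
next
  case (insert i I)
  have "v (f i + sum f I) = v (f i) + v (sum f I)"
    using insert by (intro tangentD(1)[OF v] smooth_near_sum) auto
  moreover have "v (sum f I) = (\<Sum>i\<in>I. v (f i))" using insert by simp
  ultimately show ?case unfolding sum.insert[OF insert(1,2)] by metis
qed

lemma inner_chart_near: "(U, \<phi>) \<in> maximal_atlas A \<Longrightarrow> x \<in> U \<Longrightarrow> (\<lambda>y. \<phi> y \<bullet> b) \<in> smooth_near A x"
  using smooth_nearI[OF chart_facts(1)[OF maximal_is_chart] _ smooth_fun_inner_chart] by blast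

lemma tangent_expand:
  assumes c: "(U, \<phi>) \<in> maximal_atlas A" and x: "x \<in> U" and v: "v \<in> tangent_space A x"
    and f: "f \<in> smooth_near A x"
  shows "v f = (\<Sum>b\<in>Basis. FD (\<lambda>y. f (inv_into U \<phi> y)) (\<phi> x) b * v (\<lambda>y. \<phi> y \<bullet> b))"
proof -
  note F = chart_facts[OF maximal_is_chart[OF c]]
  let ?F = "\<lambda>y. f (inv_into U \<phi> y)"
  obtain W where W: "open W" "x \<in> W" "W \<subseteq> U" "smooth_on (\<phi> ` W) ?F" "open (\<phi> ` W)"
    by (rule smooth_near_chart[OF c x f])
  obtain \<epsilon> where \<epsilon>: "\<epsilon> > 0" "ball (\<phi> x) \<epsilon> \<subseteq> \<phi> ` W" using W(2,5) open_contains_ball by blast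
  obtain h where h: "\<And>b. smooth_on (ball (\<phi> x) \<epsilon>) (h b)" "\<And>b. h b (\<phi> x) = FD ?F (\<phi> x) b"
    "\<And>y. y \<in> ball (\<phi> x) \<epsilon> \<Longrightarrow> ?F y = ?F (\<phi> x) + (\<Sum>b\<in>Basis. ((y - \<phi> x) \<bullet> b) * h b y)"
    using hadamard[OF smooth_on_subset[OF W(4) \<epsilon>(2)] \<epsilon>(1)] by blast
  define N where "N = U \<inter> \<phi> -` ball (\<phi> x) \<epsilon>"
  have N: "open N" "N \<subseteq> U" "x \<in> N" using F(10)[of "ball (\<phi> x) \<epsilon>"] x \<epsilon>(1) by (auto simp: N_def)
  have \<phi>N: "\<phi> ` N = ball (\<phi> x) \<epsilon>"
  proof
    show "ball (\<phi> x) \<epsilon> \<subseteq> \<phi> ` N"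
    proof
      fix y assume y: "y \<in> ball (\<phi> x) \<epsilon>"
      then obtain w where "w \<in> W" "y = \<phi> w" using \<epsilon>(2) by blast
      then show "y \<in> \<phi> ` N" using W(3) y by (auto simp: N_def)
    qed
  qed (auto simp: N_def)
  define G where "G b y = h b (\<phi> y)" for b y
  have G: "G b \<in> smooth_near A x" for b
  proof (rule smooth_nearI[OF N(1,3)])
    have "smooth_on (\<phi> ` N) (\<lambda>y. G b (inv_into U \<phi> y))"
      unfolding \<phi>N
    proof (rule smooth_on_cong[OF open_ball _ h(1)[of b]])
      show "h b y = G b (inv_into U \<phi> y)" if "y \<in> ball (\<phi> x) \<epsilon>" for y
        using that F(7)[of y] N(2) unfolding \<phi>N[symmetric] by (auto simp: G_def)
    qed
    then show "smooth_fun A N (G b)" using smooth_fun_iff_chart[OF c N(1,2)] by simp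
  qed
  define X where "X b = (\<lambda>y. \<phi> y \<bullet> b) + (\<lambda>y. - (\<phi> x \<bullet> b))" for b
  have X: "X b \<in> smooth_near A x" for b
    unfolding X_def by (intro smooth_near_ops(1) inner_chart_near[OF c x] smooth_near_const)
  have vX: "v (X b) = v (\<lambda>y. \<phi> y \<bullet> b)" for b
    unfolding X_def by (simp only: tangentD(1)[OF v inner_chart_near[OF c x] smooth_near_const] tangent_const[OF v] add_0_right)
  define R where "R = (\<lambda>y. f x) + (\<Sum>b\<in>Basis. X b * G b)"
  have XG: "X b * G b \<in> smooth_near A x" for b by (intro smooth_near_ops(2) X G)
  have SXG: "(\<Sum>b\<in>Basis. X b * G b) \<in> smooth_near A x" by (intro smooth_near_sum XG) simp
  have R: "R \<in> smooth_near A x" unfolding R_def by (intro smooth_near_ops(1) smooth_near_const SXG)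
  have "v f = v R"
  proof (rule tangent_local[OF v f R N(1,3)])
    fix y assume y: "y \<in> N"
    then have "\<phi> y \<in> ball (\<phi> x) \<epsilon>" "y \<in> U" by (auto simp: N_def)
    from h(3)[OF this(1)] show "f y = R y"
      using F(6)[OF \<open>y \<in> U\<close>] F(6)[OF x] by (simp add: R_def sum_fun_apply X_def G_def inner_diff_left)
  qed
  also have "\<dots> = v (\<lambda>y. f x) + v (\<Sum>b\<in>Basis. X b * G b)"
    unfolding R_def by (rule tangentD(1)[OF v smooth_near_const SXG])
  also have "\<dots> = (\<Sum>b\<in>Basis. v (X b * G b))"
    using tangent_const[OF v] tangent_sum[OF v finite_Basis XG] by simp
  also have "\<dots> = (\<Sum>b\<in>Basis. FD ?F (\<phi> x) b * v (\<lambda>y. \<phi> y \<bullet> b))"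
  proof (rule sum.cong[OF refl])
    fix b :: 'e
    have "v (X b * G b) = X b x * v (G b) + G b x * v (X b)" by (rule tangentD(3)[OF v X G])
    then show "v (X b * G b) = FD ?F (\<phi> x) b * v (\<lambda>y. \<phi> y \<bullet> b)"
      unfolding vX by (simp add: X_def G_def h(2))
  qed
  finally show ?thesis .
qed

lemma coordinate_inner:
  assumes "coordinate_system A U xs" "k < DIM('e)"
  shows "(\<lambda>y. (coord_map xs y :: 'e) \<bullet> basis_enum k) = xs ! k"
  by (intro ext coord_map_inner) (use assms in \<open>simp_all add: coordinate_system_def\<close>)

lemma coordinate_smooth:
  assumes "coordinate_system A U xs" "k < DIM('e)"
  shows "smooth_fun A U (xs ! k)"
  using smooth_fun_inner_chart[of U "coord_map xs" "basis_enum k"] coordinate_inner[OF assms] assms(1)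
  by (simp add: coordinate_system_def)

definition dir_vec :: "'a set \<Rightarrow> ('a \<Rightarrow> 'e) \<Rightarrow> 'a \<Rightarrow> 'e \<Rightarrow> 'a tvec" where
  "dir_vec U \<phi> x w = (\<lambda>f. if f \<in> smooth_near A x then FD (\<lambda>y. f (inv_into U \<phi> y)) (\<phi> x) w else 0)"

lemma coord_vf_eq: "coord_vf A U xs k x = dir_vec U (coord_map xs) x (basis_enum k)"
  unfolding coord_vf_def dir_vec_def comp_def ..

lemma near_differentiable:
  assumes c: "(U, \<phi>) \<in> maximal_atlas A" and x: "x \<in> U" and f: "f \<in> smooth_near A x"
  shows "(\<lambda>y. f (inv_into U \<phi> y)) differentiable (at (\<phi> x))"
  by (rule smooth_near_chart[OF c x f]) (auto intro: smooth_on_differentiable)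

lemma dir_vec_tangent:
  assumes c: "(U, \<phi>) \<in> maximal_atlas A" and x: "x \<in> U"
  shows "dir_vec U \<phi> x w \<in> tangent_space A x"
proof -
  note d = FD_works[OF near_differentiable[OF c x]]
  have \<psi>: "inv_into U \<phi> (\<phi> x) = x" using chart_facts(6)[OF maximal_is_chart[OF c] x] .
  have "FD (\<lambda>y. (f + g) (inv_into U \<phi> y)) (\<phi> x) w = FD (\<lambda>y. f (inv_into U \<phi> y)) (\<phi> x) w + FD (\<lambda>y. g (inv_into U \<phi> y)) (\<phi> x) w"
    "FD (\<lambda>y. (f * g) (inv_into U \<phi> y)) (\<phi> x) w = f x * FD (\<lambda>y. g (inv_into U \<phi> y)) (\<phi> x) w + g x * FD (\<lambda>y. f (inv_into U \<phi> y)) (\<phi> x) w"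
    "FD (\<lambda>y. (fscale a f) (inv_into U \<phi> y)) (\<phi> x) w = a * FD (\<lambda>y. f (inv_into U \<phi> y)) (\<phi> x) w"
    if "f \<in> smooth_near A x" "g \<in> smooth_near A x" for f g a
    using fun_cong[OF FD_eqI[OF has_derivative_add[OF d[OF that(1)] d[OF that(2)]]], of w]
      fun_cong[OF FD_eqI[OF has_derivative_mult[OF d[OF that(1)] d[OF that(2)]]], of w]
      fun_cong[OF FD_eqI[OF has_derivative_mult_right[OF d[OF that(1)], of a]], of w]
    by (simp_all add: \<psi> fscale_def mult.commute)
  then show ?thesis
    unfolding tangent_space_def dir_vec_def using smooth_near_ops by auto
qed

lemma tangent_closed:
  assumes "v \<in> tangent_space A x" "w \<in> tangent_space A x"
  shows "v + w \<in> tangent_space A x" "fscale a v \<in> tangent_space A x"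
proof -
  show "v + w \<in> tangent_space A x"
    using assms unfolding tangent_space_def by (simp add: distrib_left)
  show "fscale a v \<in> tangent_space A x"
    using assms(1) unfolding tangent_space_def by (simp add: fscale_def algebra_simps)
qed

lemma tangent_eq_sum:
  assumes c: "(U, \<phi>) \<in> maximal_atlas A" and x: "x \<in> U" and v: "v \<in> tangent_space A x"
  shows "v = (\<Sum>b\<in>Basis. fscale (v (\<lambda>y. \<phi> y \<bullet> b)) (dir_vec U \<phi> x b))"
proof
  fix f
  show "v f = (\<Sum>b\<in>Basis. fscale (v (\<lambda>y. \<phi> y \<bullet> b)) (dir_vec U \<phi> x b)) f"
  proof (cases "f \<in> smooth_near A x")
    case True
    then show ?thesis
      unfolding sum_fun_apply tangent_expand[OF c x v True] by (simp add: fscale_def dir_vec_def mult.commute)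
  next
    case False
    then show ?thesis unfolding sum_fun_apply tangentD(4)[OF v False] by (simp add: fscale_def dir_vec_def)
  qed
qed

lemma cotangentD:
  assumes "\<alpha> \<in> cotangent_space A x"
  shows "v \<in> tangent_space A x \<Longrightarrow> w \<in> tangent_space A x \<Longrightarrow> \<alpha> (v + w) = \<alpha> v + \<alpha> w"
    "v \<in> tangent_space A x \<Longrightarrow> \<alpha> (fscale a v) = a * \<alpha> v"
    "v \<notin> tangent_space A x \<Longrightarrow> \<alpha> v = 0"
  using assms unfolding cotangent_space_def by blast+

lemma tangent_zero: "0 \<in> tangent_space A x"
  by (simp add: tangent_space_def)

lemma cotangent_sum:
  assumes \<alpha>: "\<alpha> \<in> cotangent_space A x" and "finite I" "\<And>i. i \<in> I \<Longrightarrow> v i \<in> tangent_space A x"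
  shows "\<alpha> (\<Sum>i\<in>I. fscale (a i) (v i)) = (\<Sum>i\<in>I. a i * \<alpha> (v i)) \<and> (\<Sum>i\<in>I. fscale (a i) (v i)) \<in> tangent_space A x"
  using assms(2,3)
proof (induction I rule: finite_induct)
  case empty
  have "fscale 0 0 = (0 :: 'a tvec)" by (simp add: fscale_def fun_eq_iff)
  then have "\<alpha> 0 = 0" using cotangentD(2)[OF \<alpha> tangent_zero, of 0] by simp
  then show ?case unfolding sum.empty using tangent_zero by (rule conjI)
next
  case (insert i I)
  have t: "fscale (a i) (v i) \<in> tangent_space A x" using insert.prems by (intro tangent_closed) auto
  have IH: "\<alpha> (\<Sum>i\<in>I. fscale (a i) (v i)) = (\<Sum>i\<in>I. a i * \<alpha> (v i))" "(\<Sum>i\<in>I. fscale (a i) (v i)) \<in> tangent_space A x"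
    using insert by auto
  have vi: "v i \<in> tangent_space A x" using insert.prems by simp
  show ?case unfolding sum.insert[OF insert(1,2)]
  proof
    show "\<alpha> (fscale (a i) (v i) + (\<Sum>i\<in>I. fscale (a i) (v i))) = a i * \<alpha> (v i) + (\<Sum>i\<in>I. a i * \<alpha> (v i))"
      unfolding cotangentD(1)[OF \<alpha> t IH(2)] cotangentD(2)[OF \<alpha> vi] IH(1) ..
  qed (rule tangent_closed(1)[OF t IH(2)])
qed

lemma differential_cotangent: "differential A f x \<in> cotangent_space A x"
  unfolding cotangent_space_def differential_def using tangent_closed by (auto simp: fscale_def)

lemma differential_dir_vec:
  assumes "(U, \<phi>) \<in> maximal_atlas A" "x \<in> U" "f \<in> smooth_near A x"
  shows "differential A f x (dir_vec U \<phi> x w) = FD (\<lambda>y. f (inv_into U \<phi> y)) (\<phi> x) w"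
  using dir_vec_tangent[OF assms(1,2)] assms(3) by (simp add: differential_def dir_vec_def)

lemma cotangent_closed:
  assumes "\<alpha> \<in> cotangent_space A x" "\<beta> \<in> cotangent_space A x"
  shows "\<alpha> + \<beta> \<in> cotangent_space A x" "fscale a \<alpha> \<in> cotangent_space A x"
  using assms unfolding cotangent_space_def by (simp_all add: fscale_def algebra_simps)

lemma cotangent_eq_sum:
  assumes c: "(U, \<phi>) \<in> maximal_atlas A" and x: "x \<in> U" and \<alpha>: "\<alpha> \<in> cotangent_space A x"
  shows "\<alpha> = (\<Sum>b\<in>Basis. fscale (\<alpha> (dir_vec U \<phi> x b)) (differential A (\<lambda>y. \<phi> y \<bullet> b) x))"
proof
  fix v
  show "\<alpha> v = (\<Sum>b\<in>Basis. fscale (\<alpha> (dir_vec U \<phi> x b)) (differential A (\<lambda>y. \<phi> y \<bullet> b) x)) v"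
  proof (cases "v \<in> tangent_space A x")
    case True
    have "\<alpha> v = \<alpha> (\<Sum>b\<in>Basis. fscale (v (\<lambda>y. \<phi> y \<bullet> b)) (dir_vec U \<phi> x b))"
      using tangent_eq_sum[OF c x True] by simp
    also have "\<dots> = (\<Sum>b\<in>Basis. v (\<lambda>y. \<phi> y \<bullet> b) * \<alpha> (dir_vec U \<phi> x b))"
      using cotangent_sum[OF \<alpha> finite_Basis dir_vec_tangent[OF c x], where a = "\<lambda>b. v (\<lambda>y. \<phi> y \<bullet> b)"]
      by (rule conjunct1)
    finally show ?thesis using True by (simp add: sum_fun_apply fscale_def differential_def mult.commute)
  next
    case False
    then show ?thesis using cotangentD(3)[OF \<alpha> False] by (simp add: sum_fun_apply fscale_def differential_def)
  qed
qed

lemma bivector_sum_left: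
  assumes B: "bivector_at A x B" and \<beta>: "\<beta> \<in> cotangent_space A x"
    and "finite I" "\<And>i. i \<in> I \<Longrightarrow> \<alpha> i \<in> cotangent_space A x"
  shows "B (\<Sum>i\<in>I. fscale (a i) (\<alpha> i)) \<beta> = (\<Sum>i\<in>I. a i * B (\<alpha> i) \<beta>) \<and> (\<Sum>i\<in>I. fscale (a i) (\<alpha> i)) \<in> cotangent_space A x"
  using assms(3,4)
proof (induction I rule: finite_induct)
  case empty
  have z: "0 \<in> cotangent_space A x" by (simp add: cotangent_space_def)
  have "fscale 0 0 = (0 :: 'a covec)" by (simp add: fscale_def fun_eq_iff)
  moreover have "B (fscale 0 0) \<beta> = 0 * B 0 \<beta>" using B z \<beta> unfolding bivector_at_def by blast
  ultimately have "B 0 \<beta> = 0" by simp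
  then show ?case unfolding sum.empty using z by (rule conjI)
next
  case (insert i I)
  have t: "fscale (a i) (\<alpha> i) \<in> cotangent_space A x" using insert.prems by (intro cotangent_closed) auto
  have IH: "B (\<Sum>i\<in>I. fscale (a i) (\<alpha> i)) \<beta> = (\<Sum>i\<in>I. a i * B (\<alpha> i) \<beta>)" "(\<Sum>i\<in>I. fscale (a i) (\<alpha> i)) \<in> cotangent_space A x"
    using insert by auto
  have "B (fscale (a i) (\<alpha> i) + (\<Sum>i\<in>I. fscale (a i) (\<alpha> i))) \<beta> = B (fscale (a i) (\<alpha> i)) \<beta> + B (\<Sum>i\<in>I. fscale (a i) (\<alpha> i)) \<beta>"
    "B (fscale (a i) (\<alpha> i)) \<beta> = a i * B (\<alpha> i) \<beta>"
    using B t IH(2) \<beta> insert.prems unfolding bivector_at_def by blast+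
  then have "B (fscale (a i) (\<alpha> i) + (\<Sum>i\<in>I. fscale (a i) (\<alpha> i))) \<beta> = a i * B (\<alpha> i) \<beta> + (\<Sum>i\<in>I. a i * B (\<alpha> i) \<beta>)"
    using IH(1) by metis
  then show ?case unfolding sum.insert[OF insert(1,2)]
    by (rule conjI) (rule cotangent_closed(1)[OF t IH(2)])
qed

lemma bivector_skew:
  "bivector_at A x B \<Longrightarrow> \<alpha> \<in> cotangent_space A x \<Longrightarrow> \<beta> \<in> cotangent_space A x \<Longrightarrow> B \<alpha> \<beta> = - B \<beta> \<alpha>"
  unfolding bivector_at_def by blast

lemma bivector_expand_left:
  assumes c: "(U, \<phi>) \<in> maximal_atlas A" and x: "x \<in> U" and B: "bivector_at A x B"
    and \<alpha>: "\<alpha> \<in> cotangent_space A x" "\<beta> \<in> cotangent_space A x"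
  shows "B \<alpha> \<beta> = (\<Sum>b\<in>Basis. \<alpha> (dir_vec U \<phi> x b) * B (differential A (\<lambda>y. \<phi> y \<bullet> b) x) \<beta>)"
  using bivector_sum_left[OF B \<alpha>(2) finite_Basis differential_cotangent, of "\<lambda>b. \<alpha> (dir_vec U \<phi> x b)" "\<lambda>b. \<lambda>y. \<phi> y \<bullet> b"]
  unfolding cotangent_eq_sum[OF c x \<alpha>(1), symmetric] by blast

lemma bivector_expand_right:
  assumes c: "(U, \<phi>) \<in> maximal_atlas A" and x: "x \<in> U" and B: "bivector_at A x B"
    and \<alpha>: "\<alpha> \<in> cotangent_space A x" "\<beta> \<in> cotangent_space A x"
  shows "B \<alpha> \<beta> = (\<Sum>c\<in>Basis. \<beta> (dir_vec U \<phi> x c) * B \<alpha> (differential A (\<lambda>y. \<phi> y \<bullet> c) x))"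
proof -
  have "B \<alpha> \<beta> = - B \<beta> \<alpha>" by (rule bivector_skew[OF B \<alpha>])
  also have "\<dots> = (\<Sum>c\<in>Basis. \<beta> (dir_vec U \<phi> x c) * - B (differential A (\<lambda>y. \<phi> y \<bullet> c) x) \<alpha>)"
    unfolding bivector_expand_left[OF c x B \<alpha>(2,1)] by (simp add: sum_negf)
  also have "\<dots> = (\<Sum>c\<in>Basis. \<beta> (dir_vec U \<phi> x c) * B \<alpha> (differential A (\<lambda>y. \<phi> y \<bullet> c) x))"
    using bivector_skew[OF B \<alpha>(1) differential_cotangent] by simp
  finally show ?thesis .
qed

lemma bivector_expand:
  assumes c: "(U, \<phi>) \<in> maximal_atlas A" and x: "x \<in> U" and B: "bivector_at A x (P x)"
    and \<alpha>: "\<alpha> \<in> cotangent_space A x" "\<beta> \<in> cotangent_space A x"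
  shows "P x \<alpha> \<beta> = (\<Sum>b\<in>Basis. \<Sum>c\<in>Basis. \<alpha> (dir_vec U \<phi> x b) * \<beta> (dir_vec U \<phi> x c) *
    bracket A P (\<lambda>y. \<phi> y \<bullet> b) (\<lambda>y. \<phi> y \<bullet> c) x)"
proof -
  have "P x \<alpha> \<beta> = (\<Sum>b\<in>Basis. \<alpha> (dir_vec U \<phi> x b) * P x (differential A (\<lambda>y. \<phi> y \<bullet> b) x) \<beta>)"
    by (rule bivector_expand_left[OF c x B \<alpha>])
  also have "\<dots> = (\<Sum>b\<in>Basis. \<alpha> (dir_vec U \<phi> x b) * (\<Sum>c\<in>Basis. \<beta> (dir_vec U \<phi> x c) *
    P x (differential A (\<lambda>y. \<phi> y \<bullet> b) x) (differential A (\<lambda>y. \<phi> y \<bullet> c) x)))"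
    by (intro sum.cong refl arg_cong2[where f = "(*)"] bivector_expand_right[OF c x B differential_cotangent \<alpha>(2)])
  finally show ?thesis by (simp add: bracket_def sum_distrib_left mult.assoc)
qed

lemma bracket_expand:
  assumes c: "(U, \<phi>) \<in> maximal_atlas A" and x: "x \<in> U" and B: "bivector_at A x (P x)"
    and f: "f \<in> smooth_near A x" "g \<in> smooth_near A x"
  shows "bracket A P f g x = (\<Sum>b\<in>Basis. \<Sum>c\<in>Basis. FD (\<lambda>y. f (inv_into U \<phi> y)) (\<phi> x) b *
    FD (\<lambda>y. g (inv_into U \<phi> y)) (\<phi> x) c * bracket A P (\<lambda>y. \<phi> y \<bullet> b) (\<lambda>y. \<phi> y \<bullet> c) x)"
proof -
  have "bracket A P f g x = P x (differential A f x) (differential A g x)" by (simp add: bracket_def)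
  also have "\<dots> = (\<Sum>b\<in>Basis. \<Sum>c\<in>Basis. differential A f x (dir_vec U \<phi> x b) * differential A g x (dir_vec U \<phi> x c) *
    bracket A P (\<lambda>y. \<phi> y \<bullet> b) (\<lambda>y. \<phi> y \<bullet> c) x)"
    by (rule bivector_expand[where P = P, OF c x B differential_cotangent[of f] differential_cotangent[of g]])
  finally show ?thesis unfolding differential_dir_vec[OF c x f(1)] differential_dir_vec[OF c x f(2)] .
qed

end

section \<open>Poisson manifolds in charts\<close>

lemma (in poisson_domain) br_cong2:
  assumes "open S" "y \<in> S" "\<And>x. x \<in> S \<Longrightarrow> F x = F' x" "\<And>x. x \<in> S \<Longrightarrow> G x = G' x"
  shows "br F G y = br F' G' y"
  unfolding br_def using FD_cong[of S y F F'] FD_cong[of S y G G'] assms by simp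

locale poisson_mfd =
  fixes A :: "('a::{t2_space, second_countable_topology}, 'e::euclidean_space) chart set" and P :: "'a \<Rightarrow> 'a bivec"
  assumes poisson: "poisson_manifold A P"

sublocale poisson_mfd \<subseteq> smooth_mfd A
  using poisson by unfold_locales (simp add: poisson_manifold_def)

context poisson_mfd
begin

lemma bivector: "bivector_at A x (P x)"
  and smooth_bracket: "open W \<Longrightarrow> smooth_fun A W f \<Longrightarrow> smooth_fun A W g \<Longrightarrow> smooth_fun A W (bracket A P f g)"
  using poisson unfolding poisson_manifold_def bivector_field_def by blast+

lemma bracket_skew: "bracket A P f g x = - bracket A P g f x"
  unfolding bracket_def by (rule bivector_skew[OF bivector differential_cotangent differential_cotangent])

lemma global_jacobi:
  assumes "smooth_fun A UNIV f" "smooth_fun A UNIV g" "smooth_fun A UNIV h"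
  shows "bracket A P (bracket A P f g) h x + bracket A P (bracket A P g h) f x + bracket A P (bracket A P h f) g x = 0"
proof -
  have "bracket A P (bracket A P f g) h + bracket A P (bracket A P g h) f + bracket A P (bracket A P h f) g = 0"
    using poisson assms unfolding poisson_manifold_def lie_bracket_on_def by blast
  from fun_cong[OF this, of x] show ?thesis by simp
qed

definition chart_bivec :: "'a set \<Rightarrow> ('a \<Rightarrow> 'e) \<Rightarrow> 'e \<Rightarrow> 'e \<Rightarrow> 'e \<Rightarrow> real" where
  "chart_bivec U \<phi> b c y = bracket A P (\<lambda>x. \<phi> x \<bullet> b) (\<lambda>x. \<phi> x \<bullet> c) (inv_into U \<phi> y)"

lemma chart_poisson_domain:
  assumes c: "(U, \<phi>) \<in> maximal_atlas A"
  shows "poisson_domain (\<phi> ` U) (chart_bivec U \<phi>)"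
proof
  note F = chart_facts[OF maximal_is_chart[OF c]]
  show "open (\<phi> ` U)" by (rule F(2))
  show "smooth_on (\<phi> ` U) (chart_bivec U \<phi> b d)" for b d
    using smooth_bracket[OF F(1) smooth_fun_inner_chart[OF c, of b] smooth_fun_inner_chart[OF c, of d]]
    by (simp add: smooth_fun_iff_chart[OF c F(1)] chart_bivec_def[abs_def])
  show "chart_bivec U \<phi> b d y = - chart_bivec U \<phi> d b y" for b d y
    unfolding chart_bivec_def by (rule bracket_skew)
qed

lemma bracket_chart:
  assumes c: "(U, \<phi>) \<in> maximal_atlas A" and x: "x \<in> U" and f: "f \<in> smooth_near A x" "g \<in> smooth_near A x"
  shows "bracket A P f g x = poisson_domain.br (chart_bivec U \<phi>) (\<lambda>y. f (inv_into U \<phi> y)) (\<lambda>y. g (inv_into U \<phi> y)) (\<phi> x)"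
  unfolding poisson_domain.br_def[OF chart_poisson_domain[OF c]]
    bracket_expand[where P = P, OF c x bivector f]
  by (simp add: chart_bivec_def chart_facts(6)[OF maximal_is_chart[OF c] x])

lemma extend_globally:
  assumes c: "(U, \<phi>) \<in> maximal_atlas A" and S: "open S" "S \<subseteq> \<phi> ` U" "y \<in> S"
  obtains S' where "open S'" "y \<in> S'" "S' \<subseteq> S"
    "\<And>F. smooth_on S F \<Longrightarrow> \<exists>f. smooth_fun A UNIV f \<and> (\<forall>z\<in>S'. f (inv_into U \<phi> z) = F z)"
proof -
  note F = chart_facts[OF maximal_is_chart[OF c]]
  obtain R where R: "R > 0" "cball y R \<subseteq> S" using S open_contains_cball by blast
  obtain \<rho> where \<rho>: "smooth_on UNIV \<rho>" "\<And>x. dist y x \<le> R / 2 \<Longrightarrow> \<rho> x = (1::real)" "\<And>x. R \<le> dist y x \<Longrightarrow> \<rho> x = 0"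
    using smooth_bump[of "R/2" R y] R by auto
  show thesis
  proof (rule that[of "ball y (R/2)"])
    show "open (ball y (R/2))" "y \<in> ball y (R/2)" using R by auto
    have "ball y (R/2) \<subseteq> cball y R" using R(1) by (auto simp: subset_iff)
    then show bS: "ball y (R/2) \<subseteq> S" using R(2) by blast
    fix G :: "'e \<Rightarrow> real" assume G: "smooth_on S G"
    define Gt where "Gt z = (if z \<in> S then \<rho> z * G z else 0)" for z
    have Gt: "smooth_on UNIV Gt"
      unfolding Gt_def
    proof (rule smooth_on_extend_by_0[OF S(1) closed_cball R(2)])
      show "smooth_on S (\<lambda>z. \<rho> z * G z)" by (intro smooth_on_mult S(1) G smooth_on_subset[OF \<rho>(1)]) simp
      show "\<rho> z * G z = 0" if "z \<notin> cball y R" for z using \<rho>(3)[of z] that by simp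
    qed
    have Gt0: "Gt z = 0" if "z \<notin> cball y R" for z using \<rho>(3)[of z] that by (simp add: Gt_def)
    define f where "f x = (if x \<in> U then Gt (\<phi> x) else 0)" for x
    define K where "K = inv_into U \<phi> ` cball y R"
    have "compact K" unfolding K_def
      by (intro compact_continuous_image continuous_on_subset[OF F(5)] compact_cball) (use R S in blast)
    then have K: "closed K" by (rule compact_imp_closed)
    have KU: "K \<subseteq> U" unfolding K_def using F(8) R(2) S(2) by blast
    have f0: "f x = 0" if "x \<notin> K" for x
    proof (cases "x \<in> U")
      case True
      then have "\<phi> x \<notin> cball y R" using that F(6)[OF True] unfolding K_def by force
      then show ?thesis using Gt0 by (simp add: f_def)
    qed (simp add: f_def)
    have "smooth_fun A UNIV f"
    proof (rule smooth_fun_local[OF open_UNIV])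
      fix x
      show "\<exists>N. open N \<and> x \<in> N \<and> smooth_fun A N f"
      proof (cases "x \<in> U")
        case True
        have "smooth_on (\<phi> ` U) (\<lambda>z. f (inv_into U \<phi> z))"
          by (rule smooth_on_cong[OF F(2) _ smooth_on_subset[OF Gt]]) (auto simp: f_def F(6))
        then have "smooth_fun A U f" using smooth_fun_iff_chart[OF c F(1) order_refl] by blast
        then show ?thesis using True F(1) by blast
      next
        case False
        have "smooth_fun A (- K) f"
          by (rule smooth_fun_cong[of _ "\<lambda>x. 0"]) (use K f0 in \<open>auto simp: smooth_fun_def comp_def\<close>)
        then show ?thesis using K KU False by (intro exI[of _ "- K"]) auto
      qed
    qed
    moreover have "f (inv_into U \<phi> z) = G z" if "z \<in> ball y (R/2)" for z
    proof -
      have "z \<in> S" "z \<in> \<phi> ` U" using that bS S(2) by blast+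
      then show ?thesis using F(7,8)[of z] \<rho>(2)[of z] that by (simp add: f_def Gt_def)
    qed
    ultimately show "\<exists>f. smooth_fun A UNIV f \<and> (\<forall>z\<in>ball y (R/2). f (inv_into U \<phi> z) = G z)" by blast
  qed
qed

lemma chart_jacobi:
  assumes c: "(U, \<phi>) \<in> maximal_atlas A"
  shows "poisson_domain_jacobi (\<phi> ` U) (chart_bivec U \<phi>)"
proof -
  note CF = chart_facts[OF maximal_is_chart[OF c]]
  interpret poisson_domain "\<phi> ` U" "chart_bivec U \<phi>" by (rule chart_poisson_domain[OF c])
  show ?thesis
  proof
    fix S and F G H :: "'e \<Rightarrow> real" and y
    assume S: "open S" "S \<subseteq> \<phi> ` U" and s: "smooth_on S F" "smooth_on S G" "smooth_on S H" and y: "y \<in> S"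
    obtain S' where S': "open S'" "y \<in> S'" "S' \<subseteq> S"
      and ext: "\<And>F :: 'e \<Rightarrow> real. smooth_on S F \<Longrightarrow> \<exists>f. smooth_fun A UNIV f \<and> (\<forall>z\<in>S'. f (inv_into U \<phi> z) = F z)"
      using extend_globally[OF c S y] by blast
    obtain f g h where fgh: "smooth_fun A UNIV f" "smooth_fun A UNIV g" "smooth_fun A UNIV h"
      and eq: "\<And>z. z \<in> S' \<Longrightarrow> f (inv_into U \<phi> z) = F z" "\<And>z. z \<in> S' \<Longrightarrow> g (inv_into U \<phi> z) = G z"
        "\<And>z. z \<in> S' \<Longrightarrow> h (inv_into U \<phi> z) = H z"
      using ext[OF s(1)] ext[OF s(2)] ext[OF s(3)] by blast
    have *: "bracket A P u v (inv_into U \<phi> z) = br X Y z"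
      if "smooth_fun A UNIV u" "smooth_fun A UNIV v" "\<And>z. z \<in> S' \<Longrightarrow> u (inv_into U \<phi> z) = X z"
        "\<And>z. z \<in> S' \<Longrightarrow> v (inv_into U \<phi> z) = Y z" "z \<in> S'" for u v X Y z
    proof -
      have z: "z \<in> \<phi> ` U" using that(5) S'(3) S(2) by blast
      have "bracket A P u v (inv_into U \<phi> z) = br (\<lambda>y. u (inv_into U \<phi> y)) (\<lambda>y. v (inv_into U \<phi> y)) (\<phi> (inv_into U \<phi> z))"
        using that(1,2) by (intro bracket_chart[OF c CF(8)[OF z]] smooth_nearI[OF open_UNIV UNIV_I])
      also have "\<dots> = br X Y z"
        unfolding CF(7)[OF z] by (rule br_cong2[OF S'(1) that(5)]) (use that(3,4) in auto)
      finally show ?thesis .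
    qed
    note sb = smooth_bracket[OF open_UNIV]
    let ?x = "inv_into U \<phi> y"
    have "bracket A P (bracket A P f g) h ?x = br (br F G) H y"
      by (rule *[OF sb[OF fgh(1,2)] fgh(3) *[OF fgh(1,2) eq(1,2)] eq(3) S'(2)])
    moreover have "bracket A P (bracket A P g h) f ?x = br (br G H) F y"
      by (rule *[OF sb[OF fgh(2,3)] fgh(1) *[OF fgh(2,3) eq(2,3)] eq(1) S'(2)])
    moreover have "bracket A P (bracket A P h f) g ?x = br (br H F) G y"
      by (rule *[OF sb[OF fgh(3,1)] fgh(2) *[OF fgh(3,1) eq(3,1)] eq(2) S'(2)])
    ultimately show "br (br F G) H y + br (br G H) F y + br (br H F) G y = 0"
      using global_jacobi[OF fgh, of ?x] by simp
  qed
qed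

lemma canonical_chart:
  fixes p :: "nat \<Rightarrow> 'a \<Rightarrow> real"
  assumes V: "open V" "m \<in> V"
    and smooth: "\<And>i. i < r \<Longrightarrow> smooth_fun A V (p i)"
    and involution: "\<And>i j x. i < r \<Longrightarrow> j < r \<Longrightarrow> x \<in> V \<Longrightarrow> bracket A P (p i) (p j) x = 0"
    and vanish: "\<And>i. i < r \<Longrightarrow> p i m = 0"
    and indep: "lin_indep_family r (\<lambda>i. hamiltonian_vf A P (p i) m)"
  obtains U q z xs where "open U" "m \<in> U" "U \<subseteq> V" "2 * r \<le> DIM('e)" "xs = pqz r (DIM('e) - 2 * r) p q z"
    "coordinate_system A U xs" "centered_at m xs"
    "\<And>x. x \<in> U \<Longrightarrow> canonical_matrix r (DIM('e) - 2 * r) (\<lambda>k l. bracket A P (xs ! k) (xs ! l) x)"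
    "\<And>i j x y. \<lbrakk>i < DIM('e) - 2 * r; j < DIM('e) - 2 * r; x \<in> U; y \<in> U; \<forall>k<DIM('e) - 2 * r. z k x = z k y\<rbrakk>
      \<Longrightarrow> bracket A P (z i) (z j) x = bracket A P (z i) (z j) y"
proof -
  obtain U0 \<phi> where c0: "(U0, \<phi>) \<in> A" and m0: "m \<in> U0" by (rule chart_covers)
  note c = atlas_maximal[OF c0]
  note F = chart_facts[OF maximal_is_chart[OF c]]
  let ?\<psi> = "inv_into U0 \<phi>" and ?n = "DIM('e)" and ?s = "DIM('e) - 2 * r"
  interpret poisson_domain_jacobi "\<phi> ` U0" "chart_bivec U0 \<phi>" by (rule chart_jacobi[OF c])
  define V' where "V' = \<phi> ` (U0 \<inter> V)"
  define p' where "p' i y = p i (?\<psi> y)" for i y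
  have UV: "open (U0 \<inter> V)" "U0 \<inter> V \<subseteq> U0" using F(1) V by auto
  have p_near: "p i \<in> smooth_near A x" if "i < r" "x \<in> V" for i x
    using smooth_nearI[OF V(1) that(2) smooth[OF that(1)]] .
  interpret involutive_family "\<phi> ` U0" "chart_bivec U0 \<phi>" V' "\<phi> m" r p'
  proof
    show "open V'" using F(9)[OF V(1)] by (simp add: V'_def)
    show "V' \<subseteq> \<phi> ` U0" "\<phi> m \<in> V'" using m0 V(2) by (auto simp: V'_def)
    show sp: "smooth_on V' (p' i)" if "i < r" for i
      using smooth_fun_iff_chart[OF c UV, of "p i"] smooth_fun_subset[OF smooth[OF that], of "U0 \<inter> V"]
      by (simp add: V'_def p'_def[abs_def])
    show "br (p' i) (p' j) y = 0" if "i < r" "j < r" and y: "y \<in> V'" for i j y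
    proof -
      obtain x where x: "x \<in> U0" "x \<in> V" "y = \<phi> x" using y by (auto simp: V'_def)
      show ?thesis
        using bracket_chart[OF c x(1) p_near[OF that(1) x(2)] p_near[OF that(2) x(2)]] involution[OF that(1,2) x(2)] x(3)
        by (simp add: p'_def[abs_def])
    qed
    show "p' i (\<phi> m) = 0" if "i < r" for i using vanish[OF that] F(6)[OF m0] by (simp add: p'_def)
    show "\<forall>i<r. a i = 0" if a: "(\<Sum>i<r. a i *\<^sub>R ham (p' i) (\<phi> m)) = 0" for a
    proof -
      have "(\<Sum>i<r. fscale (a i) (hamiltonian_vf A P (p i) m)) = 0"
      proof
        fix f
        show "(\<Sum>i<r. fscale (a i) (hamiltonian_vf A P (p i) m)) f = 0 f"
        proof (cases "f \<in> smooth_near A m")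
          case True
          let ?f = "\<lambda>y. f (?\<psi> y)"
          have d: "?f differentiable (at (\<phi> m))" by (rule near_differentiable[OF c m0 True])
          then have lin: "linear (FD ?f (\<phi> m))" using FD_works has_derivative_linear by blast
          have "(\<Sum>i<r. fscale (a i) (hamiltonian_vf A P (p i) m)) f = (\<Sum>i<r. a i * bracket A P f (p i) m)"
            using True by (simp add: sum_fun_apply fscale_def hamiltonian_vf_def)
          also have "\<dots> = (\<Sum>i<r. a i * FD ?f (\<phi> m) (ham (p' i) (\<phi> m)))"
            by (intro sum.cong refl arg_cong2[where f = "(*)"])
              (simp add: bracket_chart[OF c m0 True p_near[OF _ V(2)]] br_ham[OF d] p'_def[abs_def])
          also have "\<dots> = FD ?f (\<phi> m) (\<Sum>i<r. a i *\<^sub>R ham (p' i) (\<phi> m))"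
            by (simp add: linear_sum[OF lin] linear_cmul[OF lin])
          also have "\<dots> = 0" using a linear_0[OF lin] by simp
          finally show ?thesis by simp
        next
          case False
          then show ?thesis by (simp add: sum_fun_apply fscale_def hamiltonian_vf_def)
        qed
      qed
      then show ?thesis using indep unfolding lin_indep_family_def by blast
    qed
  qed
  obtain W q' z' xs' g \<epsilon> where W: "open W" "\<phi> m \<in> W" "W \<subseteq> V'" and r: "2 * r \<le> ?n" and xs': "xs' = pqz r ?s p' q' z'"
    and hom: "homeomorphism W (ball 0 \<epsilon>) (coord_map xs') (g :: 'e \<Rightarrow> 'e)" and g: "smooth_on (ball 0 \<epsilon>) g"
    and sxs': "\<And>k. k < ?n \<Longrightarrow> smooth_on W (xs' ! k)" and xs'0: "\<And>k. k < ?n \<Longrightarrow> (xs' ! k) (\<phi> m) = 0"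
    and B': "\<And>x. x \<in> W \<Longrightarrow> canonical_matrix r ?s (\<lambda>k l. br (xs' ! k) (xs' ! l) x)"
    and const: "\<And>F x y. \<lbrakk>smooth_on W F; \<forall>x\<in>W. \<forall>l<2 * r. br F (xs' ! l) x = 0;
       x \<in> W; y \<in> W; \<forall>k<?s. z' k x = z' k y\<rbrakk> \<Longrightarrow> F x = F y"
    by (rule canonical_coordinates) (rule that, assumption+)
  have WU0: "W \<subseteq> \<phi> ` U0" and WV: "W \<subseteq> \<phi> ` (U0 \<inter> V)" using W(3) by (auto simp: V'_def)
  define U where "U = U0 \<inter> \<phi> -` W"
  define q where "q i x = q' i (\<phi> x)" for i x
  define z where "z k x = z' k (\<phi> x)" for k x
  have U: "open U" "m \<in> U" "U \<subseteq> U0" using F(10)[OF W(1)] m0 W(2) by (auto simp: U_def)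
  have \<phi>U: "\<phi> ` U = W" using WU0 by (auto simp: U_def)
  have \<psi>W: "?\<psi> y \<in> U" "\<phi> (?\<psi> y) = y" if "y \<in> W" for y
    using F(7,8)[of y] WU0 that by (auto simp: U_def)
  have UV': "U \<subseteq> V"
  proof
    fix x assume x: "x \<in> U"
    then obtain w where w: "w \<in> U0" "w \<in> V" "\<phi> x = \<phi> w" using WV by (auto simp: U_def)
    then have "x = w" using F(3) x U(3) by (auto simp: inj_on_def)
    then show "x \<in> V" using w by simp
  qed
  have BR: "bracket A P f h x = br G H (\<phi> x)"
    if "x \<in> U" "smooth_fun A U f" "smooth_fun A U h" "\<And>y. y \<in> W \<Longrightarrow> f (?\<psi> y) = G y" "\<And>y. y \<in> W \<Longrightarrow> h (?\<psi> y) = H y"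
    for f h G H x
  proof -
    have "bracket A P f h x = br (\<lambda>y. f (?\<psi> y)) (\<lambda>y. h (?\<psi> y)) (\<phi> x)"
      using that U by (intro bracket_chart[OF c] smooth_nearI[OF U(1)]) auto
    also have "\<dots> = br G H (\<phi> x)" by (rule br_cong2[OF W(1)]) (use that U_def in auto)
    finally show ?thesis .
  qed
  have xU: "\<phi> x \<in> W" if "x \<in> U" for x using that by (simp add: U_def)
  define xs where "xs = pqz r ?s p q z"
  have len: "length xs = ?n" "length xs' = ?n" using r by (simp_all add: xs_def xs' length_pqz)
  have nth: "(xs ! k) x = (xs' ! k) (\<phi> x)" if "x \<in> U" "k < ?n" for x k
  proof -
    have "k < 2 * r + ?s" using that(2) r by simp
    moreover have "p i x = p' i (\<phi> x)" for i using F(6)[of x] that(1) U(3) by (auto simp: p'_def)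
    ultimately show ?thesis
      by (elim pqz_index_cases) (simp_all only: xs_def xs' pqz_nth q_def z_def)
  qed
  let ?X = "coord_map xs :: 'a \<Rightarrow> 'e" and ?X' = "coord_map xs' :: 'e \<Rightarrow> 'e"
  have XX: "?X x = ?X' (\<phi> x)" if "x \<in> U" for x
    unfolding coord_map_def len by (rule sum.cong) (use nth[OF that] in auto)
  have h': "?X' ` W = ball 0 \<epsilon>" "g ` ball 0 \<epsilon> = W" "\<And>y. y \<in> W \<Longrightarrow> g (?X' y) = y" "\<And>w. w \<in> ball 0 \<epsilon> \<Longrightarrow> ?X' (g w) = w"
    "continuous_on W ?X'" "continuous_on (ball 0 \<epsilon>) g"
    using hom by (auto simp: homeomorphism_def)
  have hX: "homeomorphism U (ball 0 \<epsilon>) ?X (\<lambda>w. ?\<psi> (g w))"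
    unfolding homeomorphism_def
  proof (intro conjI ballI)
    have "continuous_on U (\<lambda>x. ?X' (\<phi> x))"
      by (rule continuous_on_compose2[OF h'(5) continuous_on_subset[OF F(4) U(3)]]) (simp add: \<phi>U)
    then show "continuous_on U ?X"
      using continuous_on_cong[of U U ?X "\<lambda>x. ?X' (\<phi> x)"] XX by simp
    show "continuous_on (ball 0 \<epsilon>) (\<lambda>w. ?\<psi> (g w))"
      by (rule continuous_on_compose2[OF F(5) h'(6)]) (use h'(2) WU0 in auto)
    show X1: "?\<psi> (g (?X x)) = x" if "x \<in> U" for x
      using XX[OF that] h'(3)[OF xU[OF that]] F(6)[of x] that U(3) by auto
    show X2: "?X (?\<psi> (g y)) = y" if "y \<in> ball 0 \<epsilon>" for y
    proof -
      have "g y \<in> W" using h'(2) that by blast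
      then show ?thesis using XX[OF \<psi>W(1)] \<psi>W(2) h'(4)[OF that] by simp
    qed
    have "?X ` U = ?X' ` \<phi> ` U" using XX by (auto simp: image_iff)
    then show "?X ` U = ball 0 \<epsilon>" by (simp add: \<phi>U h'(1))
    have "(\<lambda>w. ?\<psi> (g w)) ` ball 0 \<epsilon> = ?\<psi> ` W" using h'(2) by (metis image_image)
    also have "\<dots> = U" using F(6) U(3) by (force simp: \<phi>U[symmetric])
    finally show "(\<lambda>w. ?\<psi> (g w)) ` ball 0 \<epsilon> = U" .
  qed
  then have XU: "?X ` U = ball 0 \<epsilon>" by (simp add: homeomorphism_def)
  have chX: "is_chart (U, ?X)" unfolding is_chart_def using U(1) XU hX by auto
  have invX: "inv_into U ?X w = ?\<psi> (g w)" if "w \<in> ball 0 \<epsilon>" for w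
  proof -
    have "inj_on ?X U" using chart_facts(3)[OF chX] .
    moreover have "?\<psi> (g w) \<in> U" "?X (?\<psi> (g w)) = w" using hX that by (auto simp: homeomorphism_def)
    ultimately show ?thesis by (rule inv_into_f_eq)
  qed
  have sX': "smooth_on W ?X'" using sxs' len by (intro smooth_coord_map[OF W(1)]) auto
  have maxX: "(U, ?X) \<in> maximal_atlas A"
    unfolding maximal_atlas_def mem_Collect_eq
  proof (intro conjI chX ballI)
    fix d assume d: "d \<in> A"
    obtain Ud \<phi>d where dd: "d = (Ud, \<phi>d)" by (cases d)
    note dA = d[unfolded dd]
    note Fd = chart_facts[OF maximal_is_chart[OF atlas_maximal[OF dA]]]
    note FX = chart_facts[OF chX]
    have o1: "open (?X ` (U \<inter> Ud))" using FX(9)[OF Fd(1)] .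
    have o2: "open (\<phi>d ` (Ud \<inter> U))" using Fd(9)[OF U(1)] .
    have "smooth_on (?X ` (U \<inter> Ud)) (\<lambda>w. \<phi>d (?\<psi> (g w)))"
    proof (rule smooth_on_compose[OF o1 F(9)[OF Fd(1)] _ _ maximal_transition(1)[OF c dA]])
      show "smooth_on (?X ` (U \<inter> Ud)) g"
        by (rule smooth_on_subset[OF g]) (unfold XU[symmetric], rule image_mono, rule Int_lower1)
      show "g ` (?X ` (U \<inter> Ud)) \<subseteq> \<phi> ` (U0 \<inter> Ud)"
      proof clarify
        fix x assume x: "x \<in> U" "x \<in> Ud"
        have "g (?X x) = \<phi> x" unfolding XX[OF x(1)] by (rule h'(3)[OF xU[OF x(1)]])
        then show "g (?X x) \<in> \<phi> ` (U0 \<inter> Ud)" using x U(3) by blast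
      qed
    qed
    then have "smooth_on (?X ` (U \<inter> Ud)) (\<phi>d \<circ> inv_into U ?X)"
    proof (rule smooth_on_cong[OF o1, rotated])
      show "\<phi>d (?\<psi> (g w)) = (\<phi>d \<circ> inv_into U ?X) w" if w: "w \<in> ?X ` (U \<inter> Ud)" for w
      proof -
        have "w \<in> ball 0 \<epsilon>" using w XU by blast
        then show ?thesis by (simp add: invX)
      qed
    qed
    then show "smooth_transition (U, ?X) d" by (simp add: smooth_transition_def dd)
    have "smooth_on (\<phi>d ` (Ud \<inter> U)) (\<lambda>w. ?X' (\<phi> (inv_into Ud \<phi>d w)))"
    proof (rule smooth_on_compose[OF o2 W(1) _ _ sX'])
      show "smooth_on (\<phi>d ` (Ud \<inter> U)) (\<lambda>w. \<phi> (inv_into Ud \<phi>d w))"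
        by (rule smooth_on_subset[OF maximal_transition(2)[OF c dA]]) (use U(3) in blast)
      show "(\<lambda>w. \<phi> (inv_into Ud \<phi>d w)) ` (\<phi>d ` (Ud \<inter> U)) \<subseteq> W" using Fd(6) xU by auto
    qed
    then have "smooth_on (\<phi>d ` (Ud \<inter> U)) (?X \<circ> inv_into Ud \<phi>d)"
    proof (rule smooth_on_cong[OF o2, rotated])
      show "?X' (\<phi> (inv_into Ud \<phi>d w)) = (?X \<circ> inv_into Ud \<phi>d) w" if w: "w \<in> \<phi>d ` (Ud \<inter> U)" for w
      proof -
        have "inv_into Ud \<phi>d w \<in> U" using w Fd(6) by auto
        from XX[OF this] show ?thesis by simp
      qed
    qed
    then show "smooth_transition d (U, ?X)" by (simp add: smooth_transition_def dd)
  qed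
  have cs: "coordinate_system A U xs" using maxX len by (simp add: coordinate_system_def)
  have BX: "bracket A P (xs ! k) (xs ! l) x = br (xs' ! k) (xs' ! l) (\<phi> x)" if "x \<in> U" "k < ?n" "l < ?n" for x k l
    using nth[OF \<psi>W(1)] \<psi>W(2) that
    by (intro BR[OF that(1)] coordinate_smooth[OF cs]) auto
  show thesis
  proof (rule that[OF U(1,2) UV' r xs_def cs])
    show "centered_at m xs"
      unfolding centered_at_def by (auto simp: in_set_conv_nth len nth[OF U(2)] xs'0)
    show "canonical_matrix r ?s (\<lambda>k l. bracket A P (xs ! k) (xs ! l) x)" if x: "x \<in> U" for x
    proof (rule canonical_matrix_cong[OF B'[OF xU[OF x]]])
      show "bracket A P (xs ! k) (xs ! l) x = br (xs' ! k) (xs' ! l) (\<phi> x)" if "k < 2 * r + ?s" "l < 2 * r + ?s" for k l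
        using BX[OF x] that r by simp
    qed (rule bracket_skew)
    show "bracket A P (z i) (z j) x = bracket A P (z i) (z j) y"
      if ij: "i < ?s" "j < ?s" and xy: "x \<in> U" "y \<in> U" and zxy: "\<forall>k<?s. z k x = z k y" for i j x y
    proof -
      let ?i = "2 * r + i" and ?j = "2 * r + j"
      have ijn: "?i < ?n" "?j < ?n" using ij by auto
      have "br (xs' ! ?i) (xs' ! ?j) (\<phi> x) = br (xs' ! ?i) (xs' ! ?j) (\<phi> y)"
      proof (rule const)
        show "smooth_on W (br (xs' ! ?i) (xs' ! ?j))" using smooth_br[OF W(1) WU0 sxs'[OF ijn(1)] sxs'[OF ijn(2)]] .
        show "\<forall>w\<in>W. \<forall>l<2 * r. br (br (xs' ! ?i) (xs' ! ?j)) (xs' ! l) w = 0"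
        proof (intro ballI allI impI)
          fix w l assume w: "w \<in> W" and l: "l < 2 * r"
          have "l < ?n" using l r by simp
          then show "br (br (xs' ! ?i) (xs' ! ?j)) (xs' ! l) w = 0"
            by (intro br_br_zero[OF W(1) WU0 sxs'[OF ijn(1)] sxs'[OF ijn(2)] sxs' w] canonical_matrix_z(1)[OF B' _ l] ij)
        qed
        show "\<phi> x \<in> W" "\<phi> y \<in> W" using xU xy by auto
        show "\<forall>k<?s. z' k (\<phi> x) = z' k (\<phi> y)" using zxy by (simp add: z_def)
      qed
      moreover have "xs ! ?i = z i" "xs ! ?j = z j" using ij by (simp_all only: xs_def pqz_nth)
      ultimately show ?thesis using BX[OF xy(1) ijn] BX[OF xy(2) ijn] by simp
    qed
  qed
qed

end

section \<open>Rank and normal form\<close>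

lemma independent_eval:
  fixes u :: "nat \<Rightarrow> 'b \<Rightarrow> real" and pt :: "nat \<Rightarrow> 'b"
  assumes I: "finite I" and c: "\<And>k. k \<in> I \<Longrightarrow> c k \<noteq> 0"
    and u: "\<And>k l. k \<in> I \<Longrightarrow> l \<in> I \<Longrightarrow> u k (pt l) = (if k = l then c l else 0)"
  shows "inj_on u I" "\<not> module.dependent fscale (u ` I)"
proof -
  interpret vector_space "fscale :: real \<Rightarrow> ('b \<Rightarrow> real) \<Rightarrow> 'b \<Rightarrow> real" by (rule vector_space_fscale)
  show inj: "inj_on u I"
  proof (rule inj_onI)
    fix k l assume kl: "k \<in> I" "l \<in> I" "u k = u l"
    then have "u k (pt k) = u l (pt k)" by simp
    then show "k = l" using u[OF kl(1,1)] u[OF kl(2,1)] c[OF kl(1)] by (auto split: if_splits)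
  qed
  show "\<not> dependent (u ` I)"
  proof
    assume "dependent (u ` I)"
    then obtain t w where t: "finite t" "t \<subseteq> u ` I" "(\<Sum>v\<in>t. fscale (w v) v) = 0" "\<exists>v\<in>t. w v \<noteq> 0"
      unfolding dependent_explicit by blast
    then obtain l where l: "l \<in> I" "u l \<in> t" "w (u l) \<noteq> 0" by blast
    have "(\<Sum>v\<in>t. fscale (w v) v) (pt l) = (\<Sum>v\<in>t. if v = u l then w (u l) * c l else 0)"
      unfolding sum_fun_apply
    proof (rule sum.cong[OF refl])
      fix v assume "v \<in> t"
      then obtain k where k: "k \<in> I" "v = u k" using t(2) by blast
      have "u k = u l \<longleftrightarrow> k = l" using inj k(1) l(1) by (auto simp: inj_on_def)
      then show "fscale (w v) v (pt l) = (if v = u l then w (u l) * c l else 0)"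
        using u[OF k(1) l(1)] k(2) by (auto simp: fscale_def)
    qed
    also have "\<dots> = w (u l) * c l" using t(1) l(2) by simp
    finally show False using t(3) l c by simp
  qed
qed

lemma pqz_sum:
  fixes h :: "nat \<Rightarrow> real"
  shows "(\<Sum>k<2 * r + s. h k) = (\<Sum>i<r. h (2 * i)) + (\<Sum>i<r. h (2 * i + 1)) + (\<Sum>j<s. h (2 * r + j))"
proof -
  have "(\<Sum>k<2 * r. h k) = (\<Sum>i<r. h (2 * i)) + (\<Sum>i<r. h (2 * i + 1))"
    by (induction r) auto
  moreover have "(\<Sum>k<2 * r + s. h k) = (\<Sum>k<2 * r. h k) + (\<Sum>j<s. h (2 * r + j))"
    by (induction s) auto
  ultimately show ?thesis by simp
qed

lemma canonical_form_sum:
  assumes B: "canonical_matrix r s B"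
  shows "(\<Sum>k<2 * r + s. \<Sum>l<2 * r + s. a k * b l * B k l) =
    (\<Sum>i<r. a (2 * i + 1) * b (2 * i) - b (2 * i + 1) * a (2 * i)) +
    (\<Sum>i<s. \<Sum>j<s. B (2 * r + i) (2 * r + j) / 2 * (a (2 * r + i) * b (2 * r + j) - b (2 * r + i) * a (2 * r + j)))"
proof -
  note D = canonical_matrixD[OF B]
  let ?Z = "\<lambda>i j. B (2 * r + i) (2 * r + j)"
  have p: "(\<Sum>l<2 * r + s. a (2 * i) * b l * B (2 * i) l) = - a (2 * i) * b (2 * i + 1)" if i: "i < r" for i
  proof -
    have "(\<Sum>j<r. a (2 * i) * b (2 * j + 1) * B (2 * i) (2 * j + 1)) = (\<Sum>j<r. if j = i then - a (2 * i) * b (2 * i + 1) else 0)"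
      by (rule sum.cong[OF refl]) (subst D(5)[OF i], auto)
    then show ?thesis unfolding pqz_sum using i D(2)[OF i] D(8)[OF _ i] by simp
  qed
  have q: "(\<Sum>l<2 * r + s. a (2 * i + 1) * b l * B (2 * i + 1) l) = a (2 * i + 1) * b (2 * i)" if i: "i < r" for i
  proof -
    have "(\<Sum>j<r. a (2 * i + 1) * b (2 * j) * B (2 * i + 1) (2 * j)) = (\<Sum>j<r. if j = i then a (2 * i + 1) * b (2 * i) else 0)"
      by (rule sum.cong[OF refl]) (subst D(4)[OF i], auto)
    then show ?thesis unfolding pqz_sum using i D(3)[OF i] D(9)[OF _ i] by simp
  qed
  have z: "(\<Sum>l<2 * r + s. a (2 * r + i) * b l * B (2 * r + i) l) = (\<Sum>j<s. a (2 * r + i) * b (2 * r + j) * ?Z i j)" if i: "i < s" for i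
    unfolding pqz_sum using D(6)[OF i] D(7)[OF i] by simp
  have "(\<Sum>i<s. \<Sum>j<s. b (2 * r + i) * a (2 * r + j) * ?Z i j) = (\<Sum>j<s. \<Sum>i<s. b (2 * r + i) * a (2 * r + j) * ?Z i j)"
    by (rule sum.swap)
  also have "\<dots> = (\<Sum>j<s. \<Sum>i<s. - (a (2 * r + j) * b (2 * r + i) * ?Z j i))"
  proof (intro sum.cong refl)
    show "b (2 * r + i) * a (2 * r + j) * ?Z i j = - (a (2 * r + j) * b (2 * r + i) * ?Z j i)" for i j
      using D(1)[of "2 * r + i" "2 * r + j"] by simp
  qed
  also have "\<dots> = - (\<Sum>i<s. \<Sum>j<s. a (2 * r + i) * b (2 * r + j) * ?Z i j)" by (simp add: sum_negf)
  finally have swap: "(\<Sum>i<s. \<Sum>j<s. b (2 * r + i) * a (2 * r + j) * ?Z i j) = - (\<Sum>i<s. \<Sum>j<s. a (2 * r + i) * b (2 * r + j) * ?Z i j)" .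
  have "(\<Sum>i<s. \<Sum>j<s. ?Z i j / 2 * (a (2 * r + i) * b (2 * r + j) - b (2 * r + i) * a (2 * r + j)))
    = (\<Sum>i<s. \<Sum>j<s. 1/2 * (a (2 * r + i) * b (2 * r + j) * ?Z i j) - 1/2 * (b (2 * r + i) * a (2 * r + j) * ?Z i j))"
    by (intro sum.cong refl) (simp add: algebra_simps)
  also have "\<dots> = 1/2 * (\<Sum>i<s. \<Sum>j<s. a (2 * r + i) * b (2 * r + j) * ?Z i j) - 1/2 * (\<Sum>i<s. \<Sum>j<s. b (2 * r + i) * a (2 * r + j) * ?Z i j)"
    by (simp only: sum_subtractf sum_distrib_left)
  also have "\<dots> = (\<Sum>i<s. \<Sum>j<s. a (2 * r + i) * b (2 * r + j) * ?Z i j)" unfolding swap by simp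
  finally have Z: "(\<Sum>i<s. \<Sum>j<s. ?Z i j / 2 * (a (2 * r + i) * b (2 * r + j) - b (2 * r + i) * a (2 * r + j)))
    = (\<Sum>i<s. \<Sum>j<s. a (2 * r + i) * b (2 * r + j) * ?Z i j)" .
  have "(\<Sum>k<2 * r + s. \<Sum>l<2 * r + s. a k * b l * B k l) =
    (\<Sum>i<r. \<Sum>l<2 * r + s. a (2 * i) * b l * B (2 * i) l) + (\<Sum>i<r. \<Sum>l<2 * r + s. a (2 * i + 1) * b l * B (2 * i + 1) l) +
    (\<Sum>i<s. \<Sum>l<2 * r + s. a (2 * r + i) * b l * B (2 * r + i) l)"
    by (rule pqz_sum)
  also have "\<dots> = (\<Sum>i<r. - a (2 * i) * b (2 * i + 1)) + (\<Sum>i<r. a (2 * i + 1) * b (2 * i)) +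
    (\<Sum>i<s. \<Sum>j<s. a (2 * r + i) * b (2 * r + j) * ?Z i j)"
    (is "?p + ?q + ?z = ?p' + ?q' + ?z'")
  proof -
    have "?p = ?p'" by (rule sum.cong[OF refl]) (rule p, simp)
    moreover have "?q = ?q'" by (rule sum.cong[OF refl]) (rule q, simp)
    moreover have "?z = ?z'" by (rule sum.cong[OF refl]) (rule z, simp)
    ultimately show ?thesis by (simp only:)
  qed
  also have "(\<Sum>i<r. - a (2 * i) * b (2 * i + 1)) + (\<Sum>i<r. a (2 * i + 1) * b (2 * i))
    = (\<Sum>i<r. a (2 * i + 1) * b (2 * i) - b (2 * i + 1) * a (2 * i))"
    unfolding sum.distrib[symmetric] by (rule sum.cong) (simp_all add: algebra_simps)
  finally show ?thesis unfolding Z .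
qed

context poisson_mfd
begin

lemma coordinate_expand_right:
  assumes cs: "coordinate_system A U xs" and x: "x \<in> U"
    and \<alpha>: "\<alpha> \<in> cotangent_space A x" "\<beta> \<in> cotangent_space A x"
  shows "P x \<alpha> \<beta> = (\<Sum>l<DIM('e). \<beta> (coord_vf A U xs l x) * P x \<alpha> (differential A (xs ! l) x))"
proof -
  have c: "(U, coord_map xs) \<in> maximal_atlas A" using cs by (simp add: coordinate_system_def)
  have "P x \<alpha> \<beta> = (\<Sum>l<DIM('e). \<beta> (dir_vec U (coord_map xs) x (basis_enum l)) *
      P x \<alpha> (differential A (\<lambda>y. (coord_map xs y :: 'e) \<bullet> basis_enum l) x))"
    unfolding bivector_expand_right[OF c x bivector \<alpha>]
    by (rule sum.reindex_bij_betw[OF bij_basis_enum, symmetric])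
  then show ?thesis by (simp add: coord_vf_eq coordinate_inner[OF cs])
qed

lemma coordinate_expand:
  assumes cs: "coordinate_system A U xs" and x: "x \<in> U"
    and \<alpha>: "\<alpha> \<in> cotangent_space A x" "\<beta> \<in> cotangent_space A x"
  shows "P x \<alpha> \<beta> = (\<Sum>k<DIM('e). \<Sum>l<DIM('e). \<alpha> (coord_vf A U xs k x) * \<beta> (coord_vf A U xs l x) *
    bracket A P (xs ! k) (xs ! l) x)"
proof -
  have *: "P x \<alpha> (differential A (xs ! l) x) = (\<Sum>k<DIM('e). \<alpha> (coord_vf A U xs k x) * bracket A P (xs ! k) (xs ! l) x)" for l
  proof -
    have "P x \<alpha> (differential A (xs ! l) x) = - P x (differential A (xs ! l) x) \<alpha>"
      by (rule bivector_skew[OF bivector \<alpha>(1) differential_cotangent])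
    also have "\<dots> = (\<Sum>k<DIM('e). \<alpha> (coord_vf A U xs k x) * - bracket A P (xs ! l) (xs ! k) x)"
      unfolding coordinate_expand_right[OF cs x differential_cotangent \<alpha>(1)] by (simp add: sum_negf bracket_def)
    also have "\<dots> = (\<Sum>k<DIM('e). \<alpha> (coord_vf A U xs k x) * bracket A P (xs ! k) (xs ! l) x)"
      by (intro sum.cong refl arg_cong2[where f = "(*)"]) (rule bracket_skew[symmetric])
    finally show ?thesis .
  qed
  have "P x \<alpha> \<beta> = (\<Sum>l<DIM('e). \<Sum>k<DIM('e). \<alpha> (coord_vf A U xs k x) * \<beta> (coord_vf A U xs l x) * bracket A P (xs ! k) (xs ! l) x)"
    unfolding coordinate_expand_right[OF cs x \<alpha>] * by (simp add: sum_distrib_left mult_ac)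
  then show ?thesis by (subst sum.swap)
qed

text \<open>The vectors \<open>sharp (d\<xi>\<^sub>l)\<close>, for \<open>l < 2 * r\<close>, are told apart by their values on the conjugate
  coordinates, and a nonzero \<open>{z\<^sub>i, z\<^sub>j}\<close> provides one more independent vector.\<close>

lemma rank_canonical:
  assumes cs: "coordinate_system A U xs" and m: "m \<in> U" and n: "DIM('e) = 2 * r + s"
    and B: "canonical_matrix r s (\<lambda>k l. bracket A P (xs ! k) (xs ! l) m)"
  shows "poisson_rank A P m = 2 * r \<longleftrightarrow> (\<forall>i<s. \<forall>j<s. bracket A P (xs ! (2 * r + i)) (xs ! (2 * r + j)) m = 0)"
proof -
  interpret vs: vector_space "fscale :: real \<Rightarrow> 'a tvec \<Rightarrow> 'a tvec" by (rule vector_space_fscale)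
  have c: "(U, coord_map xs) \<in> maximal_atlas A" using cs by (simp add: coordinate_system_def)
  let ?n = "DIM('e)"
  define b where "b k l = bracket A P (xs ! k) (xs ! l) m" for k l
  note D = canonical_matrixD[OF B, folded b_def] and Dz = canonical_matrix_z[OF B, folded b_def]
  define u where "u l = sharp A P m (differential A (xs ! l) m)" for l
  define R where "R = sharp A P m ` cotangent_space A m"
  have uR: "u l \<in> R" for l unfolding u_def R_def using differential_cotangent by blast
  have xs_near: "xs ! k \<in> smooth_near A m" if "k < ?n" for k
    using inner_chart_near[OF c m, of "basis_enum k"] coordinate_inner[OF cs that] by simp
  have ub: "u l (xs ! k) = b k l" if "k < ?n" for k l
    using xs_near[OF that] by (simp add: u_def sharp_def b_def bracket_def)
  have sharp_eq: "sharp A P m \<beta> = (\<Sum>l<?n. fscale (\<beta> (coord_vf A U xs l m)) (u l))" if \<beta>: "\<beta> \<in> cotangent_space A m" for \<beta>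
  proof
    fix f
    show "sharp A P m \<beta> f = (\<Sum>l<?n. fscale (\<beta> (coord_vf A U xs l m)) (u l)) f"
    proof (cases "f \<in> smooth_near A m")
      case True
      then show ?thesis
        using coordinate_expand_right[OF cs m differential_cotangent \<beta>, of f]
        by (simp add: sum_fun_apply fscale_def u_def sharp_def)
    next
      case False
      then show ?thesis by (simp add: sum_fun_apply fscale_def u_def sharp_def)
    qed
  qed
  have Rspan: "R \<subseteq> vs.span (u ` {..<?n})"
  proof -
    have "sharp A P m \<beta> \<in> vs.span (u ` {..<?n})" if "\<beta> \<in> cotangent_space A m" for \<beta>
      unfolding sharp_eq[OF that] by (intro vs.span_sum vs.span_scale) (rule vs.span_base, simp)
    then show ?thesis by (auto simp: R_def)
  qed
  define pt where "pt l = xs ! (if even l then l + 1 else l - 1)" for l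
  have u_pt: "u k (pt l) = (if k = l then (if even l then 1 else - 1) else 0)" if kl: "k < 2 * r" "l < 2 * r" for k l
  proof -
    obtain i where i: "i < r" "k = 2 * i \<or> k = 2 * i + 1"
      using kl(1) index_even_odd by blast
    obtain j where j: "j < r" "l = 2 * j \<or> l = 2 * j + 1"
      using kl(2) index_even_odd by blast
    from j(2) show ?thesis
    proof
      assume l: "l = 2 * j"
      then have "u k (pt l) = b (2 * j + 1) k" using ub[of "2 * j + 1" k] j(1) n by (simp add: pt_def)
      moreover have "k = 2 * i + 1 \<Longrightarrow> k \<noteq> l" using l by presburger
      ultimately show ?thesis using i(2) l D(3,4)[OF j(1) i(1)] by (auto split: if_splits)
    next
      assume l: "l = 2 * j + 1"
      then have "u k (pt l) = b (2 * j) k" using ub[of "2 * j" k] j(1) n by (simp add: pt_def)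
      moreover have "k = 2 * i \<Longrightarrow> k \<noteq> l" using l by presburger
      ultimately show ?thesis using i(2) l D(2,5)[OF j(1) i(1)] by (auto split: if_splits)
    qed
  qed
  have ind: "inj_on u {..<2 * r}" "\<not> vs.dependent (u ` {..<2 * r})"
    using independent_eval[of "{..<2 * r}" "\<lambda>l. if even l then 1 else - 1" u pt] u_pt by auto
  show ?thesis
  proof
    assume zero: "\<forall>i<s. \<forall>j<s. bracket A P (xs ! (2 * r + i)) (xs ! (2 * r + j)) m = 0"
    have u0: "u (2 * r + j) = 0" if j: "j < s" for j
    proof
      fix f
      have "b k (2 * r + j) = 0" if "k < ?n" for k
      proof -
        have "k < 2 * r + s" using that n by simp
        then show ?thesis
          by (rule pqz_index_cases) (use D(8,9)[OF j] zero j in \<open>auto simp: b_def\<close>)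
      qed
      then have "P m \<alpha> (differential A (xs ! (2 * r + j)) m) = 0" if \<alpha>: "\<alpha> \<in> cotangent_space A m" for \<alpha>
      proof -
        have "P m \<alpha> (differential A (xs ! (2 * r + j)) m) = - P m (differential A (xs ! (2 * r + j)) m) \<alpha>"
          by (rule bivector_skew[OF bivector \<alpha> differential_cotangent])
        also have "P m (differential A (xs ! (2 * r + j)) m) \<alpha> = (\<Sum>l<?n. \<alpha> (coord_vf A U xs l m) * b (2 * r + j) l)"
          using coordinate_expand_right[OF cs m differential_cotangent \<alpha>] by (simp add: b_def bracket_def)
        also have "\<dots> = 0"
          using \<open>\<And>k. k < ?n \<Longrightarrow> b k (2 * r + j) = 0\<close> D(1)[of "2 * r + j"] by (intro sum.neutral) auto
        finally show ?thesis by simp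
      qed
      then show "u (2 * r + j) f = 0 f" using differential_cotangent by (simp add: u_def sharp_def)
    qed
    have "R \<subseteq> vs.span (u ` {..<2 * r})"
    proof -
      have "u l \<in> vs.span (u ` {..<2 * r})" if "l < ?n" for l
      proof (cases "l < 2 * r")
        case True
        then show ?thesis by (intro vs.span_base) auto
      next
        case False
        then have "u l = 0" using u0[of "l - 2 * r"] that n by simp
        then show ?thesis using vs.span_zero by metis
      qed
      then have "sharp A P m \<beta> \<in> vs.span (u ` {..<2 * r})" if "\<beta> \<in> cotangent_space A m" for \<beta>
        unfolding sharp_eq[OF that] by (intro vs.span_sum vs.span_scale) simp
      then show ?thesis by (auto simp: R_def)
    qed
    moreover have "u ` {..<2 * r} \<subseteq> R" using uR by blast
    ultimately show "poisson_rank A P m = 2 * r"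
      unfolding poisson_rank_def R_def[symmetric]
      using vs.dim_unique[OF _ _ ind(2) card_image[OF ind(1)]] by simp
  next
    assume rank: "poisson_rank A P m = 2 * r"
    show "\<forall>i<s. \<forall>j<s. bracket A P (xs ! (2 * r + i)) (xs ! (2 * r + j)) m = 0"
    proof (rule ccontr)
      assume "\<not> ?thesis"
      then obtain i j where ij: "i < s" "j < s" "b (2 * r + i) (2 * r + j) \<noteq> 0" by (auto simp: b_def)
      define u' where "u' l = (if l < 2 * r then u l else u (2 * r + j))" for l
      define pt' where "pt' l = (if l < 2 * r then pt l else xs ! (2 * r + i))" for l
      define cc where "cc l = (if l < 2 * r then if even l then 1 else - 1 else b (2 * r + i) (2 * r + j))" for l
      have "u' k (pt' l) = (if k = l then cc l else 0)" if kl: "k < Suc (2 * r)" "l < Suc (2 * r)" for k l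
      proof -
        have 1: "u (2 * r + j) (pt l) = 0" if l: "l < 2 * r" for l
          using ub[of "if even l then l + 1 else l - 1" "2 * r + j"] Dz(2)[OF ij(2), of "if even l then l + 1 else l - 1"]
            index_even_odd[OF l] n by (auto simp: pt_def)
        have 2: "u k (xs ! (2 * r + i)) = 0" if k: "k < 2 * r" for k
          using ub[of "2 * r + i" k] Dz(1)[OF ij(1) k] ij(1) n by simp
        have 3: "u (2 * r + j) (xs ! (2 * r + i)) = b (2 * r + i) (2 * r + j)"
          using ub[of "2 * r + i" "2 * r + j"] ij n by simp
        show ?thesis using kl u_pt[of k l] 1[of l] 2[of k] 3 by (auto simp: u'_def pt'_def cc_def)
      qed
      then have ind': "inj_on u' {..<Suc (2 * r)}" "\<not> vs.dependent (u' ` {..<Suc (2 * r)})"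
        using independent_eval[of "{..<Suc (2 * r)}" cc u' pt'] ij(3) by (auto simp: cc_def)
      obtain C where C: "C \<subseteq> R" "\<not> vs.dependent C" "R \<subseteq> vs.span C" "card C = vs.dim R"
        by (rule vs.basis_exists)
      have "finite C" using vs.independent_span_bound[of "u ` {..<?n}" C] C(1,2) Rspan by auto
      moreover have "u' ` {..<Suc (2 * r)} \<subseteq> vs.span C" using uR C(3) by (auto simp: u'_def)
      ultimately have "card (u' ` {..<Suc (2 * r)}) \<le> card C"
        using vs.independent_span_bound[OF _ ind'(2)] by blast
      then show False using C(4) rank card_image[OF ind'(1)] by (simp add: poisson_rank_def R_def)
    qed
  qed
qed

end

theorem theorem2p1:
  fixes A :: "('a::{t2_space, second_countable_topology}, 'e::euclidean_space) chart set"
    and P :: "'a \<Rightarrow> 'a bivec"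
    and m :: 'a and n r :: nat
    and V :: "'a set" and p :: "nat \<Rightarrow> 'a \<Rightarrow> real"
  assumes poisson: "poisson_manifold A P"
    and dim: "n = DIM('e)"
    and nbhd: "open V" "m \<in> V"
    and smooth: "\<And>i. i < r \<Longrightarrow> smooth_fun A V (p i)"
    and involution: "\<And>i j x. i < r \<Longrightarrow> j < r \<Longrightarrow> x \<in> V \<Longrightarrow> bracket A P (p i) (p j) x = 0"
    and vanish: "\<And>i. i < r \<Longrightarrow> p i m = 0"
    and indep: "lin_indep_family r (\<lambda>i. hamiltonian_vf A P (p i) m)"
  shows "\<exists>U q z g.
      open U \<and> m \<in> U \<and> U \<subseteq> V \<and>
      (let xs = pqz r (n - 2 * r) p q z;
           dp = (\<lambda>i. coord_vf A U xs (2 * i));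
           dq = (\<lambda>i. coord_vf A U xs (2 * i + 1));
           dz = (\<lambda>i. coord_vf A U xs (2 * r + i))
       in coordinate_system A U xs \<and> centered_at m xs \<and>
          (\<forall>x\<in>U. \<forall>\<alpha>\<in>cotangent_space A x. \<forall>\<beta>\<in>cotangent_space A x.
             P x \<alpha> \<beta> =
               (\<Sum>i<r. wedge (dq i x) (dp i x) \<alpha> \<beta>) +
               (\<Sum>i<n - 2 * r. \<Sum>j<n - 2 * r. g i j x * wedge (dz i x) (dz j x) \<alpha> \<beta>))) \<and>
      (\<forall>i<n - 2 * r. \<forall>j<n - 2 * r.
         smooth_fun A U (g i j) \<and>
         (\<forall>x\<in>U. \<forall>y\<in>U. (\<forall>k<n - 2 * r. z k x = z k y) \<longrightarrow> g i j x = g i j y) \<and>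
         (\<forall>x\<in>U. g i j x = - g j i x)) \<and>
      (poisson_rank A P m = 2 * r \<longleftrightarrow>
         (\<forall>i<n - 2 * r. \<forall>j<n - 2 * r. \<forall>x\<in>U.
            (\<forall>k<n - 2 * r. z k x = 0) \<longrightarrow> g i j x = 0))"
proof -
  interpret poisson_mfd A P using poisson by unfold_locales
  let ?s = "DIM('e) - 2 * r"
  obtain U q z xs where U: "open U" "m \<in> U" "U \<subseteq> V" and r: "2 * r \<le> DIM('e)" and xs: "xs = pqz r ?s p q z"
    and cs: "coordinate_system A U xs" and centered: "centered_at m xs"
    and B: "\<And>x. x \<in> U \<Longrightarrow> canonical_matrix r ?s (\<lambda>k l. bracket A P (xs ! k) (xs ! l) x)"
    and zz: "\<And>i j x y. \<lbrakk>i < ?s; j < ?s; x \<in> U; y \<in> U; \<forall>k<?s. z k x = z k y\<rbrakk>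
      \<Longrightarrow> bracket A P (z i) (z j) x = bracket A P (z i) (z j) y"
  proof (rule canonical_chart[OF nbhd, of r p])
    show "smooth_fun A V (p i)" "p i m = 0" if "i < r" for i using smooth[OF that] vanish[OF that] .
    show "bracket A P (p i) (p j) x = 0" if "i < r" "j < r" "x \<in> V" for i j x using involution[OF that] .
    show "lin_indep_family r (\<lambda>i. hamiltonian_vf A P (p i) m)" by (rule indep)
  qed (rule that, assumption+)
  define g where "g i j x = 1 / 2 * bracket A P (z i) (z j) x" for i j x
  have ns: "DIM('e) = 2 * r + ?s" using r by simp
  have nth_z: "xs ! (2 * r + k) = z k" if "k < ?s" for k using that by (simp only: xs pqz_nth)
  have z0: "z k m = 0" if "k < ?s" for k
  proof -
    have "2 * r + k < length xs" using that by (simp add: xs length_pqz)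
    then show ?thesis using centered nth_mem nth_z[OF that] unfolding centered_at_def by metis
  qed
  have form: "P x \<alpha> \<beta> = (\<Sum>i<r. wedge (coord_vf A U xs (2 * i + 1) x) (coord_vf A U xs (2 * i) x) \<alpha> \<beta>) +
      (\<Sum>i<?s. \<Sum>j<?s. g i j x * wedge (coord_vf A U xs (2 * r + i) x) (coord_vf A U xs (2 * r + j) x) \<alpha> \<beta>)"
    if "x \<in> U" "\<alpha> \<in> cotangent_space A x" "\<beta> \<in> cotangent_space A x" for x \<alpha> \<beta>
  proof -
    have "P x \<alpha> \<beta> = (\<Sum>k<2 * r + ?s. \<Sum>l<2 * r + ?s. \<alpha> (coord_vf A U xs k x) * \<beta> (coord_vf A U xs l x) *
        bracket A P (xs ! k) (xs ! l) x)"
      using coordinate_expand[OF cs that] ns by simp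
    also note canonical_form_sum[OF B[OF that(1)]]
    also have "(\<Sum>i<?s. \<Sum>j<?s. bracket A P (xs ! (2 * r + i)) (xs ! (2 * r + j)) x / 2 *
        (\<alpha> (coord_vf A U xs (2 * r + i) x) * \<beta> (coord_vf A U xs (2 * r + j) x) -
         \<beta> (coord_vf A U xs (2 * r + i) x) * \<alpha> (coord_vf A U xs (2 * r + j) x))) =
      (\<Sum>i<?s. \<Sum>j<?s. g i j x * wedge (coord_vf A U xs (2 * r + i) x) (coord_vf A U xs (2 * r + j) x) \<alpha> \<beta>)"
      by (intro sum.cong refl) (simp add: g_def wedge_def nth_z)
    finally show ?thesis by (simp add: wedge_def)
  qed
  have gs: "smooth_fun A U (g i j)" if "i < ?s" "j < ?s" for i j
    unfolding g_def[abs_def]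
  proof (rule smooth_fun_cmult[OF U(1) smooth_bracket[OF U(1)]])
    show "smooth_fun A U (z i)" "smooth_fun A U (z j)"
      using coordinate_smooth[OF cs, of "2 * r + i"] coordinate_smooth[OF cs, of "2 * r + j"] nth_z that ns by auto
  qed
  have rank: "poisson_rank A P m = 2 * r \<longleftrightarrow> (\<forall>i<?s. \<forall>j<?s. \<forall>x\<in>U. (\<forall>k<?s. z k x = 0) \<longrightarrow> g i j x = 0)"
  proof -
    have "poisson_rank A P m = 2 * r \<longleftrightarrow> (\<forall>i<?s. \<forall>j<?s. bracket A P (z i) (z j) m = 0)"
      using rank_canonical[OF cs U(2) ns B[OF U(2)]] nth_z by auto
    also have "\<dots> \<longleftrightarrow> (\<forall>i<?s. \<forall>j<?s. \<forall>x\<in>U. (\<forall>k<?s. z k x = 0) \<longrightarrow> g i j x = 0)"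
    proof (intro iffI allI impI ballI)
      fix i j x assume "\<forall>i<?s. \<forall>j<?s. bracket A P (z i) (z j) m = 0" "i < ?s" "j < ?s" "x \<in> U" "\<forall>k<?s. z k x = 0"
      then show "g i j x = 0" using zz[of i j x m] U(2) z0 by (simp add: g_def)
    next
      fix i j assume "\<forall>i<?s. \<forall>j<?s. \<forall>x\<in>U. (\<forall>k<?s. z k x = 0) \<longrightarrow> g i j x = 0" "i < ?s" "j < ?s"
      then have "g i j m = 0" using U(2) z0 by blast
      then show "bracket A P (z i) (z j) m = 0" by (simp add: g_def)
    qed
    finally show ?thesis .
  qed
  have gprops: "\<forall>i<?s. \<forall>j<?s. smooth_fun A U (g i j) \<and>
      (\<forall>x\<in>U. \<forall>y\<in>U. (\<forall>k<?s. z k x = z k y) \<longrightarrow> g i j x = g i j y) \<and> (\<forall>x\<in>U. g i j x = - g j i x)"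
  proof (intro allI impI conjI ballI)
    fix i j assume ij: "i < ?s" "j < ?s"
    show "smooth_fun A U (g i j)" by (rule gs[OF ij])
    show "g i j x = g i j y" if "x \<in> U" "y \<in> U" "\<forall>k<?s. z k x = z k y" for x y
      using zz[OF ij that] by (simp add: g_def)
    show "g i j x = - g j i x" for x using bracket_skew[of "z i" "z j" x] by (simp add: g_def)
  qed
  show ?thesis
    unfolding Let_def dim
  proof (rule exI[of _ U], rule exI[of _ q], rule exI[of _ z], rule exI[of _ g], intro conjI)
    show "coordinate_system A U (pqz r ?s p q z)" "centered_at m (pqz r ?s p q z)"
      using cs centered by (simp_all add: xs)
    show "\<forall>x\<in>U. \<forall>\<alpha>\<in>cotangent_space A x. \<forall>\<beta>\<in>cotangent_space A x. P x \<alpha> \<beta> =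
      (\<Sum>i<r. wedge (coord_vf A U (pqz r ?s p q z) (2 * i + 1) x) (coord_vf A U (pqz r ?s p q z) (2 * i) x) \<alpha> \<beta>) +
      (\<Sum>i<?s. \<Sum>j<?s. g i j x * wedge (coord_vf A U (pqz r ?s p q z) (2 * r + i) x) (coord_vf A U (pqz r ?s p q z) (2 * r + j) x) \<alpha> \<beta>)"
      using form unfolding xs by blast
  qed (rule U gprops rank)+
qed

end
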